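(* Let $G$ be a finitely generated group with $b_1(G)=1$ and $\Delta^G\not\doteq\mathrm{const}$. Let $z_1,\dots,z_s$ be the distinct roots of $\Delta^G$ in $\mathbb{C}^*$, with multiplicities $\mu_1,\dots,\mu_s$, so that $\Delta^G\doteq_{\mathbb{C}}(t-z_1)^{\mu_1}\cdots(t-z_s)^{\mu_s}$, and let $e_k(z_j)$ be the exponents in the decomposition $$B_G\otimes\mathbb{C}=\bigoplus_{j=1}^s\bigoplus_{k\ge1}\bigl(\Lambda/(t-z_j)^k\Lambda\bigr)^{e_k(z_j)}.$$ Then, for $j=1,\dots,s$, $$b_1(G,z_j)=\mu_j\iff e_k(z_j)=0\ \text{ for all } k>1.$$
   Context: Let $G$ be a finitely generated group with $b_1(G)=1$, so that $G_{\mathrm{abf}}=G_{\mathrm{ab}}/\mathrm{Torsion}\cong\mathbb{Z}$; let $\phi\colon G\to\mathbb{Z}$ be the projection, and identify $\mathbb{Z}[G_{\mathrm{abf}}]=\Lambda_1=\mathbb{Z}[t^{\pm1}]$. Set $\Lambda=\Lambda_1\otimes\mathbb{C}=\mathbb{C}[t^{\pm1}]$. The Alexander module is $A_G=\mathbb{Z}[G_{\mathrm{abf}}]\otimes_{\mathbb{Z}[G]}I_G$, where $I_G$ is the augmentation ideal of $\mathbb{Z}[G]$. If $\Lambda_1^h\to\Lambda_1^m\to A_G\to0$ is a presentation, $\mathcal{E}_1(A_G)$ is the ideal generated by the minors of size $m-1$ of the presentation matrix (equal to $\Lambda_1$ if $m\le1$, and to $0$ if $m-1>h$), and the Alexander polynomial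 $\Delta^G\in\Lambda_1$ is the greatest common divisor of all elements of $\mathcal{E}_1(A_G)$, up to units. $\doteq$ (resp. $\doteq_{\mathbb{C}}$) is equality up to units of $\Lambda_1$ (resp. $\Lambda$); $\Delta\doteq\mathrm{const}$ means $\Delta\doteq c$ for some $c\in\mathbb{Z}$ (including $c=0$). The Alexander invariant $B_G$ is the $\Lambda_1$-module $H_1(\ker\phi;\mathbb{Z})=\ker\phi/[\ker\phi,\ker\phi]$, with $\mathbb{Z}=G/\ker\phi$ acting by conjugation (equivalently $H_1$ of the infinite cyclic cover associated to $\phi$ of a CW-complex with fundamental group $G$). When $b_1(G)=1$ and $\Delta^G\not\doteq\mathrm{const}$, $B_G\otimes\mathbb{C}$ is a non-zero, finitely generated torsion $\Lambda$-module, supported exactly at the roots $z_1,\dots,z_s\in\mathbb{C}\setminus\{0,1\}$ of $\Delta^G$, so it has a decomposition as displayed, with non-negative integers $e_k(z_j)$, finitely many of which are non-zero. A number $z\in\mathbb{C}^*$ defines the character $G\xrightarrow{\phi}\mathbb{Z}\to\mathbb{C}^*$ sending the generator $t$ to $z$; $\mathbb{C}_z$ is the corresponding rank one local system and $b_1(G,z)=\dim_{\mathbb{C}}H_1(G;\mathbb{C}_z)$. *)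

theory Defs
  imports
    "HOL-Algebra.Free_Abelian_Groups"
    "HOL-Algebra.Ideal"
    "Jordan_Normal_Form.DL_Rank_Submatrix"
begin

section \<open>Modules\<close>

text \<open>Modules are records of HOL-Algebra; their fields \<open>mult\<close> and \<open>one\<close> are irrelevant and are
  left undefined.  A commutative ring given by a type class is turned into a record by
  \<open>class_ring\<close>, and \<open>module_hom\<close> is the set of homomorphisms from the VectorSpace library.\<close>

definition module_isomorphic ::
  "('r, 'a) ring_scheme \<Rightarrow> ('r, 'm, 'b) module_scheme \<Rightarrow> ('r, 'n, 'c) module_scheme \<Rightarrow> bool" where
  "module_isomorphic R M N \<longleftrightarrow> (\<exists>f \<in> LinearCombinations.module_hom R M N. bij_betw f (carrier M) (carrier N))"

definition quot_module :: "('r, 'm, 'b) module_scheme \<Rightarrow> 'm set \<Rightarrow> ('r, 'm set) module" where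
  "quot_module M H = \<lparr>carrier = a_rcosets\<^bsub>M\<^esub> H, monoid.mult = undefined, one = undefined,
     zero = H, add = (<+>\<^bsub>M\<^esub>), smult = (\<lambda>r Y. \<Union>x\<in>Y. H +>\<^bsub>M\<^esub> (r \<odot>\<^bsub>M\<^esub> x))\<rparr>"

definition direct_sum_module :: "'i set \<Rightarrow> ('i \<Rightarrow> ('r, 'm) module) \<Rightarrow> ('r, 'i \<Rightarrow> 'm) module" where
  "direct_sum_module I M =
     \<lparr>carrier = {f \<in> (\<Pi>\<^sub>E i\<in>I. carrier (M i)). finite {i \<in> I. f i \<noteq> \<zero>\<^bsub>M i\<^esub>}},
      monoid.mult = undefined, one = undefined,
      zero = (\<lambda>i\<in>I. \<zero>\<^bsub>M i\<^esub>),
      add = (\<lambda>f g. \<lambda>i\<in>I. f i \<oplus>\<^bsub>M i\<^esub> g i),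
      smult = (\<lambda>r f. \<lambda>i\<in>I. r \<odot>\<^bsub>M i\<^esub> f i)\<rparr>"

definition regular_module :: "('r::comm_ring_1, 'r) module" where
  "regular_module = \<lparr>carrier = UNIV, monoid.mult = (*), one = 1, zero = 0, add = (+), smult = (*)\<rparr>"

text \<open>\<open>M \<otimes>\<^sub>S N\<close> as the quotient of the free abelian group on \<open>M \<times> N\<close> by the biadditivity and
  balancing relations.  Here \<open>ra x s\<close> is the right action of \<open>S\<close> on \<open>M\<close>, while \<open>S\<close> (possibly
  noncommutative) acts on the left on \<open>N\<close> by the scalar multiplication of \<open>N\<close>.  The argument
  \<open>act\<close> supplies a further module structure over a ring \<open>R\<close>: it sends \<open>r\<close> and \<open>(x, n)\<close> to a
  formal sum of pairs representing \<open>r \<cdot> (x \<otimes> n)\<close>.\<close>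

definition tensor_relators ::
  "('s, 'a) ring_scheme \<Rightarrow> ('m \<Rightarrow> 's \<Rightarrow> 'm) \<Rightarrow> ('m, 'b) ring_scheme \<Rightarrow> ('s, 'n, 'c) module_scheme
    \<Rightarrow> (('m \<times> 'n) \<Rightarrow>\<^sub>0 int) set" where
  "tensor_relators S ra M N =
     {frag_of (x \<oplus>\<^bsub>M\<^esub> y, n) - frag_of (x, n) - frag_of (y, n) | x y n.
        x \<in> carrier M \<and> y \<in> carrier M \<and> n \<in> carrier N} \<union>
     {frag_of (x, n \<oplus>\<^bsub>N\<^esub> n') - frag_of (x, n) - frag_of (x, n') | x n n'.
        x \<in> carrier M \<and> n \<in> carrier N \<and> n' \<in> carrier N} \<union>
     {frag_of (ra x s, n) - frag_of (x, s \<odot>\<^bsub>N\<^esub> n) | x s n.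
        x \<in> carrier M \<and> s \<in> carrier S \<and> n \<in> carrier N}"

definition tensor_module ::
  "('s, 'a) ring_scheme \<Rightarrow> ('m \<Rightarrow> 's \<Rightarrow> 'm) \<Rightarrow> ('r \<Rightarrow> 'm \<times> 'n \<Rightarrow> (('m \<times> 'n) \<Rightarrow>\<^sub>0 int)) \<Rightarrow>
    ('m, 'b) ring_scheme \<Rightarrow> ('s, 'n, 'c) module_scheme \<Rightarrow> ('r, (('m \<times> 'n) \<Rightarrow>\<^sub>0 int) set) module" where
  "tensor_module S ra act M N =
     quot_module
       \<lparr>carrier = carrier (free_Abelian_group (carrier M \<times> carrier N)),
        monoid.mult = undefined, one = undefined, zero = 0, add = (+),
        smult = (\<lambda>r. frag_extend (act r))\<rparr>
       (generate (free_Abelian_group (carrier M \<times> carrier N)) (tensor_relators S ra M N))"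


section \<open>Laurent polynomials\<close>

text \<open>The Laurent polynomial ring over a commutative ring \<open>'r\<close> is the type \<open>int \<Rightarrow>\<^sub>0 'r\<close> of
  finitely supported functions with the convolution product of \<open>HOL-Library.Poly_Mapping\<close>, that
  is, the group ring of the integers.  So \<open>int \<Rightarrow>\<^sub>0 int\<close> is \<open>\<Lambda>\<^sub>1\<close> and \<open>int \<Rightarrow>\<^sub>0 complex\<close> is \<open>\<Lambda>\<close>.\<close>

abbreviation tpow :: "int \<Rightarrow> int \<Rightarrow>\<^sub>0 'r::comm_ring_1" where
  "tpow i \<equiv> Poly_Mapping.single i 1"

abbreviation lconst :: "'r \<Rightarrow> int \<Rightarrow>\<^sub>0 'r::comm_ring_1" where
  "lconst c \<equiv> Poly_Mapping.single 0 c"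

definition eq_up_to_unit :: "'r::comm_ring_1 \<Rightarrow> 'r \<Rightarrow> bool" (infix \<open>\<doteq>\<close> 50) where
  "p \<doteq> q \<longleftrightarrow> (\<exists>u. u dvd 1 \<and> p = u * q)"

definition complexify :: "(int \<Rightarrow>\<^sub>0 int) \<Rightarrow> int \<Rightarrow>\<^sub>0 complex" where
  "complexify p = Poly_Mapping.map of_int p"

definition leval :: "(int \<Rightarrow>\<^sub>0 complex) \<Rightarrow> complex \<Rightarrow> complex" where
  "leval p z = (\<Sum>i\<in>Poly_Mapping.keys p. Poly_Mapping.lookup p i * z powi i)"

definition nonzero_roots :: "(int \<Rightarrow>\<^sub>0 int) \<Rightarrow> complex set" where
  "nonzero_roots p = {z. z \<noteq> 0 \<and> leval (complexify p) z = 0}"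


section \<open>The maximal torsion-free abelian quotient\<close>

definition finitely_generated :: "('g, 'a) monoid_scheme \<Rightarrow> bool" where
  "finitely_generated G \<longleftrightarrow>
     (\<exists>S. finite S \<and> S \<subseteq> carrier G \<and> generate G S = carrier G)"

definition abelianization :: "('g, 'a) monoid_scheme \<Rightarrow> 'g set monoid" where
  "abelianization G = G Mod derived G (carrier G)"

definition torsion_subgroup :: "('g, 'a) monoid_scheme \<Rightarrow> 'g set" where
  "torsion_subgroup H = {x \<in> carrier H. \<exists>n::nat. 0 < n \<and> x [^]\<^bsub>H\<^esub> n = \<one>\<^bsub>H\<^esub>}"

definition abf :: "('g, 'a) monoid_scheme \<Rightarrow> 'g set set monoid" where
  "abf G = abelianization G Mod torsion_subgroup (abelianization G)"

definition abf_projection :: "('g, 'a) monoid_scheme \<Rightarrow> ('g set set \<Rightarrow> int) \<Rightarrow> 'g \<Rightarrow> int" where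
  "abf_projection G \<psi> g =
     \<psi> (torsion_subgroup (abelianization G) #>\<^bsub>abelianization G\<^esub> (derived G (carrier G) #>\<^bsub>G\<^esub> g))"


section \<open>First homology with rank one coefficients\<close>

definition chain_space :: "'x set \<Rightarrow> (complex, 'x \<Rightarrow>\<^sub>0 complex) module" where
  "chain_space S = \<lparr>carrier = {c. Poly_Mapping.keys c \<subseteq> S}, monoid.mult = undefined, one = undefined,
     zero = 0, add = (+), smult = (\<lambda>a. Poly_Mapping.map ((*) a))\<rparr>"

text \<open>The inhomogeneous bar complex \<open>\<complex>\<^sub>\<rho> \<otimes>\<^bsub>\<int>[G]\<^esub> Bar(G)\<close> in degrees at most two, for a character
  \<open>\<rho> : G \<rightarrow> \<complex>\<^sup>*\<close>.  The coefficients \<open>\<complex>\<^sub>\<rho>\<close> are the right module \<open>v \<cdot> g = \<rho>(g) v\<close>, obtained by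
  base change along the ring map \<open>\<int>[G] \<rightarrow> \<complex>\<close> extending \<open>\<rho>\<close>, which is the convention used below
  for the Alexander module.\<close>

definition bar_d1 :: "('g \<Rightarrow> complex) \<Rightarrow> ('g \<Rightarrow>\<^sub>0 complex) \<Rightarrow> complex" where
  "bar_d1 \<rho> c = (\<Sum>g\<in>Poly_Mapping.keys c. Poly_Mapping.lookup c g * (\<rho> g - 1))"

definition bar_d2 ::
  "('g, 'a) monoid_scheme \<Rightarrow> ('g \<Rightarrow> complex) \<Rightarrow> (('g \<times> 'g) \<Rightarrow>\<^sub>0 complex) \<Rightarrow> 'g \<Rightarrow>\<^sub>0 complex" where
  "bar_d2 G \<rho> c = (\<Sum>(g, h)\<in>Poly_Mapping.keys c.
      Poly_Mapping.single h (Poly_Mapping.lookup c (g, h) * \<rho> g)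
    - Poly_Mapping.single (g \<otimes>\<^bsub>G\<^esub> h) (Poly_Mapping.lookup c (g, h))
    + Poly_Mapping.single g (Poly_Mapping.lookup c (g, h)))"

definition twisted_H1 ::
  "('g, 'a) monoid_scheme \<Rightarrow> ('g \<Rightarrow> complex) \<Rightarrow> (complex, ('g \<Rightarrow>\<^sub>0 complex) set) module" where
  "twisted_H1 G \<rho> =
     quot_module
       ((chain_space (carrier G))
          \<lparr>carrier := {c \<in> carrier (chain_space (carrier G)). bar_d1 \<rho> c = 0}\<rparr>)
       (bar_d2 G \<rho> ` carrier (chain_space (carrier G \<times> carrier G)))"

text \<open>For finitely generated \<open>G\<close> this space is finite-dimensional, so that the default value of
  \<open>dim\<close> plays no role.\<close>

definition twisted_b1 :: "('g, 'a) monoid_scheme \<Rightarrow> ('g \<Rightarrow> complex) \<Rightarrow> nat" where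
  "twisted_b1 G \<rho> = vectorspace.dim class_ring (twisted_H1 G \<rho>)"

definition b1 :: "('g, 'a) monoid_scheme \<Rightarrow> nat" where
  "b1 G = twisted_b1 G (\<lambda>_. 1)"


section \<open>The Alexander module and the Alexander polynomial\<close>

definition integral_group_ring :: "('g, 'a) monoid_scheme \<Rightarrow> ('g \<Rightarrow>\<^sub>0 int) ring" where
  "integral_group_ring G =
     \<lparr>carrier = {x. Poly_Mapping.keys x \<subseteq> carrier G},
      monoid.mult = (\<lambda>x y. frag_extend (\<lambda>g. frag_extend (\<lambda>h. frag_of (g \<otimes>\<^bsub>G\<^esub> h)) y) x),
      one = frag_of \<one>\<^bsub>G\<^esub>, zero = 0, add = (+)\<rparr>"

definition augmentation :: "('g \<Rightarrow>\<^sub>0 int) \<Rightarrow> int" where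
  "augmentation x = (\<Sum>g\<in>Poly_Mapping.keys x. Poly_Mapping.lookup x g)"

definition augmentation_ideal :: "('g, 'a) monoid_scheme \<Rightarrow> ('g \<Rightarrow>\<^sub>0 int, 'g \<Rightarrow>\<^sub>0 int) module" where
  "augmentation_ideal G =
     \<lparr>carrier = {x \<in> carrier (integral_group_ring G). augmentation x = 0},
      monoid.mult = undefined, one = undefined, zero = 0, add = (+),
      smult = monoid.mult (integral_group_ring G)\<rparr>"

definition group_ring_map :: "('g \<Rightarrow> int) \<Rightarrow> ('g \<Rightarrow>\<^sub>0 int) \<Rightarrow> (int \<Rightarrow>\<^sub>0 int)" where
  "group_ring_map \<phi> = frag_extend (\<lambda>g. tpow (\<phi> g))"

definition alexander_module ::
  "('g, 'a) monoid_scheme \<Rightarrow> ('g \<Rightarrow> int) \<Rightarrow>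
    (int \<Rightarrow>\<^sub>0 int, (((int \<Rightarrow>\<^sub>0 int) \<times> ('g \<Rightarrow>\<^sub>0 int)) \<Rightarrow>\<^sub>0 int) set) module" where
  "alexander_module G \<phi> =
     tensor_module (integral_group_ring G) (\<lambda>p s. p * group_ring_map \<phi> s)
       (\<lambda>r (p, x). frag_of (r * p, x))
       (class_ring :: (int \<Rightarrow>\<^sub>0 int) ring) (augmentation_ideal G)"

text \<open>An \<open>h \<times> m\<close> matrix \<open>P\<close> presents \<open>A\<close> if there is an exact sequence
  \<open>R\<^sup>h \<rightarrow> R\<^sup>m \<rightarrow> A \<rightarrow> 0\<close> whose first map sends the basis vectors to the rows of \<open>P\<close>.\<close>

definition presentation_matrix :: "'r::comm_ring_1 mat \<Rightarrow> ('r, 'm) module \<Rightarrow> bool" where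
  "presentation_matrix P A \<longleftrightarrow>
     (\<exists>\<pi> \<in> LinearCombinations.module_hom class_ring (module_vec TYPE('r) (dim_col P)) A.
        \<pi> ` carrier_vec (dim_col P) = carrier A \<and>
        {v \<in> carrier_vec (dim_col P). \<pi> v = \<zero>\<^bsub>A\<^esub>} =
          (\<lambda>w. transpose_mat P *\<^sub>v w) ` carrier_vec (dim_row P))"

text \<open>The conventions for \<open>m \<le> 1\<close> (the whole ring, since the empty determinant is one and the
  subtraction is truncated) and for \<open>m - 1 > h\<close> (the zero ideal, since there are no minors) are
  consequences of the formula.\<close>

definition elementary_ideal1 :: "'r::comm_ring_1 mat \<Rightarrow> 'r set" where
  "elementary_ideal1 P = Idl\<^bsub>class_ring\<^esub>
     {det (submatrix P I J) | I J. I \<subseteq> {..<dim_row P} \<and> J \<subseteq> {..<dim_col P} \<and>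
        card I = dim_col P - 1 \<and> card J = dim_col P - 1}"

definition is_gcd_of :: "'r::comm_ring_1 \<Rightarrow> 'r set \<Rightarrow> bool" where
  "is_gcd_of d E \<longleftrightarrow> (\<forall>x\<in>E. d dvd x) \<and> (\<forall>c. (\<forall>x\<in>E. c dvd x) \<longrightarrow> c dvd d)"

definition is_alexander_polynomial ::
  "('g, 'a) monoid_scheme \<Rightarrow> ('g \<Rightarrow> int) \<Rightarrow> (int \<Rightarrow>\<^sub>0 int) \<Rightarrow> bool" where
  "is_alexander_polynomial G \<phi> \<Delta> \<longleftrightarrow>
     (\<exists>P. presentation_matrix P (alexander_module G \<phi>) \<and> is_gcd_of \<Delta> (elementary_ideal1 P))"


section \<open>The Alexander invariant\<close>

definition ker_ab :: "('g, 'a) monoid_scheme \<Rightarrow> ('g \<Rightarrow> int) \<Rightarrow> 'g set monoid" where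
  "ker_ab G \<phi> =
     (let K = kernel G integer_group \<phi>
      in \<lparr>carrier = K, monoid.mult = monoid.mult G, one = one G\<rparr> Mod derived G K)"

text \<open>The action of \<open>t\<^sup>i\<close> on a coset \<open>Y\<close> is \<open>g Y g\<^sup>-\<^sup>1\<close> for any \<open>g\<close> with \<open>\<phi> g = i\<close>; all such \<open>g\<close>
  give the same coset, which is therefore equal to the following union.\<close>

definition conj_action :: "('g, 'a) monoid_scheme \<Rightarrow> ('g \<Rightarrow> int) \<Rightarrow> int \<Rightarrow> 'g set \<Rightarrow> 'g set" where
  "conj_action G \<phi> i Y =
     {g \<otimes>\<^bsub>G\<^esub> x \<otimes>\<^bsub>G\<^esub> inv\<^bsub>G\<^esub> g | g x. g \<in> carrier G \<and> \<phi> g = i \<and> x \<in> Y}"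

definition alexander_invariant ::
  "('g, 'a) monoid_scheme \<Rightarrow> ('g \<Rightarrow> int) \<Rightarrow> (int \<Rightarrow>\<^sub>0 int, 'g set) module" where
  "alexander_invariant G \<phi> =
     \<lparr>carrier = carrier (ker_ab G \<phi>), monoid.mult = undefined, one = undefined,
      zero = one (ker_ab G \<phi>), add = monoid.mult (ker_ab G \<phi>),
      smult = (\<lambda>p Y. finprod (ker_ab G \<phi>)
        (\<lambda>i. conj_action G \<phi> i Y [^]\<^bsub>ker_ab G \<phi>\<^esub> Poly_Mapping.lookup p i) (Poly_Mapping.keys p))\<rparr>"

definition complex_int_module :: "(int, complex) module" where
  "complex_int_module = \<lparr>carrier = UNIV, monoid.mult = (*), one = 1, zero = 0, add = (+),
     smult = (\<lambda>k c. of_int k * c)\<rparr>"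

text \<open>\<open>B \<otimes>\<^sub>\<int> \<complex>\<close> with the \<open>\<Lambda>\<close>-action
  \<open>(\<Sum>\<^sub>i a\<^sub>i t\<^sup>i) \<cdot> (b \<otimes> c) = \<Sum>\<^sub>i t\<^sup>i b \<otimes> a\<^sub>i c\<close>.\<close>

definition complexified_module ::
  "(int \<Rightarrow>\<^sub>0 int, 'm) module \<Rightarrow> (int \<Rightarrow>\<^sub>0 complex, (('m \<times> complex) \<Rightarrow>\<^sub>0 int) set) module" where
  "complexified_module B =
     tensor_module (class_ring :: int ring) (\<lambda>b k. lconst k \<odot>\<^bsub>B\<^esub> b)
       (\<lambda>p (b, c). \<Sum>i\<in>Poly_Mapping.keys p. frag_of (tpow i \<odot>\<^bsub>B\<^esub> b, Poly_Mapping.lookup p i * c))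
       B complex_int_module"

definition cyclic_summand ::
  "complex \<Rightarrow> nat \<Rightarrow> (int \<Rightarrow>\<^sub>0 complex, (int \<Rightarrow>\<^sub>0 complex) set) module" where
  "cyclic_summand z k = quot_module regular_module (PIdl\<^bsub>class_ring\<^esub> ((tpow 1 - lconst z) ^ k))"

text \<open>The index \<open>(j, k, l)\<close> with \<open>l < e k (z j)\<close> runs through the copies of the \<open>k\<close>-th summand at
  the root \<open>z j\<close>.\<close>

definition primary_decomposition_module ::
  "nat \<Rightarrow> (nat \<Rightarrow> complex) \<Rightarrow> (nat \<Rightarrow> complex \<Rightarrow> nat) \<Rightarrow>
    (int \<Rightarrow>\<^sub>0 complex, nat \<times> nat \<times> nat \<Rightarrow> (int \<Rightarrow>\<^sub>0 complex) set) module" where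
  "primary_decomposition_module s z e =
     direct_sum_module {(j, k, l). j \<in> {1..s} \<and> 1 \<le> k \<and> l < e k (z j)}
       (\<lambda>(j, k, l). cyclic_summand (z j) k)"

end

theory Submission
  imports Defs
    "HOL-Computational_Algebra.Formal_Power_Series"
    "HOL-Computational_Algebra.Polynomial_Factorial"
    "Jordan_Normal_Form.Char_Poly"
begin

text \<open>Fix a root \<open>z = z\<^sub>j\<close> of the Alexander polynomial and expand Laurent polynomials as power series in
  \<open>X = t - z\<close>.  Both conditions turn out to express that a certain matrix of power series has no
  kernel vector to first order in \<open>X\<close>.

  Let \<open>P\<close> be a presentation matrix of the Alexander module.  By the universal property of the
  augmentation ideal, the vectors annihilated by the image of \<open>P\<close> under a ring homomorphism
  \<open>\<chi> : \<Lambda>\<^sub>1 \<rightarrow> R\<close> are the crossed homomorphisms \<open>G \<rightarrow> R\<close> twisted by \<open>g \<mapsto> \<chi>(t\<^sup>\<phi>\<^sup>(\<^sup>g\<^sup>))\<close>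
  (\<open>kernel_vector_of_crossed_hom\<close>).  In particular \<open>g \<mapsto> t\<^sup>\<phi>\<^sup>(\<^sup>g\<^sup>) - 1\<close> gives a kernel vector \<open>d\<close> of \<open>P\<close>
  itself, whose multiples are the principal crossed homomorphisms.  Since \<open>b\<^sub>1(G) = 1\<close>, the Alexander
  polynomial does not vanish at \<open>1\<close> (\<open>alexander_polynomial_at_1\<close>), so \<open>z \<noteq> 1\<close>, and therefore
  \<open>d\<^sub>j(z) \<noteq> 0\<close> for some column \<open>j\<close>.  Let \<open>N\<close> be the matrix of power series obtained from \<open>P\<close> by
  deleting this column.  First homology is dual to crossed homomorphisms modulo principal ones
  (\<open>twisted_b1_eq\<close>), and so \<open>b\<^sub>1(G, z)\<close> is the dimension \<open>b\<close> of the kernel of \<open>N(0)\<close>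
  (\<open>twisted_b1_delete_col\<close>).

  The multiplicity \<open>\<mu>\<close> of \<open>z\<close> in the Alexander polynomial is the least order in \<open>X\<close> of a maximal minor
  of \<open>N\<close>: the other minors of \<open>P\<close> are proportional to these by the entries of \<open>d\<close>
  (\<open>fps_X_power_dvd_gcd\<close>), and the greatest common divisor of an ideal of \<open>\<Lambda>\<^sub>1\<close> vanishes at \<open>z\<close> to the
  order of the ideal, because the ideal becomes principal over the rationals (\<open>gcd_order\<close>).  In a basis
  adapted to the kernel of \<open>N(0)\<close>, \<open>b\<close> columns of \<open>N\<close> are divisible by \<open>X\<close>; hence \<open>b \<le> \<mu>\<close>.  Dividing
  these columns by \<open>X\<close>, one sees that \<open>b = \<mu>\<close> unless a non-zero vector \<open>u\<^sub>0\<close> in the kernel of \<open>N(0)\<close>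
  extends to a solution \<open>u\<^sub>0 + X u\<^sub>1\<close> of \<open>N u = 0\<close> modulo \<open>X\<^sup>2\<close>, in which case \<open>b < \<mu>\<close>
  (\<open>exists_maximal_minor_of_order\<close>, \<open>fps_X_power_dvd_maximal_minor_Suc\<close>).

  These first-order solutions are kernel vectors over the dual numbers
  \<open>\<complex>[\<epsilon>] = \<complex>[X] / (X\<^sup>2)\<close>, that is, crossed homomorphisms \<open>G \<rightarrow> \<complex>[\<epsilon>]\<close>.  Restriction to the kernel
  of \<open>\<phi>\<close> turns them, up to principal ones, into the \<open>\<Lambda>\<close>-linear maps \<open>B\<^sub>G \<otimes> \<complex> \<rightarrow> \<complex>[\<epsilon>]\<close>, where \<open>t\<close>
  acts on \<open>\<complex>[\<epsilon>]\<close> as \<open>z + \<epsilon>\<close>; so \<open>b = \<mu>\<close> if and only if \<open>\<epsilon>\<close> kills the image of every such map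
  (\<open>eps_kills_iff_kernel_vectors\<close>, \<open>twisted_b1_eq_order_iff\<close>).  On the summand \<open>\<Lambda> / (t - z)\<^sup>k\<close> there is a
  surjection onto \<open>\<complex>[\<epsilon>]\<close> if \<open>k > 1\<close>, while for \<open>k = 1\<close>, and on the summands at the other roots, \<open>\<epsilon>\<close>
  kills the image of every map (\<open>eps_detects_higher_summand\<close>, \<open>semisimple_imp_eps_kills\<close>).\<close>


section \<open>Linear extension of functions on a basis\<close>

text \<open>Free abelian groups, spaces of chains and Laurent polynomials all consist of finitely supported
  functions.  Homomorphisms out of any of them are linear extensions of a function on the basis, with
  coefficients mapped to the target by \<open>w\<close>.\<close>

definition pm_ext :: "('c::ab_group_add \<Rightarrow> 'r::comm_ring_1) \<Rightarrow> ('k \<Rightarrow> 'r) \<Rightarrow> ('k \<Rightarrow>\<^sub>0 'c) \<Rightarrow> 'r" where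
  "pm_ext w f c = (\<Sum>x\<in>Poly_Mapping.keys c. w (Poly_Mapping.lookup c x) * f x)"

lemma additive_zero:
  fixes w :: "'c::ab_group_add \<Rightarrow> 'r::ab_group_add"
  assumes "\<And>a b. w (a + b) = w a + w b"
  shows "w 0 = 0"
  using assms[of 0 0] by simp

lemma additive_diff:
  fixes w :: "'c::ab_group_add \<Rightarrow> 'r::ab_group_add"
  assumes "\<And>a b. w (a + b) = w a + w b"
  shows "w (a - b) = w a - w b"
  using assms[of "a - b" b] by simp

lemma pm_ext_superset:
  assumes "w 0 = 0" "finite S" "Poly_Mapping.keys c \<subseteq> S"
  shows "pm_ext w f c = (\<Sum>x\<in>S. w (Poly_Mapping.lookup c x) * f x)"
  unfolding pm_ext_def by (rule sum.mono_neutral_left) (use assms in \<open>auto simp: in_keys_iff\<close>)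

lemma pm_ext_add:
  assumes "\<And>a b. w (a + b) = w a + w b"
  shows "pm_ext w f (c + d) = pm_ext w f c + pm_ext w f d"
proof -
  have w0: "w 0 = 0" using assms by (rule additive_zero)
  let ?S = "Poly_Mapping.keys c \<union> Poly_Mapping.keys d"
  have "pm_ext w f (c + d) = (\<Sum>x\<in>?S. w (Poly_Mapping.lookup (c + d) x) * f x)"
    by (rule pm_ext_superset) (use w0 Poly_Mapping.keys_add[of c d] in auto)
  also have "\<dots> = (\<Sum>x\<in>?S. w (Poly_Mapping.lookup c x) * f x) + (\<Sum>x\<in>?S. w (Poly_Mapping.lookup d x) * f x)"
    by (simp add: lookup_add assms distrib_right sum.distrib)
  also have "\<dots> = pm_ext w f c + pm_ext w f d"
    using pm_ext_superset[of w ?S c f] pm_ext_superset[of w ?S d f] w0 by simp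
  finally show ?thesis .
qed

lemma pm_ext_0 [simp]: "pm_ext w f 0 = 0"
  by (simp add: pm_ext_def)

lemma pm_ext_diff:
  assumes "\<And>a b. w (a + b) = w a + w b"
  shows "pm_ext w f (c - d) = pm_ext w f c - pm_ext w f d"
  by (rule additive_diff) (rule pm_ext_add[OF assms])

lemma pm_ext_sum:
  assumes "\<And>a b. w (a + b) = w a + w b"
  shows "pm_ext w f (\<Sum>i\<in>I. c i) = (\<Sum>i\<in>I. pm_ext w f (c i))"
  by (induction I rule: infinite_finite_induct) (simp_all add: pm_ext_add[OF assms])

lemma pm_ext_single:
  assumes "w 0 = 0"
  shows "pm_ext w f (Poly_Mapping.single x a) = w a * f x"
  using assms by (simp add: pm_ext_def)

lemma pm_sum_singles: "c = (\<Sum>x\<in>Poly_Mapping.keys c. Poly_Mapping.single x (Poly_Mapping.lookup c x))"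
  by (rule poly_mapping_eqI)
    (simp add: lookup_sum lookup_single when_def in_keys_iff sum.delta' cong: if_cong)

lemma pm_ext_cong:
  assumes "\<And>x. x \<in> Poly_Mapping.keys c \<Longrightarrow> f x = g x"
  shows "pm_ext w f c = pm_ext w g c"
  unfolding pm_ext_def by (rule sum.cong) (use assms in auto)

lemma pm_ext_hom:
  assumes "comm_ring_hom h"
  shows "h (pm_ext w f c) = pm_ext (\<lambda>a. h (w a)) (\<lambda>x. h (f x)) c"
proof -
  interpret comm_ring_hom h by fact
  show ?thesis by (simp add: pm_ext_def hom_distribs)
qed

abbreviation zext :: "('k \<Rightarrow> 'r::comm_ring_1) \<Rightarrow> ('k \<Rightarrow>\<^sub>0 int) \<Rightarrow> 'r" where
  "zext \<equiv> pm_ext of_int"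

abbreviation cext :: "('k \<Rightarrow> complex) \<Rightarrow> ('k \<Rightarrow>\<^sub>0 complex) \<Rightarrow> complex" where
  "cext \<equiv> pm_ext (\<lambda>a. a)"

lemmas zext_simps = pm_ext_add[of of_int, OF of_int_add] pm_ext_diff[of of_int, OF of_int_add]
  pm_ext_single[of of_int, OF of_int_0]

lemma zext_frag_of [simp]: "zext f (frag_of x) = f x"
  by (simp add: zext_simps)

lemma zext_frag_extend: "zext f (frag_extend b c) = zext (\<lambda>x. zext f (b x)) c"
  using subset_UNIV[of "Poly_Mapping.keys c"]
  by (induction c rule: frag_induction) (auto simp: frag_extend_diff zext_simps)


section \<open>Evaluation of Laurent polynomials\<close>

lemma pm_ext_mult:
  fixes q :: "'k::cancel_comm_monoid_add \<Rightarrow> 'r::comm_ring_1" and w :: "'c::comm_ring_1 \<Rightarrow> 'r"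
  assumes w: "\<And>a b. w (a + b) = w a + w b" "\<And>a b. w (a * b) = w a * w b"
    and q: "\<And>i j. q (i + j) = q i * q j"
  shows "pm_ext w q (c * d) = pm_ext w q c * pm_ext w q d"
proof -
  let ?s = "\<lambda>c x. Poly_Mapping.single x (Poly_Mapping.lookup c x)"
  have w0: "w 0 = 0" by (rule additive_zero) (rule w)
  have "pm_ext w q (c * d) = pm_ext w q ((\<Sum>x\<in>Poly_Mapping.keys c. ?s c x) * (\<Sum>y\<in>Poly_Mapping.keys d. ?s d y))"
    by (simp flip: pm_sum_singles)
  also have "\<dots> = (\<Sum>x\<in>Poly_Mapping.keys c. \<Sum>y\<in>Poly_Mapping.keys d. pm_ext w q (?s c x * ?s d y))"
    by (simp add: sum_product pm_ext_sum[OF w(1)])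
  also have "\<dots> = pm_ext w q c * pm_ext w q d"
    by (simp add: pm_ext_def[of w q c] pm_ext_def[of w q d] sum_product mult_single
        pm_ext_single w0 w q ac_simps)
  finally show ?thesis .
qed

text \<open>The inverse \<open>b\<close> of \<open>a\<close> is a parameter, since commutative rings have no inverse operation.\<close>

definition unit_pow :: "'r::comm_ring_1 \<Rightarrow> 'r \<Rightarrow> int \<Rightarrow> 'r" where
  "unit_pow a b i = (if i \<ge> 0 then a ^ nat i else b ^ nat (- i))"

lemma unit_pow_0 [simp]: "unit_pow a b 0 = 1" and unit_pow_1 [simp]: "unit_pow a b 1 = a"
  by (simp_all add: unit_pow_def)

lemma unit_pow_add:
  assumes ab: "a * b = 1"
  shows "unit_pow a b (i + j) = unit_pow a b i * unit_pow a b j"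
proof -
  have ab': "b * a = 1" using ab by (simp add: mult.commute)
  have succ: "unit_pow a b (k + 1) = unit_pow a b k * a" for k
  proof (cases "k \<ge> 0")
    case True
    then show ?thesis by (simp add: unit_pow_def nat_add_distrib mult.commute)
  next
    case False
    then have "nat (- k) = Suc (nat (- (k + 1)))" by linarith
    with False have "unit_pow a b k * a = b ^ nat (- (k + 1)) * (b * a)"
      by (simp add: unit_pow_def mult_ac)
    also have "\<dots> = unit_pow a b (k + 1)" using ab' False by (auto simp: unit_pow_def)
    finally show ?thesis ..
  qed
  have pred: "unit_pow a b (k - 1) = unit_pow a b k * b" for k
    using succ[of "k - 1"] ab by (simp add: mult.assoc)
  show ?thesis
  proof (induction j rule: int_induct[where k = 0])
    case base
    then show ?case by simp
  next
    case (step1 j)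
    then show ?case using succ[of "i + j"] succ[of j] by (simp add: add.assoc mult.assoc)
  next
    case (step2 j)
    then show ?case using pred[of "i + j"] pred[of j] by (simp add: algebra_simps)
  qed
qed

lemma unit_pow_hom:
  assumes "comm_ring_hom h"
  shows "h (unit_pow a b i) = unit_pow (h a) (h b) i"
proof -
  interpret comm_ring_hom h by fact
  show ?thesis by (simp add: unit_pow_def hom_distribs)
qed

lemma unit_pow_complex: "z \<noteq> 0 \<Longrightarrow> unit_pow z (inverse z) i = z powi i"
  by (simp add: unit_pow_def power_int_def)

lemma pm_ext_unit_pow_hom:
  fixes w :: "'c::comm_ring_1 \<Rightarrow> 'r::comm_ring_1"
  assumes "a * b = 1" "comm_ring_hom w"
  shows "comm_ring_hom (pm_ext w (unit_pow a b))"
proof -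
  interpret comm_ring_hom w by fact
  show ?thesis
    by unfold_locales
      (simp_all add: pm_ext_add hom_add pm_ext_mult hom_mult unit_pow_add[OF assms(1)] pm_ext_single
        flip: single_one)
qed

text \<open>Laurent polynomials are expanded at \<open>z \<noteq> 0\<close> in the local parameter \<open>X = t - z\<close>; the expansion of \<open>t\<close>
  is \<open>z + X\<close>, a unit.\<close>

definition loc_t :: "complex \<Rightarrow> complex fps" where
  "loc_t z = fps_const z + fps_X"

definition expansion :: "complex \<Rightarrow> (int \<Rightarrow>\<^sub>0 complex) \<Rightarrow> complex fps" where
  "expansion z = pm_ext fps_const (unit_pow (loc_t z) (inverse (loc_t z)))"

definition int_expansion :: "complex \<Rightarrow> (int \<Rightarrow>\<^sub>0 int) \<Rightarrow> complex fps" where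
  "int_expansion z = pm_ext of_int (unit_pow (loc_t z) (inverse (loc_t z)))"

lemma loc_t_unit: "z \<noteq> 0 \<Longrightarrow> loc_t z * inverse (loc_t z) = 1"
  by (rule inverse_mult_eq_1') (simp add: loc_t_def)

lemma expansion_hom: "z \<noteq> 0 \<Longrightarrow> comm_ring_hom (expansion z)"
  unfolding expansion_def
  by (rule pm_ext_unit_pow_hom[OF loc_t_unit]) (unfold_locales, auto)

lemma int_expansion_hom: "z \<noteq> 0 \<Longrightarrow> comm_ring_hom (int_expansion z)"
  unfolding int_expansion_def
  by (rule pm_ext_unit_pow_hom[OF loc_t_unit]) (unfold_locales, auto)

lemma lookup_complexify [simp]: "Poly_Mapping.lookup (complexify p) i = of_int (Poly_Mapping.lookup p i)"
  unfolding complexify_def by transfer (simp add: when_def)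

lemma keys_complexify [simp]: "Poly_Mapping.keys (complexify p) = Poly_Mapping.keys p"
  by (auto simp: in_keys_iff)

lemma expansion_complexify: "expansion z (complexify p) = int_expansion z p"
  by (simp add: expansion_def int_expansion_def pm_ext_def fps_of_int)

lemma fps_coeff_0_hom: "comm_ring_hom (\<lambda>f :: complex fps. fps_nth f 0)"
  by unfold_locales auto

lemma expansion_coeff_0:
  assumes "z \<noteq> 0"
  shows "fps_nth (expansion z p) 0 = leval p z"
  using assms
  by (simp add: expansion_def pm_ext_hom[OF fps_coeff_0_hom] unit_pow_hom[OF fps_coeff_0_hom])
    (simp add: pm_ext_def leval_def loc_t_def unit_pow_complex)

lemma expansion_tpow: "expansion z (tpow i) = unit_pow (loc_t z) (inverse (loc_t z)) i"
  and expansion_lconst: "expansion z (lconst c) = fps_const c"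
  and int_expansion_tpow: "int_expansion z (tpow i) = unit_pow (loc_t z) (inverse (loc_t z)) i"
  by (simp_all add: expansion_def int_expansion_def pm_ext_single)

lemma unit_pow_loc_t_coeff_0: "z \<noteq> 0 \<Longrightarrow> fps_nth (unit_pow (loc_t z) (inverse (loc_t z)) i) 0 = z powi i"
  by (simp add: unit_pow_hom[OF fps_coeff_0_hom] loc_t_def unit_pow_complex)

lemma expansion_linear_factor:
  assumes "z \<noteq> 0"
  shows "expansion z (tpow 1 - lconst w) = fps_const (z - w) + fps_X"
proof -
  interpret comm_ring_hom "expansion z" using assms by (rule expansion_hom)
  show ?thesis by (simp add: hom_minus expansion_tpow expansion_lconst loc_t_def flip: fps_const_sub)
qed


section \<open>Dual numbers\<close>

text \<open>The ring \<open>\<complex>[\<epsilon>] / (\<epsilon>\<^sup>2)\<close>: its elements are values together with a first-order variation.\<close>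

datatype dual = Dual (dual_re: complex) (dual_eps: complex)

instantiation dual :: comm_ring_1
begin
definition "0 = Dual 0 0"
definition "1 = Dual 1 0"
definition "x + y = Dual (dual_re x + dual_re y) (dual_eps x + dual_eps y)"
definition "x - y = Dual (dual_re x - dual_re y) (dual_eps x - dual_eps y)"
definition "- x = Dual (- dual_re x) (- dual_eps x)"
definition "x * y = Dual (dual_re x * dual_re y) (dual_re x * dual_eps y + dual_eps x * dual_re y)"
instance
  by standard (simp_all add: zero_dual_def one_dual_def plus_dual_def minus_dual_def uminus_dual_def
      times_dual_def algebra_simps)
end

lemma dual_sel [simp]:
  "dual_re 0 = 0" "dual_eps 0 = 0" "dual_re 1 = 1" "dual_eps 1 = 0"
  "dual_re (x + y) = dual_re x + dual_re y" "dual_eps (x + y) = dual_eps x + dual_eps y"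
  "dual_re (x - y) = dual_re x - dual_re y" "dual_eps (x - y) = dual_eps x - dual_eps y"
  "dual_re (- x) = - dual_re x" "dual_eps (- x) = - dual_eps x"
  "dual_re (x * y) = dual_re x * dual_re y"
  "dual_eps (x * y) = dual_re x * dual_eps y + dual_eps x * dual_re y"
  by (simp_all add: zero_dual_def one_dual_def plus_dual_def minus_dual_def uminus_dual_def
      times_dual_def)

lemma dual_sum [simp]:
  "dual_re (\<Sum>i\<in>I. f i) = (\<Sum>i\<in>I. dual_re (f i))" "dual_eps (\<Sum>i\<in>I. f i) = (\<Sum>i\<in>I. dual_eps (f i))"
  by (induction I rule: infinite_finite_induct) auto

lemma dual_eq_iff: "x = y \<longleftrightarrow> dual_re x = dual_re y \<and> dual_eps x = dual_eps y"
  by (cases x; cases y) auto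

definition eps :: dual where "eps = Dual 0 1"

lemma eps_sel [simp]: "dual_re eps = 0" "dual_eps eps = 1"
  by (simp_all add: eps_def)

lemma eps_mult_eq_0_iff: "eps * x = 0 \<longleftrightarrow> dual_re x = 0"
  by (simp add: dual_eq_iff)

lemma dual_unit:
  assumes "dual_re x \<noteq> 0"
  obtains y where "x * y = 1"
proof
  show "x * Dual (1 / dual_re x) (- dual_eps x / (dual_re x)\<^sup>2) = 1"
    using assms by (simp add: dual_eq_iff field_simps power2_eq_square)
qed

definition truncate :: "complex fps \<Rightarrow> dual" where
  "truncate f = Dual (fps_nth f 0) (fps_nth f 1)"

lemma truncate_sel [simp]: "dual_re (truncate f) = fps_nth f 0" "dual_eps (truncate f) = fps_nth f 1"
  by (simp_all add: truncate_def)

lemma truncate_hom: "comm_ring_hom truncate"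
  by unfold_locales (auto simp: dual_eq_iff fps_mult_nth numeral_2_eq_2)


section \<open>Maximal minors of matrices of power series\<close>

lemma fps_X_power_mult_fps_shift:
  fixes f :: "'a::comm_ring_1 fps"
  assumes "\<forall>i<k. fps_nth f i = 0"
  shows "fps_X ^ k * fps_shift k f = f"
  by (rule fps_ext) (use assms in \<open>auto simp: fps_X_power_mult_nth\<close>)

lemma fps_X_power_dvd_iff: "fps_X ^ k dvd (f :: 'a::comm_ring_1 fps) \<longleftrightarrow> (\<forall>i<k. fps_nth f i = 0)"
proof
  assume "\<forall>i<k. fps_nth f i = 0"
  from fps_X_power_mult_fps_shift[OF this] show "fps_X ^ k dvd f" by (metis dvd_triv_left)
qed (auto simp: fps_X_power_mult_nth elim!: dvdE)

lemma mult_mat_vec_nth: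
  assumes "A \<in> carrier_mat h n" "v \<in> carrier_vec n" "r < h"
  shows "(A *\<^sub>v v) $ r = (\<Sum>c<n. A $$ (r, c) * v $ c)"
  using assms by (auto simp: scalar_prod_def atLeast0LessThan intro!: sum.cong)

text \<open>Selecting rows by an arbitrary function avoids sorting them; a repeated row makes the determinant
  vanish.\<close>

definition select_rows :: "'a mat \<Rightarrow> (nat \<Rightarrow> nat) \<Rightarrow> 'a mat" where
  "select_rows N f = mat (dim_col N) (dim_col N) (\<lambda>(r, c). N $$ (f r, c))"

lemma select_rows_carrier [simp]: "N \<in> carrier_mat h n \<Longrightarrow> select_rows N f \<in> carrier_mat n n"
  by (simp add: select_rows_def)

lemma select_rows_mult:
  assumes "N \<in> carrier_mat h n" "S \<in> carrier_mat n n" "f \<in> {..<n} \<rightarrow> {..<h}"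
  shows "select_rows N f * S = select_rows (N * S) f"
  by (rule eq_matI) (use assms in \<open>auto simp: select_rows_def scalar_prod_def Pi_iff\<close>)

lemma map_mat_select_rows:
  assumes "N \<in> carrier_mat h n" "f \<in> {..<n} \<rightarrow> {..<h}"
  shows "select_rows (map_mat w N) f = map_mat w (select_rows N f)"
  by (rule eq_matI) (use assms in \<open>auto simp: select_rows_def Pi_iff\<close>)

lemma det_select_rows_inj:
  assumes "N \<in> carrier_mat h n" "det (select_rows N f) \<noteq> 0"
  shows "inj_on f {..<n}"
proof (rule inj_onI, rule ccontr)
  fix x y assume *: "x \<in> {..<n}" "y \<in> {..<n}" "f x = f y" "x \<noteq> y"
  have "det (select_rows N f) = 0"
    by (rule det_identical_rows[of _ n x y]) (use * assms in \<open>auto simp: select_rows_def\<close>)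
  with assms show False by simp
qed

lemma det_scale_cols:
  assumes A: "A \<in> carrier_mat n n" and M: "M \<in> carrier_mat n n"
    and eq: "\<And>i c. i < n \<Longrightarrow> c < n \<Longrightarrow> A $$ (i, c) = s c * M $$ (i, c)"
  shows "det A = (\<Prod>c<n. s c) * det M"
proof -
  have "(\<Prod>j<n. A $$ (p j, j)) = (\<Prod>j<n. s j) * (\<Prod>j<n. M $$ (p j, j))" if "p permutes {0..<n}" for p
  proof -
    have "p j < n" if "j < n" for j
      using permutes_in_image[OF \<open>p permutes {0..<n}\<close>, of j] that by simp
    then have "(\<Prod>j<n. A $$ (p j, j)) = (\<Prod>j<n. s j * M $$ (p j, j))"
      by (intro prod.cong) (auto simp: eq)
    then show ?thesis by (simp only: prod.distrib)
  qed
  then show ?thesis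
    unfolding det_col[OF A] det_col[OF M] sum_distrib_left
    by (intro sum.cong) (simp_all add: mult_ac)
qed

text \<open>Multiplication by \<open>S\<close> changes every maximal minor by a unit, after which a power of \<open>X\<close> can be taken
  out of each column.\<close>

lemma fps_X_power_dvd_minor:
  fixes N :: "complex fps mat"
  assumes N: "N \<in> carrier_mat h n" and S: "S \<in> carrier_mat n n" and f: "f \<in> {..<n} \<rightarrow> {..<h}"
    and unit: "fps_nth (det S) 0 \<noteq> 0"
    and dvd: "\<And>r c. r < h \<Longrightarrow> c < n \<Longrightarrow> fps_X ^ k c dvd (N * S) $$ (r, c)"
  shows "fps_X ^ (\<Sum>c<n. k c) dvd det (select_rows N f)"
proof -
  define M where "M = mat n n (\<lambda>(r, c). SOME y. (N * S) $$ (f r, c) = fps_X ^ k c * y)"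
  have "det (select_rows (N * S) f) = (\<Prod>c<n. fps_X ^ k c) * det M"
  proof (rule det_scale_cols[where n = n])
    fix i c assume ic: "i < n" "c < n"
    then have "\<exists>y. (N * S) $$ (f i, c) = fps_X ^ k c * y"
      using dvd[of "f i" c] f by (auto elim!: dvdE)
    from someI_ex[OF this] show "select_rows (N * S) f $$ (i, c) = fps_X ^ k c * M $$ (i, c)"
      using ic N S f by (simp add: M_def select_rows_def)
  qed (use N S in \<open>auto simp: M_def select_rows_def\<close>)
  also have "det (select_rows (N * S) f) = det (select_rows N f) * det S"
    unfolding select_rows_mult[OF N S f, symmetric] using N S by (intro det_mult) auto
  finally have "fps_X ^ (\<Sum>c<n. k c) dvd det (select_rows N f) * det S"
    by (simp add: power_sum)
  moreover have "det S dvd 1" using unit by simp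
  ultimately show ?thesis by (metis dvd_mult_unit_iff)
qed

text \<open>A rectangular matrix with trivial kernel has a non-vanishing maximal minor: border a
  non-vanishing minor of the first \<open>n\<close> columns by one row and the last column.  The cofactors of the
  bordering row do not depend on that row; if all the bordered minors vanished, these cofactors would
  be a non-zero element of the kernel.\<close>

lemma exists_nonzero_maximal_minor_fun:
  fixes N :: "nat \<Rightarrow> nat \<Rightarrow> 'a::field"
  assumes "\<And>v. \<forall>r<h. (\<Sum>c<n. N r c * v c) = 0 \<Longrightarrow> \<forall>c<n. v c = 0"
  shows "\<exists>f \<in> {..<n} \<rightarrow> {..<h}. det (mat n n (\<lambda>(r, c). N (f r) c)) \<noteq> 0"
  using assms
proof (induction n)
  case 0
  then show ?case by simp
next
  case (Suc n)
  have "\<forall>c<n. v c = 0" if v: "\<forall>r<h. (\<Sum>c<n. N r c * v c) = 0" for v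
  proof -
    have "\<forall>r<h. (\<Sum>c<Suc n. N r c * (v(n := 0)) c) = 0" using v by simp
    from Suc.prems[OF this] show ?thesis by (metis fun_upd_other less_Suc_eq less_irrefl)
  qed
  from Suc.IH[OF this] obtain f where f: "f \<in> {..<n} \<rightarrow> {..<h}"
    and det: "det (mat n n (\<lambda>(r, c). N (f r) c)) \<noteq> 0" by blast
  define A where "A r = mat (Suc n) (Suc n) (\<lambda>(i, c). N ((f(n := r)) i) c)" for r
  define v where "v = cofactor (A 0) n"
  have A: "A r \<in> carrier_mat (Suc n) (Suc n)" for r by (simp add: A_def)
  have cof: "cofactor (A r) n c = v c" if "c < Suc n" for r c
    unfolding v_def cofactor_def mat_delete_def
    by (intro arg_cong2[of _ _ _ _ "(*)"] arg_cong[of _ _ det] eq_matI) (auto simp: A_def)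
  have det_A: "det (A r) = (\<Sum>c<Suc n. N r c * v c)" for r
  proof -
    have "det (A r) = (\<Sum>c<Suc n. A r $$ (n, c) * cofactor (A r) n c)"
      by (rule laplace_expansion_row[OF A]) simp
    also have "\<dots> = (\<Sum>c<Suc n. N r c * v c)"
    proof (rule sum.cong)
      fix c assume "c \<in> {..<Suc n}"
      then have "c < Suc n" by simp
      then show "A r $$ (n, c) * cofactor (A r) n c = N r c * v c"
        unfolding cof[OF \<open>c < Suc n\<close>] by (simp add: A_def)
    qed simp
    finally show ?thesis .
  qed
  have "\<forall>c<Suc n. v c = 0" if "\<forall>r<h. det (A r) = 0"
    by (rule Suc.prems) (use that in \<open>simp only: det_A\<close>)
  moreover have "v n = det (mat n n (\<lambda>(r, c). N (f r) c))"
  proof -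
    have "mat_delete (A 0) n n = mat n n (\<lambda>(r, c). N (f r) c)"
      by (rule eq_matI) (auto simp: A_def mat_delete_def)
    then show ?thesis by (simp add: v_def cofactor_def minus_one_power_iff)
  qed
  ultimately obtain r where "r < h" "det (A r) \<noteq> 0"
    using det by (metis lessI)
  then show ?case using f
    by (intro bexI[of _ "f(n := r)"]) (auto simp: A_def Pi_iff less_Suc_eq)
qed

lemma exists_nonzero_maximal_minor:
  fixes N :: "'a::field mat"
  assumes N: "N \<in> carrier_mat h n"
    and inj: "\<And>v. v \<in> carrier_vec n \<Longrightarrow> N *\<^sub>v v = 0\<^sub>v h \<Longrightarrow> v = 0\<^sub>v n"
  shows "\<exists>f \<in> {..<n} \<rightarrow> {..<h}. det (select_rows N f) \<noteq> 0"
proof -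
  have "\<exists>f \<in> {..<n} \<rightarrow> {..<h}. det (mat n n (\<lambda>(r, c). N $$ (f r, c))) \<noteq> 0"
  proof (rule exists_nonzero_maximal_minor_fun)
    fix v assume "\<forall>r<h. (\<Sum>c<n. N $$ (r, c) * v c) = 0"
    then have "N *\<^sub>v vec n v = 0\<^sub>v h"
      using N by (intro eq_vecI) (auto simp: scalar_prod_def atLeast0LessThan)
    from inj[OF _ this] show "\<forall>c<n. v c = 0" by (metis index_vec index_zero_vec(1) vec_carrier)
  qed
  then show ?thesis using N by (simp add: select_rows_def)
qed

text \<open>A basis of the domain (the columns of \<open>T\<close>) adapted to the kernel: the columns with index in
  \<open>B\<close> lie in the kernel, and the others are independent modulo the kernel.\<close>

definition kernel_adapted :: "'a::field mat \<Rightarrow> 'a mat \<Rightarrow> nat set \<Rightarrow> bool" where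
  "kernel_adapted N T B \<longleftrightarrow> T \<in> carrier_mat (dim_col N) (dim_col N) \<and> det T \<noteq> 0 \<and> B \<subseteq> {..<dim_col N} \<and>
     (\<forall>c\<in>B. N *\<^sub>v col T c = 0\<^sub>v (dim_row N)) \<and>
     (\<forall>v\<in>carrier_vec (dim_col N). (\<forall>c\<in>B. v $ c = 0) \<longrightarrow> N *\<^sub>v (T *\<^sub>v v) = 0\<^sub>v (dim_row N)
        \<longrightarrow> v = 0\<^sub>v (dim_col N))"

lemma kernel_adapted_exists: "\<exists>T B. kernel_adapted (N :: 'a::field mat) T B"
proof -
  let ?n = "dim_col N" and ?h = "dim_row N"
  define Q where "Q T B \<longleftrightarrow> T \<in> carrier_mat ?n ?n \<and> det T \<noteq> 0 \<and> B \<subseteq> {..<?n} \<and>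
     (\<forall>c\<in>B. N *\<^sub>v col T c = 0\<^sub>v ?h)" for T B
  have "Q (1\<^sub>m ?n) {}" by (simp add: Q_def)
  moreover have "card B \<le> ?n" if "Q T B" for T B
    using that card_mono[of "{..<?n}" B] by (auto simp: Q_def)
  ultimately obtain TB where Q': "case TB of (T, B) \<Rightarrow> Q T B"
    and max': "\<forall>TB'. (case TB' of (T, B) \<Rightarrow> Q T B) \<longrightarrow> card (snd TB') \<le> card (snd TB)"
    using ex_has_greatest_nat[of "\<lambda>(T, B). Q T B" "(1\<^sub>m ?n, {})" "\<lambda>TB. card (snd TB)" "Suc ?n"]
    by (auto simp: less_Suc_eq_le)
  obtain T B where TB: "TB = (T, B)" by (cases TB)
  have Q: "Q T B" using Q' TB by simp
  have max: "card B' \<le> card B" if "Q T' B'" for T' B'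
    using max'[rule_format, of "(T', B')"] that TB by simp
  have "v = 0\<^sub>v ?n" if v: "v \<in> carrier_vec ?n" "\<forall>c\<in>B. v $ c = 0" "N *\<^sub>v (T *\<^sub>v v) = 0\<^sub>v ?h" for v
  proof (rule ccontr)
    assume "v \<noteq> 0\<^sub>v ?n"
    then obtain k where k: "k < ?n" "v $ k \<noteq> 0" using v(1) by (metis carrier_vecD eq_vecI index_zero_vec)
    \<comment> \<open>exchange the \<open>k\<close>-th basis vector for the new kernel vector \<open>T v\<close>\<close>
    let ?T = "replace_col T (T *\<^sub>v v) k"
    have T: "T \<in> carrier_mat ?n ?n" using Q by (simp add: Q_def)
    have "k \<notin> B" using v(2) k by auto
    have cols: "col ?T c = (if c = k then T *\<^sub>v v else col T c)" if "c < ?n" for c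
      by (rule eq_vecI) (use that T v in \<open>auto simp: replace_col_def\<close>)
    have "Q ?T (insert k B)"
      unfolding Q_def using Q cramer_lemma_mat[OF T v(1) k(1)] k v(3) cols \<open>k \<notin> B\<close>
      by (auto simp: Q_def replace_col_def subset_iff)
    from max[OF this] show False using \<open>k \<notin> B\<close> Q finite_subset[of B "{..<?n}"]
      by (simp add: Q_def)
  qed
  with Q have "kernel_adapted N T B" unfolding kernel_adapted_def Q_def by blast
  then show ?thesis by blast
qed

lemma kernel_adapted_coordinates:
  fixes N :: "'a::field mat"
  assumes ad: "kernel_adapted N T B" and N: "N \<in> carrier_mat h n"
    and u: "u \<in> carrier_vec n" "N *\<^sub>v u = 0\<^sub>v h"
  obtains v where "v \<in> carrier_vec n" "u = T *\<^sub>v v" "\<And>c. c < n \<Longrightarrow> c \<notin> B \<Longrightarrow> v $ c = 0"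
proof -
  have T: "T \<in> carrier_mat n n" "det T \<noteq> 0" and Bn: "B \<subseteq> {..<n}"
    and kill: "\<And>c. c \<in> B \<Longrightarrow> N *\<^sub>v col T c = 0\<^sub>v h"
    and indep: "\<And>v. v \<in> carrier_vec n \<Longrightarrow> \<forall>c\<in>B. v $ c = 0 \<Longrightarrow> N *\<^sub>v (T *\<^sub>v v) = 0\<^sub>v h \<Longrightarrow> v = 0\<^sub>v n"
    using ad N by (auto simp: kernel_adapted_def)
  from det_non_zero_imp_unit[OF T] obtain T' where T': "T' \<in> carrier_mat n n" "T * T' = 1\<^sub>m n"
    unfolding Units_def by (auto simp: ring_mat_def)
  define v where "v = T' *\<^sub>v u"
  have v: "v \<in> carrier_vec n" using T' u by (simp add: v_def)
  have uv: "u = T *\<^sub>v v" using T T' u assoc_mult_mat_vec[of T n n T' n u] by (simp add: v_def)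
  define w where "w = vec n (\<lambda>c. if c \<in> B then 0 else v $ c)"
  have entry: "(N * T) $$ (r, c) = 0" if "r < h" "c \<in> B" for r c
    using kill[OF that(2)] N T that Bn by (auto simp: vec_eq_iff)
  have "(N * T) *\<^sub>v w = (N * T) *\<^sub>v v"
  proof (rule eq_vecI)
    fix r assume "r < dim_vec ((N * T) *\<^sub>v v)"
    then have r: "r < h" using N by simp
    have "(\<Sum>c<n. (N * T) $$ (r, c) * w $ c) = (\<Sum>c<n. (N * T) $$ (r, c) * v $ c)"
      by (rule sum.cong) (use entry[OF r] in \<open>auto simp: w_def simp del: index_mult_mat(1)\<close>)
    then show "((N * T) *\<^sub>v w) $ r = ((N * T) *\<^sub>v v) $ r"
      using mult_mat_vec_nth[of "N * T" h n _ r] N T v r by (simp add: w_def del: index_mult_mat index_mult_mat_vec)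
  qed (use N in simp)
  also have "(N * T) *\<^sub>v v = N *\<^sub>v u" using N T v uv by (simp add: assoc_mult_mat_vec[of N h n T n v])
  finally have "N *\<^sub>v (T *\<^sub>v w) = 0\<^sub>v h"
    using u(2) N T assoc_mult_mat_vec[of N h n T n w] by (simp add: w_def)
  then have "w = 0\<^sub>v n" using Bn by (intro indep) (auto simp: w_def)
  then have "v $ c = 0" if "c < n" "c \<notin> B" for c
    using that by (auto simp: w_def vec_eq_iff split: if_splits)
  with v uv show ?thesis by (rule that)
qed

abbreviation "const_part \<equiv> map_mat (\<lambda>f :: complex fps. fps_nth f 0)"
abbreviation "lin_part \<equiv> map_mat (\<lambda>f :: complex fps. fps_nth f 1)"

lemma map_fps_const_carrier [simp]: "T \<in> carrier_mat n m \<Longrightarrow> map_mat fps_const T \<in> carrier_mat n m"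
  by simp

lemma fps_nth_1_mult: "fps_nth (f * g) (Suc 0) = fps_nth f 0 * fps_nth g (Suc 0) + fps_nth f (Suc 0) * fps_nth g 0"
  by (simp add: fps_mult_nth)

lemma mult_entry_eq_0:
  assumes "A \<in> carrier_mat h n" "T \<in> carrier_mat n n" "A *\<^sub>v col T c = 0\<^sub>v h" "r < h" "c < n"
  shows "(A * T) $$ (r, c) = 0"
  using arg_cong[OF assms(3), of "\<lambda>x. x $ r"] assms(1,2,4,5) by simp

lemma mult_entry_coeff:
  assumes "A \<in> carrier_mat h n" "S \<in> carrier_mat n m" "r < h" "c < m"
  shows "fps_nth ((A * S) $$ (r, c)) 0 = (const_part A * const_part S) $$ (r, c)"
    "fps_nth ((A * S) $$ (r, c)) 1 = (lin_part A * const_part S) $$ (r, c) + (const_part A * lin_part S) $$ (r, c)"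
  using assms by (simp_all add: scalar_prod_def fps_sum_nth fps_nth_1_mult sum.distrib)

lemma const_part_fps_const: "const_part (map_mat fps_const T) = T"
  by (rule eq_matI) simp_all

lemma kernel_column_dvd:
  assumes "N \<in> carrier_mat h n" "T \<in> carrier_mat n n" "const_part N *\<^sub>v col T c = 0\<^sub>v h" "r < h" "c < n"
  shows "fps_nth ((N * map_mat fps_const T) $$ (r, c)) 0 = 0"
proof -
  have "fps_nth ((N * map_mat fps_const T) $$ (r, c)) 0 = (const_part N * T) $$ (r, c)"
    using mult_entry_coeff(1)[OF assms(1) map_fps_const_carrier[OF assms(2)] assms(4,5)]
    by (simp only: const_part_fps_const)
  also have "\<dots> = 0"
    by (rule mult_entry_eq_0[OF _ assms(2,3,4,5)]) (use assms(1) in simp)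
  finally show ?thesis .
qed

lemma det_const_part: "A \<in> carrier_mat n n \<Longrightarrow> det (const_part A) = fps_nth (det A) 0"
  using comm_ring_hom.hom_det[OF fps_coeff_0_hom] by blast

text \<open>In an adapted basis, the columns that span the kernel of the constant part become divisible
  by \<open>X\<close>.\<close>

lemma fps_X_power_dvd_maximal_minor:
  fixes N :: "complex fps mat"
  assumes ad: "kernel_adapted (const_part N) T B" and N: "N \<in> carrier_mat h n"
    and f: "f \<in> {..<n} \<rightarrow> {..<h}"
  shows "fps_X ^ card B dvd det (select_rows N f)"
proof -
  let ?S = "map_mat fps_const T"
  have T: "T \<in> carrier_mat n n" "det T \<noteq> 0" and Bn: "B \<subseteq> {..<n}"
    and kill: "\<And>c. c \<in> B \<Longrightarrow> const_part N *\<^sub>v col T c = 0\<^sub>v h"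
    using ad N by (auto simp: kernel_adapted_def)
  have det: "fps_nth (det ?S) 0 \<noteq> 0"
    using T det_const_part[of ?S n] by (simp add: const_part_fps_const)
  have "fps_X ^ (\<Sum>c<n. if c \<in> B then 1 else 0) dvd det (select_rows N f)"
  proof (rule fps_X_power_dvd_minor[OF N _ f det])
    fix r c assume rc: "r < h" "c < n"
    have "fps_nth ((N * ?S) $$ (r, c)) 0 = 0" if "c \<in> B"
      by (rule kernel_column_dvd[OF N T(1) kill[OF that] rc])
    then show "fps_X ^ (if c \<in> B then 1 else 0) dvd (N * ?S) $$ (r, c)"
      using fps_X_power_dvd_iff[of 1] by auto
  qed (use T in simp)
  also have "(\<Sum>c<n. if c \<in> B then 1 else 0 :: nat) = card B"
    using Bn by (simp add: sum.If_cases Int_absorb1 Int_absorb2)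
  finally show ?thesis .
qed

text \<open>A non-zero kernel vector of the constant part that lifts to a solution modulo \<open>X\<^sup>2\<close> can be made
  part of the basis, and contributes a column divisible by \<open>X\<^sup>2\<close>.\<close>

lemma fps_X_power_dvd_maximal_minor_Suc:
  fixes N :: "complex fps mat"
  assumes ad: "kernel_adapted (const_part N) T B" and N: "N \<in> carrier_mat h n"
    and f: "f \<in> {..<n} \<rightarrow> {..<h}"
    and u: "u0 \<in> carrier_vec n" "u1 \<in> carrier_vec n" "u0 \<noteq> 0\<^sub>v n"
      "const_part N *\<^sub>v u0 = 0\<^sub>v h" "lin_part N *\<^sub>v u0 + const_part N *\<^sub>v u1 = 0\<^sub>v h"
  shows "fps_X ^ Suc (card B) dvd det (select_rows N f)"
proof -
  have T: "T \<in> carrier_mat n n" "det T \<noteq> 0" and Bn: "B \<subseteq> {..<n}"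
    and kill: "\<And>c. c \<in> B \<Longrightarrow> const_part N *\<^sub>v col T c = 0\<^sub>v h"
    using ad N by (auto simp: kernel_adapted_def)
  obtain v where v: "v \<in> carrier_vec n" "u0 = T *\<^sub>v v" "\<And>c. c < n \<Longrightarrow> c \<notin> B \<Longrightarrow> v $ c = 0"
    by (rule kernel_adapted_coordinates[OF ad _ u(1,4)]) (use N in auto)
  have "v \<noteq> 0\<^sub>v n" using u(3) v T by auto
  then obtain k where k: "k < n" "v $ k \<noteq> 0" using v(1) by (metis carrier_vecD eq_vecI index_zero_vec)
  then have kB: "k \<in> B" using v(3) by blast
  \<comment> \<open>replace the \<open>k\<close>-th kernel vector by a lift of \<open>u0\<close> that \<open>N\<close> kills to second order\<close>
  define S where "S = replace_col (map_mat fps_const T) (vec n (\<lambda>i. fps_const (u0 $ i) + fps_X * fps_const (u1 $ i))) k"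
  have S: "S \<in> carrier_mat n n" using T by (simp add: S_def replace_col_def)
  have "const_part S = replace_col T (T *\<^sub>v v) k"
    by (rule eq_matI) (use T v in \<open>auto simp: S_def replace_col_def\<close>)
  then have "fps_nth (det S) 0 = v $ k * det T"
    using cramer_lemma_mat[OF T(1) v(1) k(1)] det_const_part[OF S] by simp
  then have det: "fps_nth (det S) 0 \<noteq> 0" using T k by simp
  have "fps_X ^ (\<Sum>c<n. if c = k then 2 else if c \<in> B then 1 else 0) dvd det (select_rows N f)"
  proof (rule fps_X_power_dvd_minor[OF N S f det])
    fix r c assume rc: "r < h" "c < n"
    have 1: "fps_nth ((N * S) $$ (r, c)) 0 = 0" if "c \<in> B" "c \<noteq> k"
    proof -
      have "col (const_part S) c = col T c" using T rc that
        by (intro eq_vecI) (auto simp: S_def replace_col_def)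
      then have "(const_part N * const_part S) $$ (r, c) = 0"
        using kill[OF that(1)] N S by (intro mult_entry_eq_0[OF _ _ _ rc]) simp_all
      then show ?thesis unfolding mult_entry_coeff(1)[OF N S rc] .
    qed
    have 2: "fps_nth ((N * S) $$ (r, k)) 0 = 0" "fps_nth ((N * S) $$ (r, k)) 1 = 0"
    proof -
      have "col (const_part S) k = u0" "col (lin_part S) k = u1" using T k u(1,2)
        by (auto simp: S_def replace_col_def intro!: eq_vecI)
      then show "fps_nth ((N * S) $$ (r, k)) 0 = 0" "fps_nth ((N * S) $$ (r, k)) 1 = 0"
        unfolding mult_entry_coeff[OF N S rc(1) k(1)]
        using N S rc(1) k(1) arg_cong[OF u(4), of "\<lambda>x. x $ r"] arg_cong[OF u(5), of "\<lambda>x. x $ r"]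
        by simp_all
    qed
    show "fps_X ^ (if c = k then 2 else if c \<in> B then 1 else 0) dvd (N * S) $$ (r, c)"
      unfolding fps_X_power_dvd_iff using 1 2 by (auto simp: less_2_cases_iff)
  qed
  also have "(\<Sum>c<n. if c = k then 2 else if c \<in> B then 1 else 0 :: nat) = (\<Sum>c<n. (if c \<in> B then 1 else 0) + (if c = k then 1 else 0))"
    using kB by (intro sum.cong) auto
  also have "\<dots> = Suc (card B)"
    using Bn k by (simp add: sum.distrib sum.If_cases Int_absorb1 Int_absorb2)
  finally show ?thesis .
qed

text \<open>Divide the kernel columns by \<open>X\<close>.  If no non-zero kernel vector lifts to first order, the constant
  part of the resulting matrix has trivial kernel, so one of its maximal minors is a unit.\<close>

lemma exists_maximal_minor_of_order:
  fixes N :: "complex fps mat"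
  assumes ad: "kernel_adapted (const_part N) T B" and N: "N \<in> carrier_mat h n"
    and semisimple: "\<And>u0 u1. u0 \<in> carrier_vec n \<Longrightarrow> u1 \<in> carrier_vec n \<Longrightarrow> const_part N *\<^sub>v u0 = 0\<^sub>v h \<Longrightarrow>
      lin_part N *\<^sub>v u0 + const_part N *\<^sub>v u1 = 0\<^sub>v h \<Longrightarrow> u0 = 0\<^sub>v n"
  shows "\<exists>f \<in> {..<n} \<rightarrow> {..<h}. inj_on f {..<n} \<and> \<not> fps_X ^ Suc (card B) dvd det (select_rows N f)"
proof -
  have T: "T \<in> carrier_mat n n" "det T \<noteq> 0" and Bn: "B \<subseteq> {..<n}"
    and kill: "\<And>c. c \<in> B \<Longrightarrow> const_part N *\<^sub>v col T c = 0\<^sub>v h"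
    and indep: "\<And>v. v \<in> carrier_vec n \<Longrightarrow> \<forall>c\<in>B. v $ c = 0 \<Longrightarrow> const_part N *\<^sub>v (T *\<^sub>v v) = 0\<^sub>v h \<Longrightarrow> v = 0\<^sub>v n"
    using ad N by (auto simp: kernel_adapted_def)
  let ?S = "map_mat fps_const T"
  define k where "k c = (if c \<in> B then 1 else 0 :: nat)" for c
  define M where "M = mat h n (\<lambda>(r, c). fps_shift (k c) ((N * ?S) $$ (r, c)))"
  have M: "M \<in> carrier_mat h n" by (simp add: M_def)
  have NS: "N * ?S \<in> carrier_mat h n" using N T by simp
  have entry: "(N * ?S) $$ (r, c) = fps_X ^ k c * M $$ (r, c)" if rc: "r < h" "c < n" for r c
  proof -
    have "fps_nth ((N * ?S) $$ (r, c)) 0 = 0" if "c \<in> B"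
      by (rule kernel_column_dvd[OF N T(1) kill[OF that] rc])
    then have "\<forall>i<k c. fps_nth ((N * ?S) $$ (r, c)) i = 0" by (simp add: k_def)
    moreover have "M $$ (r, c) = fps_shift (k c) ((N * ?S) $$ (r, c))"
      unfolding M_def using rc by (simp del: index_mult_mat)
    ultimately show ?thesis by (simp only: fps_X_power_mult_fps_shift)
  qed
  have nth0: "fps_nth ((N * ?S) $$ (r, c)) 0 = (const_part N * T) $$ (r, c)"
    and nth1: "fps_nth ((N * ?S) $$ (r, c)) 1 = (lin_part N * T) $$ (r, c)" if "r < h" "c < n" for r c
  proof -
    have "(const_part N * lin_part ?S) $$ (r, c) = 0" using that N T by (simp add: scalar_prod_def)
    then show "fps_nth ((N * ?S) $$ (r, c)) 0 = (const_part N * T) $$ (r, c)"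
      "fps_nth ((N * ?S) $$ (r, c)) 1 = (lin_part N * T) $$ (r, c)"
      using mult_entry_coeff[OF N map_fps_const_carrier[OF T(1)] that]
      by (simp_all only: const_part_fps_const add_0_right)
  qed
  have lead: "c \<in> B \<Longrightarrow> (const_part N * T) $$ (r, c) = 0"
    "c \<in> B \<Longrightarrow> fps_nth (M $$ (r, c)) 0 = (lin_part N * T) $$ (r, c)"
    "c \<notin> B \<Longrightarrow> fps_nth (M $$ (r, c)) 0 = (const_part N * T) $$ (r, c)" if rc: "r < h" "c < n" for r c
    unfolding nth0[OF rc, symmetric] nth1[OF rc, symmetric] entry[OF rc] by (simp_all add: k_def)
  \<comment> \<open>a kernel vector of the leading terms is a first-order solution for \<open>N\<close>\<close>
  have Minj: "v = 0\<^sub>v n" if v: "v \<in> carrier_vec n" "const_part M *\<^sub>v v = 0\<^sub>v h" for v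
  proof -
    define vB where "vB = vec n (\<lambda>c. if c \<in> B then v $ c else 0)"
    define vC where "vC = vec n (\<lambda>c. if c \<in> B then 0 else v $ c)"
    have PT: "const_part N * T \<in> carrier_mat h n" "lin_part N * T \<in> carrier_mat h n"
      "\<And>w. w \<in> carrier_vec n \<Longrightarrow> const_part N *\<^sub>v (T *\<^sub>v w) = (const_part N * T) *\<^sub>v w"
      "\<And>w. w \<in> carrier_vec n \<Longrightarrow> lin_part N *\<^sub>v (T *\<^sub>v w) = (lin_part N * T) *\<^sub>v w"
      using N T(1) by (simp_all add: assoc_mult_mat_vec[of _ h n T n])
    have car: "vB \<in> carrier_vec n" "vC \<in> carrier_vec n" by (simp_all add: vB_def vC_def)
    have 0: "const_part N *\<^sub>v (T *\<^sub>v vB) = 0\<^sub>v h"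
    proof (rule eq_vecI)
      fix r assume "r < dim_vec (0\<^sub>v h)"
      then have r: "r < h" by simp
      have "(\<Sum>c<n. (const_part N * T) $$ (r, c) * vB $ c) = 0"
      proof (rule sum.neutral, intro ballI)
        fix c assume c: "c \<in> {..<n}"
        then show "(const_part N * T) $$ (r, c) * vB $ c = 0"
          using lead(1)[OF r, of c] by (simp add: vB_def del: index_mult_mat(1))
      qed
      then have "((const_part N * T) *\<^sub>v vB) $ r = 0"
        unfolding mult_mat_vec_nth[OF PT(1) car(1) r] .
      then show "(const_part N *\<^sub>v (T *\<^sub>v vB)) $ r = 0\<^sub>v h $ r"
        unfolding PT(3)[OF car(1)] using r by (simp del: index_mult_mat_vec)
    qed (use N in simp)
    have 1: "lin_part N *\<^sub>v (T *\<^sub>v vB) + const_part N *\<^sub>v (T *\<^sub>v vC) = 0\<^sub>v h"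
    proof (rule eq_vecI)
      fix r assume "r < dim_vec (0\<^sub>v h)"
      then have r: "r < h" by simp
      have "(\<Sum>c<n. (lin_part N * T) $$ (r, c) * vB $ c + (const_part N * T) $$ (r, c) * vC $ c)
        = (\<Sum>c<n. fps_nth (M $$ (r, c)) 0 * v $ c)"
      proof (rule sum.cong)
        fix c assume c: "c \<in> {..<n}"
        then show "(lin_part N * T) $$ (r, c) * vB $ c + (const_part N * T) $$ (r, c) * vC $ c
          = fps_nth (M $$ (r, c)) 0 * v $ c"
          using lead[OF r, of c] by (simp add: vB_def vC_def del: index_mult_mat(1))
      qed simp
      also have "\<dots> = (const_part M *\<^sub>v v) $ r"
        using mult_mat_vec_nth[of "const_part M" h n v r] r M v(1) by (simp del: index_mult_mat_vec)
      also have "\<dots> = 0" unfolding v(2) using r by simp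
      finally have "((lin_part N * T) *\<^sub>v vB) $ r + ((const_part N * T) *\<^sub>v vC) $ r = 0"
        unfolding mult_mat_vec_nth[OF PT(1) car(2) r] mult_mat_vec_nth[OF PT(2) car(1) r] sum.distrib .
      then have "((lin_part N * T) *\<^sub>v vB + (const_part N * T) *\<^sub>v vC) $ r = 0"
        using r N by (simp del: index_mult_mat_vec)
      then show "(lin_part N *\<^sub>v (T *\<^sub>v vB) + const_part N *\<^sub>v (T *\<^sub>v vC)) $ r = 0\<^sub>v h $ r"
        unfolding PT(3)[OF car(2)] PT(4)[OF car(1)] using r by simp
    qed (use N in simp)
    have "T *\<^sub>v vB = 0\<^sub>v n"
      using T car by (intro semisimple[OF _ _ 0 1]) auto
    then have vB0: "vB = 0\<^sub>v n"
      using det_0_iff_vec_prod_zero_field[OF T(1)] T(2) car by blast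
    have "lin_part N *\<^sub>v 0\<^sub>v n = 0\<^sub>v h" using N by (intro eq_vecI) auto
    with 1 have "const_part N *\<^sub>v (T *\<^sub>v vC) = 0\<^sub>v h"
      using \<open>T *\<^sub>v vB = 0\<^sub>v n\<close> N T(1) car(2) by simp
    then have "vC = 0\<^sub>v n"
      using Bn by (intro indep) (auto simp: vC_def)
    then have "v $ c = 0" if "c < n" for c
      using vB0 that by (cases "c \<in> B") (auto simp: vB_def vC_def vec_eq_iff split: if_splits)
    then show ?thesis using v by (intro eq_vecI) auto
  qed
  have "const_part M \<in> carrier_mat h n" using M by simp
  from exists_nonzero_maximal_minor[OF this Minj]
  obtain f where f: "f \<in> {..<n} \<rightarrow> {..<h}" and fdet: "det (select_rows (const_part M) f) \<noteq> 0"
    by blast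
  then have detM: "fps_nth (det (select_rows M f)) 0 \<noteq> 0"
    using fdet unfolding map_mat_select_rows[OF M f] det_const_part[OF select_rows_carrier[OF M]] by blast
  have "det (select_rows (N * ?S) f) = (\<Prod>c<n. fps_X ^ k c) * det (select_rows M f)"
  proof (rule det_scale_cols[where n = n])
    fix i c assume ic: "i < n" "c < n"
    then have "f i < h" using f by auto
    from entry[OF this ic(2)]
    show "select_rows (N * ?S) f $$ (i, c) = fps_X ^ k c * select_rows M f $$ (i, c)"
      using ic NS M T(1) by (simp add: select_rows_def del: index_mult_mat(1))
  qed (use NS M T(1) in \<open>simp_all add: select_rows_def\<close>)
  also have "det (select_rows (N * ?S) f) = det (select_rows N f) * det ?S"
    using det_mult[of "select_rows N f" n ?S] select_rows_mult[OF N _ f, of ?S] N T by simp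
  also have "(\<Prod>c<n. fps_X ^ k c :: complex fps) = fps_X ^ card B"
    using Bn by (simp add: k_def sum.If_cases Int_absorb1 Int_absorb2 flip: power_sum)
  finally have eq: "det (select_rows N f) * det ?S = fps_X ^ card B * det (select_rows M f)" .
  have not_dvd: "\<not> fps_X ^ Suc (card B) dvd det (select_rows N f)"
  proof
    assume "fps_X ^ Suc (card B) dvd det (select_rows N f)"
    then have "fps_X ^ Suc (card B) dvd fps_X ^ card B * det (select_rows M f)"
      unfolding eq[symmetric] by simp
    then have "fps_nth (fps_X ^ card B * det (select_rows M f)) (card B) = 0"
      unfolding fps_X_power_dvd_iff by blast
    then show False using detM by (simp add: fps_X_power_mult_nth)
  qed
  then have "det (select_rows N f) \<noteq> 0" by (metis dvd_0_right)
  then have "inj_on f {..<n}" by (rule det_select_rows_inj[OF N])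
  with f not_dvd show ?thesis by blast
qed


section \<open>Minors of a matrix with a kernel vector\<close>

definition delete_col :: "'a mat \<Rightarrow> nat \<Rightarrow> 'a mat" where
  "delete_col P j = mat (dim_row P) (dim_col P - 1) (\<lambda>(r, c). P $$ (r, insert_index j c))"

lemma delete_col_carrier [simp]: "P \<in> carrier_mat h (Suc n) \<Longrightarrow> delete_col P j \<in> carrier_mat h n"
  by (simp add: delete_col_def)

lemma insert_index_less: "c < n \<Longrightarrow> insert_index j c < Suc n"
  by (simp add: insert_index_def)

lemma map_mat_delete_col:
  "P \<in> carrier_mat h (Suc n) \<Longrightarrow> map_mat w (delete_col P j) = delete_col (map_mat w P) j"
  by (rule eq_matI) (simp_all add: delete_col_def insert_index_less)

lemma pick_delete:
  assumes "c < n" "j < Suc n"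
  shows "pick ({..<Suc n} - {j}) c = insert_index j c"
proof -
  let ?J = "{..<Suc n} - {j}"
  have "{a \<in> ?J. a < insert_index j c} = (if c < j then {..<c} else {..<Suc c} - {j})"
    using assms by (auto simp: insert_index_def)
  then have "card {a \<in> ?J. a < insert_index j c} = c"
    by auto
  moreover have "insert_index j c \<in> ?J"
    using assms by (simp add: insert_index_less)
  ultimately show ?thesis using pick_card_in_set by metis
qed

lemma submatrix_delete_col:
  assumes P: "P \<in> carrier_mat h (Suc n)" and I: "I \<subseteq> {..<h}" "card I = n" and j: "j < Suc n"
  shows "submatrix P I ({..<Suc n} - {j}) = select_rows (delete_col P j) (pick I)"
proof -
  have 1: "{i. i < h \<and> i \<in> I} = I" "{c. c < Suc n \<and> c \<in> {..<Suc n} - {j}} = {..<Suc n} - {j}"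
    using I by auto
  have 2: "card ({..<Suc n} - {j}) = n" using j by simp
  have 3: "pick I r < h" if "r < n" for r
    using pick_in_set_le[of r I] that I by auto
  show ?thesis
  proof (rule eq_matI)
    fix r c assume "r < dim_row (select_rows (delete_col P j) (pick I))"
      "c < dim_col (select_rows (delete_col P j) (pick I))"
    then have rc: "r < n" "c < n" using P by (simp_all add: select_rows_def delete_col_def)
    have "submatrix P I ({..<Suc n} - {j}) $$ (r, c) = P $$ (pick I r, pick ({..<Suc n} - {j}) c)"
      by (rule submatrix_index) (use P 1 2 I rc in simp_all)
    also have "\<dots> = select_rows (delete_col P j) (pick I) $$ (r, c)"
      using rc P 3[OF rc(1)] by (simp add: select_rows_def delete_col_def pick_delete[OF rc(2) j])
    finally show "submatrix P I ({..<Suc n} - {j}) $$ (r, c) = select_rows (delete_col P j) (pick I) $$ (r, c)" .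
  qed (use P 1 2 I in \<open>simp_all add: dim_submatrix select_rows_def delete_col_def\<close>)
qed

lemma pick_rows:
  assumes "I \<subseteq> {..<h}" "card I = n"
  shows "pick I \<in> {..<n} \<rightarrow> {..<h}"
  using pick_in_set_le[of _ I] assms by auto

text \<open>Sorting the selected rows multiplies the minor by the sign of a permutation.\<close>

lemma select_rows_pick:
  fixes N :: "'a::comm_ring_1 mat"
  assumes N: "N \<in> carrier_mat h n" and f: "f \<in> {..<n} \<rightarrow> {..<h}" "inj_on f {..<n}"
  obtains s where "s dvd 1" "det (select_rows N f) = s * det (select_rows N (pick (f ` {..<n})))"
proof -
  let ?I = "f ` {..<n}"
  have card: "card ?I = n" using f(2) by (simp add: card_image)
  have fin: "finite ?I" by simp
  \<comment> \<open>the position of row \<open>f r\<close> among the selected rows\<close>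
  define p where "p r = (if r < n then card {a \<in> ?I. a < f r} else r)" for r
  have pick: "pick ?I (p r) = f r" if "r < n" for r
    using pick_card_in_set[of "f r" ?I] that by (simp add: p_def)
  have lt: "p r < n" if "r < n" for r
  proof -
    have "{a \<in> ?I. a < f r} \<subset> ?I" using that by auto
    from psubset_card_mono[OF fin this] show ?thesis using that card by (simp add: p_def)
  qed
  have inj: "inj_on p {0..<n}"
  proof (rule inj_onI)
    fix x y assume xy: "x \<in> {0..<n}" "y \<in> {0..<n}" "p x = p y"
    then have "f x = f y" using pick[of x] pick[of y] by simp
    then show "x = y" using f(2) xy by (auto dest: inj_onD)
  qed
  have "p ` {0..<n} = {0..<n}"
    by (rule endo_inj_surj[OF _ _ inj]) (use lt in auto)
  with inj have "bij_betw p {0..<n} {0..<n}" by (simp add: bij_betw_def)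
  then have perm: "p permutes {0..<n}"
    by (rule bij_imp_permutes) (simp add: p_def)
  have sel: "select_rows N (pick ?I) \<in> carrier_mat n n" using N by (rule select_rows_carrier)
  have "select_rows N f = mat n n (\<lambda>(i, j). select_rows N (pick ?I) $$ (p i, j))"
    by (rule eq_matI) (use N lt pick in \<open>simp_all add: select_rows_def\<close>)
  then have "det (select_rows N f) = signof p * det (select_rows N (pick ?I))"
    using det_permute_rows[OF sel perm] by simp
  moreover have "(signof p :: 'a) dvd 1" by (simp add: sign_def)
  ultimately show ?thesis using that by blast
qed

text \<open>The maximal minors of a matrix with one more column than rows are proportional to any kernel
  vector \<open>d\<close>: put the \<open>j\<close>-th unit vector on top of the matrix and apply the adjugate to the product
  with \<open>d\<close>.\<close>

lemma minors_proportional_to_kernel_vector: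
  fixes P :: "'a::idom mat"
  assumes P: "P \<in> carrier_mat h (Suc n)" and d: "d \<in> carrier_vec (Suc n)" "P *\<^sub>v d = 0\<^sub>v h"
    and f: "f \<in> {..<n} \<rightarrow> {..<h}" and ij: "i < Suc n" "j < Suc n" and dj: "d $ j \<noteq> 0"
  obtains s where "s dvd 1"
    "det (select_rows (delete_col P i) f) * d $ j = s * (det (select_rows (delete_col P j) f) * d $ i)"
proof -
  define Q where "Q = mat (Suc n) (Suc n) (\<lambda>(r, c). if r = 0 then (if c = j then 1 else 0) else P $$ (f (r - 1), c))"
  have Q: "Q \<in> carrier_mat (Suc n) (Suc n)" by (simp add: Q_def)
  have Qd: "Q *\<^sub>v d = d $ j \<cdot>\<^sub>v unit_vec (Suc n) 0"
  proof (rule eq_vecI)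
    fix r assume "r < dim_vec (d $ j \<cdot>\<^sub>v unit_vec (Suc n) 0)"
    then have r: "r < Suc n" by simp
    show "(Q *\<^sub>v d) $ r = (d $ j \<cdot>\<^sub>v unit_vec (Suc n) 0) $ r"
    proof (cases "r = 0")
      case True
      have "(\<Sum>c<Suc n. Q $$ (r, c) * d $ c) = (\<Sum>c<Suc n. if c = j then d $ c else 0)"
        using True by (intro sum.cong) (simp_all add: Q_def)
      then show ?thesis using True mult_mat_vec_nth[OF Q d(1) r] ij(2) by (simp add: sum.delta del: sum.lessThan_Suc)
    next
      case False
      then have fr: "f (r - 1) < h" using f r by auto
      have "(\<Sum>c<Suc n. Q $$ (r, c) * d $ c) = (\<Sum>c<Suc n. P $$ (f (r - 1), c) * d $ c)"
        using False r by (intro sum.cong) (simp_all add: Q_def)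
      also have "\<dots> = (P *\<^sub>v d) $ f (r - 1)" using mult_mat_vec_nth[OF P d(1) fr] by simp
      also have "\<dots> = 0" unfolding d(2) using fr by simp
      finally show ?thesis using False mult_mat_vec_nth[OF Q d(1) r] r by simp
    qed
  qed (use Q in simp)
  have cof: "cofactor Q 0 k = (-1) ^ k * det (select_rows (delete_col P k) f)" if k: "k < Suc n" for k
  proof -
    have "mat_delete Q 0 k = select_rows (delete_col P k) f"
    proof (rule eq_matI)
      fix r c assume "r < dim_row (select_rows (delete_col P k) f)" "c < dim_col (select_rows (delete_col P k) f)"
      then have rc: "r < n" "c < n" using P by (simp_all add: select_rows_def delete_col_def)
      then have "f r < h" using f by auto
      then show "mat_delete Q 0 k $$ (r, c) = select_rows (delete_col P k) f $$ (r, c)"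
        using rc P by (simp add: select_rows_def delete_col_def mat_delete_def Q_def insert_index_def)
    qed (use P in \<open>simp_all add: select_rows_def delete_col_def Q_def\<close>)
    then show ?thesis by (simp add: cofactor_def)
  qed
  have key: "det Q * d $ k = d $ j * cofactor Q 0 k" if k: "k < Suc n" for k
  proof -
    have "(adj_mat Q * Q) *\<^sub>v d = adj_mat Q *\<^sub>v (Q *\<^sub>v d)"
      by (rule assoc_mult_mat_vec[OF adj_mat(1)[OF Q] Q d(1)])
    then have "(det Q \<cdot>\<^sub>m 1\<^sub>m (Suc n)) *\<^sub>v d = adj_mat Q *\<^sub>v (d $ j \<cdot>\<^sub>v unit_vec (Suc n) 0)"
      unfolding adj_mat(3)[OF Q] Qd .
    then have eq: "((det Q \<cdot>\<^sub>m 1\<^sub>m (Suc n)) *\<^sub>v d) $ k = (adj_mat Q *\<^sub>v (d $ j \<cdot>\<^sub>v unit_vec (Suc n) 0)) $ k"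
      by simp
    have "(\<Sum>c<Suc n. (det Q \<cdot>\<^sub>m 1\<^sub>m (Suc n)) $$ (k, c) * d $ c) = (\<Sum>c<Suc n. if c = k then det Q * d $ c else 0)"
      using k by (intro sum.cong) simp_all
    also have "\<dots> = det Q * d $ k" using k by (simp add: sum.delta del: sum.lessThan_Suc)
    finally have l: "((det Q \<cdot>\<^sub>m 1\<^sub>m (Suc n)) *\<^sub>v d) $ k = det Q * d $ k"
      using mult_mat_vec_nth[of "det Q \<cdot>\<^sub>m 1\<^sub>m (Suc n)" "Suc n" "Suc n" d k] d(1) k
      by (simp del: sum.lessThan_Suc index_mult_mat_vec)
    have "(\<Sum>c<Suc n. adj_mat Q $$ (k, c) * (d $ j \<cdot>\<^sub>v unit_vec (Suc n) 0) $ c)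
      = (\<Sum>c<Suc n. if c = 0 then adj_mat Q $$ (k, c) * d $ j else 0)"
      by (intro sum.cong) simp_all
    also have "\<dots> = d $ j * cofactor Q 0 k"
      using k Q by (simp add: sum.delta adj_mat_def del: sum.lessThan_Suc)
    finally have r: "(adj_mat Q *\<^sub>v (d $ j \<cdot>\<^sub>v unit_vec (Suc n) 0)) $ k = d $ j * cofactor Q 0 k"
      using mult_mat_vec_nth[OF adj_mat(1)[OF Q], of "d $ j \<cdot>\<^sub>v unit_vec (Suc n) 0" k] k
      by (simp del: sum.lessThan_Suc index_mult_mat_vec)
    show ?thesis using eq unfolding l r .
  qed
  from key[OF ij(2)] dj have det: "det Q = cofactor Q 0 j" by simp
  have "(- 1) ^ i * det (select_rows (delete_col P i) f) * d $ j = (- 1) ^ j * det (select_rows (delete_col P j) f) * d $ i"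
    using key[OF ij(1)] unfolding det cof[OF ij(1)] cof[OF ij(2)] by (simp add: mult_ac)
  then have "det (select_rows (delete_col P i) f) * d $ j = ((- 1) ^ i * (- 1) ^ j) * (det (select_rows (delete_col P j) f) * d $ i)"
    by (cases "even i"; cases "even j") (simp_all add: minus_one_power_iff, metis minus_minus)
  moreover have "((- 1) ^ i * (- 1) ^ j :: 'a) dvd 1"
    by (simp add: minus_one_power_iff)
  ultimately show ?thesis using that by blast
qed


section \<open>The order of the greatest common divisor of an ideal of Laurent polynomials\<close>

definition laurent_of_poly :: "int poly \<Rightarrow> int \<Rightarrow>\<^sub>0 int" where
  "laurent_of_poly p = poly (map_poly lconst p) (tpow 1)"

lemma lconst_hom: "comm_ring_hom (lconst :: int \<Rightarrow> int \<Rightarrow>\<^sub>0 int)"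
  by unfold_locales (simp_all add: single_add mult_single flip: single_one)

lemma laurent_of_poly_hom: "comm_ring_hom laurent_of_poly"
proof -
  interpret comm_ring_hom "lconst :: int \<Rightarrow> int \<Rightarrow>\<^sub>0 int" by (rule lconst_hom)
  interpret map: map_poly_comm_ring_hom "lconst :: int \<Rightarrow> int \<Rightarrow>\<^sub>0 int" ..
  show ?thesis by unfold_locales (simp_all add: laurent_of_poly_def map.hom_add map.hom_mult)
qed

lemma tpow_mult: "tpow i * tpow j = (tpow (i + j) :: int \<Rightarrow>\<^sub>0 'r::comm_ring_1)"
  by (simp add: mult_single)

lemma tpow_power: "tpow 1 ^ n = (tpow (int n) :: int \<Rightarrow>\<^sub>0 'r::comm_ring_1)"
  by (induction n) (simp_all add: tpow_mult flip: single_one)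

lemma tpow_unit: "(tpow i :: int \<Rightarrow>\<^sub>0 'r::comm_ring_1) dvd 1"
proof -
  have "tpow i * tpow (- i) = (1 :: int \<Rightarrow>\<^sub>0 'r)" by (simp add: tpow_mult)
  then show ?thesis by (metis dvd_triv_left)
qed

lemma laurent_of_poly_monom: "laurent_of_poly (monom c n) = Poly_Mapping.single (int n) c"
proof -
  interpret comm_ring_hom "lconst :: int \<Rightarrow> int \<Rightarrow>\<^sub>0 int" by (rule lconst_hom)
  show ?thesis
    by (simp add: laurent_of_poly_def poly_monom map_poly_monom tpow_power mult_single)
qed

lemma laurent_of_poly_smult: "laurent_of_poly (Polynomial.smult c p) = lconst c * laurent_of_poly p"
proof -
  interpret comm_ring_hom laurent_of_poly by (rule laurent_of_poly_hom)
  have "Polynomial.smult c p = monom c 0 * p" by (simp add: monom_0)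
  then show ?thesis by (simp add: hom_mult laurent_of_poly_monom)
qed

lemma laurent_eq_poly: "\<exists>N p. tpow N * x = laurent_of_poly p"
proof -
  interpret comm_ring_hom laurent_of_poly by (rule laurent_of_poly_hom)
  define N where "N = (\<Sum>k\<in>Poly_Mapping.keys x. \<bar>k\<bar>)"
  have N: "0 \<le> k + N" if "k \<in> Poly_Mapping.keys x" for k
    using member_le_sum[OF that, of abs] by (simp add: N_def)
  have "tpow N * x = (\<Sum>k\<in>Poly_Mapping.keys x. tpow N * Poly_Mapping.single k (Poly_Mapping.lookup x k))"
    using pm_sum_singles[of x] by (metis sum_distrib_left)
  also have "\<dots> = (\<Sum>k\<in>Poly_Mapping.keys x. laurent_of_poly (monom (Poly_Mapping.lookup x k) (nat (k + N))))"
    by (rule sum.cong) (simp_all add: laurent_of_poly_monom mult_single N add.commute)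
  also have "\<dots> = laurent_of_poly (\<Sum>k\<in>Poly_Mapping.keys x. monom (Poly_Mapping.lookup x k) (nat (k + N)))"
    by (simp add: hom_sum)
  finally show ?thesis by blast
qed

text \<open>By Gauss's lemma, integer factors of a multiple of a primitive polynomial can be cancelled.\<close>

lemma primitive_dvd_smult:
  fixes g h :: "int poly"
  assumes "content g = 1" "g dvd Polynomial.smult a h" "a \<noteq> 0"
  shows "g dvd h"
proof -
  from assms(2) obtain s where s: "Polynomial.smult a h = g * s" by (elim dvdE)
  have "content (Polynomial.smult a h) = content s" unfolding s content_mult using assms(1) by simp
  then have "content s = normalize a * content h" by simp
  then have "a dvd content s" by simp
  then have "[:a:] dvd s" by (simp add: const_poly_dvd_iff_dvd_content)
  then obtain s' where "s = Polynomial.smult a s'" by (auto elim!: dvdE)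
  with s have "Polynomial.smult a (h - g * s') = 0" by (simp add: smult_diff_right)
  with assms(3) have "h = g * s'" by simp
  then show ?thesis by simp
qed

text \<open>An ideal of integral Laurent polynomials becomes principal over the rationals, with a primitive
  integral generator, which divides the ideal already over the integers.  Hence the greatest common
  divisor can be computed rationally, and vanishes at a point to the order to which the ideal does.\<close>

lemma ideal_rationally_principal:
  fixes E :: "(int \<Rightarrow>\<^sub>0 int) set"
  assumes add: "\<And>x y. x \<in> E \<Longrightarrow> y \<in> E \<Longrightarrow> x - y \<in> E" and mult: "\<And>x y. x \<in> E \<Longrightarrow> y * x \<in> E"
    and nonzero: "x0 \<in> E" "x0 \<noteq> 0"
  shows "\<exists>c g. c \<noteq> 0 \<and> lconst c * g \<in> E \<and> (\<forall>x\<in>E. g dvd x)"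
proof -
  interpret comm_ring_hom laurent_of_poly by (rule laurent_of_poly_hom)
  have poly_in: "\<exists>N p. tpow N * x = laurent_of_poly p \<and> laurent_of_poly p \<in> E" if "x \<in> E" for x
    using laurent_eq_poly[of x] mult[OF that] by metis
  let ?Q = "\<lambda>p. p \<noteq> 0 \<and> laurent_of_poly p \<in> E"
  obtain N p where p: "tpow N * x0 = laurent_of_poly p" "laurent_of_poly p \<in> E"
    using poly_in[OF nonzero(1)] by blast
  have "tpow N * x0 \<noteq> 0" using nonzero(2) by simp
  with p have "?Q p" by auto
  \<comment> \<open>pseudo-division shows that an element of least degree divides every other one up to a constant\<close>
  then obtain f where f: "?Q f" and min: "\<And>q. ?Q q \<Longrightarrow> degree f \<le> degree q"
    using ex_has_least_nat[of ?Q p degree] by blast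
  define g where "g = primitive_part f"
  have "content g = 1" using f by (simp add: g_def)
  have dvd_poly: "g dvd h" if h: "laurent_of_poly h \<in> E" for h
  proof -
    obtain q r where qr: "pseudo_divmod h f = (q, r)" by (cases "pseudo_divmod h f")
    define a where "a = coeff f (degree f) ^ (Suc (degree h) - degree f)"
    have "a \<noteq> 0" using f by (simp add: a_def)
    have eq: "Polynomial.smult a h = f * q + r" and r: "r = 0 \<or> degree r < degree f"
      using pseudo_divmod[OF _ qr] f unfolding a_def by blast+
    have "laurent_of_poly r = lconst a * laurent_of_poly h - laurent_of_poly q * laurent_of_poly f"
      using arg_cong[OF eq, of laurent_of_poly] by (simp add: hom_add hom_mult laurent_of_poly_smult mult.commute)
    also have "\<dots> \<in> E" using f by (intro add mult h) auto
    finally have "r = 0" using min[of r] r by force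
    with eq have "f dvd Polynomial.smult a h" by simp
    moreover have "g dvd f" unfolding g_def by (metis content_times_primitive_part dvd_smult dvd_refl)
    ultimately show ?thesis
      using primitive_dvd_smult[OF \<open>content g = 1\<close> _ \<open>a \<noteq> 0\<close>] dvd_trans by blast
  qed
  show ?thesis
  proof (intro exI conjI ballI)
    show "content f \<noteq> 0" using f by simp
    show "lconst (content f) * laurent_of_poly g \<in> E"
      using f by (simp add: g_def flip: laurent_of_poly_smult)
    fix x assume "x \<in> E"
    then obtain N h where h: "tpow N * x = laurent_of_poly h" "laurent_of_poly h \<in> E"
      using poly_in by blast
    have "laurent_of_poly g dvd tpow N * x"
      unfolding h(1) using dvd_poly[OF h(2)] by (rule hom_dvd)
    then show "laurent_of_poly g dvd x"
      using tpow_unit by (metis dvd_mult_unit_iff')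
  qed
qed

lemma gcd_order:
  fixes S :: "(int \<Rightarrow>\<^sub>0 int) set"
  assumes gcd: "is_gcd_of \<Delta> (Idl\<^bsub>class_ring\<^esub> S)" and "\<Delta> \<noteq> 0" and z: "z \<noteq> 0"
    and dvd: "\<And>x. x \<in> S \<Longrightarrow> fps_X ^ k dvd int_expansion z x"
  shows "fps_X ^ k dvd int_expansion z \<Delta>"
proof -
  interpret h: comm_ring_hom "int_expansion z" using z by (rule int_expansion_hom)
  let ?E = "Idl\<^bsub>class_ring\<^esub> S"
  have R: "ring (class_ring :: (int \<Rightarrow>\<^sub>0 int) ring)"
    using class_cring.cring_axioms by (rule cring.axioms(1))
  interpret E: ideal ?E "class_ring :: (int \<Rightarrow>\<^sub>0 int) ring"
    by (rule ring.genideal_ideal[OF R]) simp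
  have "x + y \<in> ?E" if "x \<in> ?E" "y \<in> ?E" for x y
    using E.a_closed[OF that] by simp
  moreover have mult: "y * x \<in> ?E" if "x \<in> ?E" for x y
    using E.I_l_closed[OF that, of y] by simp
  ultimately have diff: "x - y \<in> ?E" if "x \<in> ?E" "y \<in> ?E" for x y
    using that mult[of y "-1"] by (metis add_uminus_conv_diff mult_minus1)
  obtain x0 where x0: "x0 \<in> ?E" "x0 \<noteq> 0"
    using gcd \<open>\<Delta> \<noteq> 0\<close> unfolding is_gcd_of_def by (metis dvd_0_left_iff dvd_refl)
  obtain c g where g: "c \<noteq> 0" "lconst c * g \<in> ?E" "\<And>x. x \<in> ?E \<Longrightarrow> g dvd x"
    using ideal_rationally_principal[of ?E, OF diff mult x0] by blast
  have "ideal {x. fps_X ^ k dvd int_expansion z x} (class_ring :: (int \<Rightarrow>\<^sub>0 int) ring)"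
  proof (rule idealI)
    show "subgroup {x. fps_X ^ k dvd int_expansion z x} (add_monoid (class_ring :: (int \<Rightarrow>\<^sub>0 int) ring))"
    proof
      show "inv\<^bsub>add_monoid class_ring\<^esub> x \<in> {x. fps_X ^ k dvd int_expansion z x}"
        if "x \<in> {x. fps_X ^ k dvd int_expansion z x}" for x
      proof -
        have "a_inv (class_ring :: (int \<Rightarrow>\<^sub>0 int) ring) x = - x" by (simp only: class_ring_simps)
        then show ?thesis using that by (simp add: a_inv_def h.hom_uminus)
      qed
    qed (simp_all add: h.hom_add)
  qed (simp_all add: h.hom_mult R)
  then have "?E \<subseteq> {x. fps_X ^ k dvd int_expansion z x}"
    by (rule ring.genideal_minimal[OF R]) (use dvd in auto)
  with g(2) have "fps_X ^ k dvd int_expansion z (lconst c) * int_expansion z g"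
    by (auto simp: h.hom_mult)
  moreover have "int_expansion z (lconst c) dvd 1"
    using g(1) by (simp add: int_expansion_def pm_ext_single flip: fps_of_int)
  ultimately have "fps_X ^ k dvd int_expansion z g" by (metis dvd_mult_unit_iff')
  moreover have "g dvd \<Delta>" using gcd g(3) unfolding is_gcd_of_def by blast
  ultimately show ?thesis using h.hom_dvd dvd_trans by blast
qed


section \<open>Quotient modules\<close>

definition cls :: "'m::ab_group_add set \<Rightarrow> 'm \<Rightarrow> 'm set" where
  "cls H x = (\<lambda>h. h + x) ` H"

locale add_subgroup =
  fixes H :: "'m::ab_group_add set"
  assumes zero_mem: "0 \<in> H" and diff_mem: "x \<in> H \<Longrightarrow> y \<in> H \<Longrightarrow> x - y \<in> H"
begin

lemma uminus_mem: "x \<in> H \<Longrightarrow> - x \<in> H"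
  using diff_mem[OF zero_mem] by simp

lemma add_mem: "x \<in> H \<Longrightarrow> y \<in> H \<Longrightarrow> x + y \<in> H"
  using diff_mem[OF _ uminus_mem] by simp

lemma mem_cls_iff: "y \<in> cls H x \<longleftrightarrow> y - x \<in> H"
  unfolding cls_def by (metis (mono_tags, lifting) add_diff_cancel diff_add_cancel image_iff)

lemma cls_eq_iff: "cls H x = cls H y \<longleftrightarrow> x - y \<in> H"
proof
  assume "cls H x = cls H y"
  moreover have "x \<in> cls H x" by (simp add: mem_cls_iff zero_mem)
  ultimately show "x - y \<in> H" by (simp add: mem_cls_iff)
next
  assume xy: "x - y \<in> H"
  have "w - x \<in> H \<longleftrightarrow> w - y \<in> H" for w
    using add_mem[of "w - x" "x - y"] diff_mem[of "w - y" "x - y"] xy by (auto simp: algebra_simps)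
  then show "cls H x = cls H y" by (auto simp: mem_cls_iff set_eq_iff)
qed

end

lemma a_r_coset_eq_cls:
  assumes "add M = (+)"
  shows "a_r_coset M H x = cls H x"
  using assms by (auto simp: a_r_coset_def r_coset_def cls_def)

lemma quot_module_carrier:
  assumes "add M = (+)"
  shows "carrier (quot_module M H) = cls H ` carrier M"
  using assms a_r_coset_eq_cls[OF assms, of H]
  by (auto simp: quot_module_def A_RCOSETS_def RCOSETS_def a_r_coset_def)

lemma quot_module_zero: "\<zero>\<^bsub>quot_module M H\<^esub> = cls H 0"
  by (simp add: quot_module_def cls_def)

lemma (in add_subgroup) quot_module_add:
  assumes "add M = (+)"
  shows "cls H x \<oplus>\<^bsub>quot_module M H\<^esub> cls H y = cls H (x + y)"
proof -
  have "cls H x \<oplus>\<^bsub>quot_module M H\<^esub> cls H y = {a + b | a b. a \<in> cls H x \<and> b \<in> cls H y}"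
    using assms by (auto simp: quot_module_def set_add_def set_mult_def)
  also have "\<dots> = cls H (x + y)"
  proof (intro equalityI subsetI)
    fix w assume "w \<in> {a + b | a b. a \<in> cls H x \<and> b \<in> cls H y}"
    then obtain a b where ab: "w = a + b" "a - x \<in> H" "b - y \<in> H" by (auto simp: mem_cls_iff)
    have "w - (x + y) = (a - x) + (b - y)" using ab by simp
    with add_mem[OF ab(2,3)] show "w \<in> cls H (x + y)" by (simp only: mem_cls_iff)
  next
    fix w assume "w \<in> cls H (x + y)"
    then have "(w - y) \<in> cls H x" "y \<in> cls H y" by (simp_all add: mem_cls_iff zero_mem algebra_simps)
    moreover have "w = (w - y) + y" by simp
    ultimately show "w \<in> {a + b | a b. a \<in> cls H x \<and> b \<in> cls H y}" by blast
  qed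
  finally show ?thesis .
qed

lemma (in add_subgroup) quot_module_smult:
  assumes "add M = (+)" and "\<And>y. y - x \<in> H \<Longrightarrow> r \<odot>\<^bsub>M\<^esub> y - r \<odot>\<^bsub>M\<^esub> x \<in> H"
  shows "r \<odot>\<^bsub>quot_module M H\<^esub> cls H x = cls H (r \<odot>\<^bsub>M\<^esub> x)"
proof -
  have "r \<odot>\<^bsub>quot_module M H\<^esub> cls H x = (\<Union>y\<in>cls H x. cls H (r \<odot>\<^bsub>M\<^esub> y))"
    by (simp add: quot_module_def a_r_coset_eq_cls[OF assms(1)])
  also have "\<dots> = (\<Union>y\<in>cls H x. cls H (r \<odot>\<^bsub>M\<^esub> x))"
    by (rule SUP_cong) (use assms(2) in \<open>auto simp: mem_cls_iff cls_eq_iff\<close>)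
  also have "\<dots> = cls H (r \<odot>\<^bsub>M\<^esub> x)"
  proof -
    have "x \<in> cls H x" by (simp add: mem_cls_iff zero_mem)
    then show ?thesis by auto
  qed
  finally show ?thesis .
qed


section \<open>Twisted first homology and crossed homomorphisms\<close>

text \<open>Crossed homomorphisms are also called derivations or one-cocycles.  Those of the form
  \<open>g \<mapsto> c (\<rho> g - 1)\<close> are the principal ones.\<close>

definition crossed_hom :: "('g, 'a) monoid_scheme \<Rightarrow> ('g \<Rightarrow> 'r::comm_ring_1) \<Rightarrow> ('g \<Rightarrow> 'r) \<Rightarrow> bool" where
  "crossed_hom G \<rho> D \<longleftrightarrow> (\<forall>g\<in>carrier G. \<forall>h\<in>carrier G. D (g \<otimes>\<^bsub>G\<^esub> h) = D g + \<rho> g * D h)"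

abbreviation scl :: "complex \<Rightarrow> ('x \<Rightarrow>\<^sub>0 complex) \<Rightarrow> 'x \<Rightarrow>\<^sub>0 complex" where
  "scl a \<equiv> Poly_Mapping.map ((*) a)"

lemma lookup_scl [simp]: "Poly_Mapping.lookup (scl a c) x = a * Poly_Mapping.lookup c x"
  by transfer (simp add: when_def)

lemma scl_vector_space: "vector_space scl"
  by unfold_locales (auto intro!: poly_mapping_eqI simp: lookup_add algebra_simps)

lemma scl_single: "scl a (Poly_Mapping.single x b) = Poly_Mapping.single x (a * b)"
  by (rule poly_mapping_eqI) (simp add: lookup_single when_def)

lemma keys_scl: "Poly_Mapping.keys (scl a c) \<subseteq> Poly_Mapping.keys c"
  by (auto simp: in_keys_iff)

lemma scl_add: "scl a (c + d) = scl a c + scl a d" and scl_diff: "scl a (c - d) = scl a c - scl a d"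
  by (auto intro!: poly_mapping_eqI simp: lookup_add lookup_minus algebra_simps)

lemma scl_sum: "scl a (\<Sum>i\<in>I. c i) = (\<Sum>i\<in>I. scl a (c i))"
  by (rule poly_mapping_eqI) (simp add: lookup_sum sum_distrib_left)

lemmas cext_simps = pm_ext_add[of "\<lambda>a. a", OF refl] pm_ext_diff[of "\<lambda>a. a", OF refl]
  pm_ext_single[of "\<lambda>a. a", OF refl] pm_ext_sum[of "\<lambda>a. a", OF refl]

lemma cext_scl: "cext D (scl a c) = a * cext D c"
proof -
  have "cext D (scl a c) = (\<Sum>x\<in>Poly_Mapping.keys c. Poly_Mapping.lookup (scl a c) x * D x)"
    by (rule pm_ext_superset) (simp_all add: keys_scl)
  then show ?thesis by (simp add: pm_ext_def sum_distrib_left mult.assoc)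
qed

text \<open>A subspace is the common kernel of the functionals that vanish on it.\<close>

lemma separating_functional:
  fixes U :: "('x \<Rightarrow>\<^sub>0 complex) set"
  assumes U: "0 \<in> U" "\<And>x y. x \<in> U \<Longrightarrow> y \<in> U \<Longrightarrow> x + y \<in> U" "\<And>a x. x \<in> U \<Longrightarrow> scl a x \<in> U"
    and c: "c \<notin> U"
  shows "\<exists>E. (\<forall>x\<in>U. cext E x = 0) \<and> cext E c = 1"
proof -
  interpret VP: vector_space_pair scl "(*) :: complex \<Rightarrow> complex \<Rightarrow> complex"
    by (intro vector_space_pair.intro scl_vector_space) (unfold_locales, simp_all add: algebra_simps)
  have sub: "VP.vs1.subspace U" by (rule VP.vs1.subspaceI) (use U in auto)
  obtain B where B: "B \<subseteq> U" "VP.vs1.independent B" "U \<subseteq> VP.vs1.span B"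
    using VP.vs1.maximal_independent_subset[of U] by blast
  have "VP.vs1.span B \<subseteq> U" using B(1) sub by (rule VP.vs1.span_minimal)
  with c have "c \<notin> VP.vs1.span B" by blast
  with B(2) have "VP.vs1.independent (insert c B)" by (rule VP.vs1.independent_insertI[rotated])
  from VP.linear_independent_extend[OF this, of "\<lambda>x. if x = c then 1 else 0"]
  obtain f where f: "Vector_Spaces.linear scl (*) f"
    and eq: "\<And>x. x \<in> insert c B \<Longrightarrow> f x = (if x = c then 1 else 0)" by blast
  interpret f: Vector_Spaces.linear scl "(*)" f by (rule f)
  have f0: "f x = 0" if "x \<in> VP.vs1.span B" for x
    by (rule VP.linear_eq_0_on_span[OF f _ that]) (use eq B(1) c in auto)
  have f_ext: "cext (\<lambda>g. f (Poly_Mapping.single g 1)) x = f x" for x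
  proof -
    have "f x = f (\<Sum>g\<in>Poly_Mapping.keys x. scl (Poly_Mapping.lookup x g) (Poly_Mapping.single g 1))"
      using pm_sum_singles[of x] by (simp add: scl_single)
    also have "\<dots> = cext (\<lambda>g. f (Poly_Mapping.single g 1)) x"
      by (simp only: f.sum f.scale pm_ext_def)
    finally show ?thesis by (rule sym)
  qed
  have "f c = 1" using eq by simp
  with f0 B(3) show ?thesis
    by (intro exI[of _ "\<lambda>g. f (Poly_Mapping.single g 1)"]) (auto simp only: f_ext)
qed

text \<open>Linearly independent functionals admit a dual system of vectors.\<close>

lemma dual_vectors:
  fixes D :: "nat \<Rightarrow> 'x \<Rightarrow> complex"
  assumes Z: "0 \<in> Z" "\<And>x y. x \<in> Z \<Longrightarrow> y \<in> Z \<Longrightarrow> x + y \<in> Z" "\<And>a x. x \<in> Z \<Longrightarrow> scl a x \<in> Z"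
    and indep: "\<And>a. \<forall>x\<in>Z. (\<Sum>i<b. a i * cext (D i) x) = 0 \<Longrightarrow> \<forall>i<b. a i = 0"
  shows "\<exists>x. (\<forall>j<b. x j \<in> Z) \<and> (\<forall>i<b. \<forall>j<b. cext (D i) (x j) = (if i = j then 1 else 0))"
  using indep
proof (induction b)
  case 0
  then show ?case by simp
next
  case (Suc b)
  have Zsum: "(\<Sum>i\<in>I. c i) \<in> Z" if "\<And>i. i \<in> I \<Longrightarrow> c i \<in> Z" for I :: "nat set" and c
    using that by (induction I rule: infinite_finite_induct) (auto simp: Z)
  have minus: "x - y = x + scl (-1) y" for x y :: "'x \<Rightarrow>\<^sub>0 complex"
    by (rule poly_mapping_eqI) (simp add: lookup_add lookup_minus)
  have Zminus: "x - y \<in> Z" if "x \<in> Z" "y \<in> Z" for x y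
    unfolding minus using that Z by blast
  have "\<forall>i<b. a i = 0" if "\<forall>x\<in>Z. (\<Sum>i<b. a i * cext (D i) x) = 0" for a
  proof -
    have "\<forall>x\<in>Z. (\<Sum>i<Suc b. (a(b := 0)) i * cext (D i) x) = 0" using that by simp
    from Suc.prems[OF this] show ?thesis by (metis fun_upd_other less_Suc_eq less_irrefl)
  qed
  from Suc.IH[OF this] obtain x where x: "\<And>j. j < b \<Longrightarrow> x j \<in> Z"
    "\<And>i j. i < b \<Longrightarrow> j < b \<Longrightarrow> cext (D i) (x j) = (if i = j then 1 else 0)" by blast
  define a where "a i = (if i = b then 1 else - cext (D b) (x i))" for i
  have "\<not> (\<forall>y\<in>Z. (\<Sum>i<Suc b. a i * cext (D i) y) = 0)"
  proof
    assume "\<forall>y\<in>Z. (\<Sum>i<Suc b. a i * cext (D i) y) = 0"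
    from Suc.prems[OF this] have "a b = 0" by blast
    then show False by (simp add: a_def)
  qed
  then obtain y where y: "y \<in> Z" "(\<Sum>i<Suc b. a i * cext (D i) y) \<noteq> 0" by blast
  \<comment> \<open>remove from \<open>y\<close> its components along the previous vectors\<close>
  define y' where "y' = y - (\<Sum>j<b. scl (cext (D j) y) (x j))"
  have y': "y' \<in> Z" unfolding y'_def by (intro Zminus y Zsum Z(3) x(1)) simp
  have y'0: "cext (D i) y' = 0" if "i < b" for i
  proof -
    have "(\<Sum>j<b. cext (D j) y * cext (D i) (x j)) = (\<Sum>j<b. if j = i then cext (D j) y else 0)"
      by (rule sum.cong) (use x(2) that in auto)
    also have "\<dots> = cext (D i) y" using that by simp
    finally show ?thesis by (simp add: y'_def cext_simps cext_scl)
  qed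
  have y'b: "cext (D b) y' \<noteq> 0"
  proof -
    have "(\<Sum>i<b. a i * cext (D i) y) = - (\<Sum>j<b. cext (D j) y * cext (D b) (x j))"
      unfolding sum_negf[symmetric] by (rule sum.cong) (auto simp: a_def)
    then show ?thesis using y(2) by (simp add: y'_def cext_simps cext_scl a_def)
  qed
  define v where "v = scl (1 / cext (D b) y') y'"
  have v: "v \<in> Z" "cext (D b) v = 1" "\<And>i. i < b \<Longrightarrow> cext (D i) v = 0"
    using y' y'b y'0 by (auto simp: v_def cext_scl Z)
  define x' where "x' j = (if j = b then v else x j - scl (cext (D b) (x j)) v)" for j
  have "x' j \<in> Z" if "j < Suc b" for j
    using that x(1)[of j] v(1) Zminus Z(3) by (auto simp: x'_def less_Suc_eq)
  moreover have "cext (D i) (x' j) = (if i = j then 1 else 0)" if "i < Suc b" "j < Suc b" for i j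
    using that x(2)[of i j] v by (auto simp: x'_def less_Suc_eq cext_simps cext_scl)
  ultimately show ?case by blast
qed

text \<open>The dimension of a subquotient \<open>Z / U\<close> of a space of chains is the number of functionals in a
  basis of its dual.\<close>

lemma dim_quot_module:
  fixes D :: "nat \<Rightarrow> 'x \<Rightarrow> complex"
  assumes M: "add M = (+)" "zero M = 0" "module.smult M = scl" "carrier M = Z"
    and Z: "0 \<in> Z" "\<And>x y. x \<in> Z \<Longrightarrow> y \<in> Z \<Longrightarrow> x + y \<in> Z" "\<And>a x. x \<in> Z \<Longrightarrow> scl a x \<in> Z"
    and U: "0 \<in> U" "\<And>x y. x \<in> U \<Longrightarrow> y \<in> U \<Longrightarrow> x + y \<in> U" "\<And>a x. x \<in> U \<Longrightarrow> scl a x \<in> U"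
    and vanish: "\<And>i x. i < b \<Longrightarrow> x \<in> U \<Longrightarrow> cext (D i) x = 0"
    and separate: "\<And>x. x \<in> Z \<Longrightarrow> \<forall>i<b. cext (D i) x = 0 \<Longrightarrow> x \<in> U"
    and indep: "\<And>a. \<forall>x\<in>Z. (\<Sum>i<b. a i * cext (D i) x) = 0 \<Longrightarrow> \<forall>i<b. a i = 0"
  shows "vectorspace.dim class_ring (quot_module M U) = b"
proof -
  let ?V = "quot_module M U"
  have minus: "x - y = x + scl (-1) y" for x y :: "'x \<Rightarrow>\<^sub>0 complex"
    by (rule poly_mapping_eqI) (simp add: lookup_add lookup_minus)
  interpret add_subgroup U
    by unfold_locales (use U in \<open>auto simp: minus\<close>)
  have Zsum: "(\<Sum>i\<in>I. c i) \<in> Z" if "\<And>i. i \<in> I \<Longrightarrow> c i \<in> Z" for I :: "nat set" and c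
    using that by (induction I rule: infinite_finite_induct) (auto simp: Z)
  have car: "carrier ?V = cls U ` Z" by (simp add: quot_module_carrier M)
  have add: "cls U x \<oplus>\<^bsub>?V\<^esub> cls U y = cls U (x + y)" for x y
    by (rule quot_module_add) (rule M)
  have smult: "a \<odot>\<^bsub>?V\<^esub> cls U x = cls U (scl a x)" for a x
    using quot_module_smult[of M x a] U(3) by (simp add: M scl_diff[symmetric])
  have zero: "\<zero>\<^bsub>?V\<^esub> = cls U 0" by (rule quot_module_zero)
  interpret S: vector_space scl by (rule scl_vector_space)
  have V: "vectorspace (class_ring :: complex ring) ?V"
  proof (rule vs_criteria)
    show "\<forall>v\<in>carrier ?V. \<exists>neg_v\<in>carrier ?V. v \<oplus>\<^bsub>?V\<^esub> neg_v = \<zero>\<^bsub>?V\<^esub>"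
    proof
      fix v assume "v \<in> carrier ?V"
      then obtain x where x: "v = cls U x" "x \<in> Z" by (auto simp: car)
      have "cls U (scl (-1) x) \<in> carrier ?V" unfolding car using Z(3)[OF x(2)] by (rule imageI)
      moreover have "v \<oplus>\<^bsub>?V\<^esub> cls U (scl (-1) x) = \<zero>\<^bsub>?V\<^esub>"
        unfolding x(1) add zero minus[symmetric] by simp
      ultimately show "\<exists>neg_v\<in>carrier ?V. v \<oplus>\<^bsub>?V\<^esub> neg_v = \<zero>\<^bsub>?V\<^esub>" by blast
    qed
  qed (auto simp: class_field car add smult zero Z ac_simps S.scale_left_distrib S.scale_right_distrib)
  have "\<exists>x. (\<forall>j<b. x j \<in> Z) \<and> (\<forall>i<b. \<forall>j<b. cext (D i) (x j) = (if i = j then 1 else 0))"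
    by (rule dual_vectors) (fact Z indep)+
  then obtain x where "(\<forall>j<b. x j \<in> Z) \<and> (\<forall>i<b. \<forall>j<b. cext (D i) (x j) = (if i = j then 1 else 0))"
    by (elim exE)
  then have x: "\<And>j. j < b \<Longrightarrow> x j \<in> Z"
    "\<And>i j. i < b \<Longrightarrow> j < b \<Longrightarrow> cext (D i) (x j) = (if i = j then 1 else 0)"
    by simp_all
  define T where "T v = cls U (\<Sum>j<b. scl (v $ j) (x j))" for v
  have coord: "cext (D i) (\<Sum>j<b. scl (v $ j) (x j)) = v $ i" if "i < b" for v i
  proof -
    have "(\<Sum>j<b. v $ j * cext (D i) (x j)) = (\<Sum>j<b. if j = i then v $ j else 0)"
      by (rule sum.cong) (use x(2) that in auto)
    then show ?thesis using that by (simp add: cext_simps cext_scl)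
  qed
  have hom: "T \<in> LinearCombinations.module_hom class_ring (module_vec TYPE(complex) b) ?V"
    unfolding LinearCombinations.module_hom_def module_vec_simps
  proof (intro CollectI conjI allI impI)
    show "T \<in> carrier_vec b \<rightarrow> carrier ?V"
      unfolding T_def car by (intro funcsetI imageI Zsum Z(3) x(1)) simp
    show "T (v + w) = T v \<oplus>\<^bsub>?V\<^esub> T w" if "v \<in> carrier_vec b \<and> w \<in> carrier_vec b" for v w
    proof -
      have "(\<Sum>j<b. scl ((v + w) $ j) (x j)) = (\<Sum>j<b. scl (v $ j) (x j) + scl (w $ j) (x j))"
        by (rule sum.cong) (use that in \<open>auto simp: S.scale_left_distrib\<close>)
      then show ?thesis by (simp add: T_def add sum.distrib)
    qed
    show "T (a \<cdot>\<^sub>v v) = a \<odot>\<^bsub>?V\<^esub> T v" if "a \<in> carrier class_ring \<and> v \<in> carrier_vec b" for a v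
    proof -
      have "(\<Sum>j<b. scl ((a \<cdot>\<^sub>v v) $ j) (x j)) = (\<Sum>j<b. scl a (scl (v $ j) (x j)))"
        by (rule sum.cong) (use that in auto)
      then show ?thesis by (simp only: T_def smult scl_sum)
    qed
  qed
  interpret VS: vec_space "TYPE(complex)" b .
  have vec_vs: "vectorspace (class_ring :: complex ring) (module_vec TYPE(complex) b)"
    by (rule VS.vectorspace_axioms)
  interpret T: linear_map "class_ring :: complex ring" "module_vec TYPE(complex) b" ?V T
    using vec_vs V hom
    by (auto simp: linear_map_def mod_hom_def mod_hom_axioms_def vectorspace_def)
  have "inj_on T (carrier (module_vec TYPE(complex) b))"
  proof (rule inj_onI)
    fix v w assume vw: "v \<in> carrier (module_vec TYPE(complex) b)"
      "w \<in> carrier (module_vec TYPE(complex) b)" "T v = T w"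
    then have "(\<Sum>j<b. scl (v $ j) (x j)) - (\<Sum>j<b. scl (w $ j) (x j)) \<in> U"
      by (simp add: T_def cls_eq_iff)
    from vanish[OF _ this] have "v $ i = w $ i" if "i < b" for i
      using that coord[OF that, of v] coord[OF that, of w] by (simp add: cext_simps(2))
    then show "v = w" using vw(1,2) by (intro eq_vecI) (auto simp: module_vec_simps)
  qed
  moreover have "T ` carrier (module_vec TYPE(complex) b) = carrier ?V"
  proof
    show "T ` carrier (module_vec TYPE(complex) b) \<subseteq> carrier ?V"
      using hom by (auto simp: LinearCombinations.module_hom_def)
    show "carrier ?V \<subseteq> T ` carrier (module_vec TYPE(complex) b)"
    proof
      fix w assume "w \<in> carrier ?V"
      then obtain c where c: "w = cls U c" "c \<in> Z" by (auto simp: car)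
      define v where "v = vec b (\<lambda>i. cext (D i) c)"
      let ?s = "\<Sum>j<b. scl (v $ j) (x j)"
      have "?s \<in> Z" by (intro Zsum Z(3) x(1)) simp
      then have "c - ?s \<in> Z" unfolding minus using c(2) Z by blast
      moreover have "\<forall>i<b. cext (D i) (c - ?s) = 0"
        using coord[of _ v] by (simp add: cext_simps(2) v_def)
      ultimately have "c - ?s \<in> U" by (rule separate)
      then have "w = T v" unfolding c T_def cls_eq_iff .
      moreover have "v \<in> carrier (module_vec TYPE(complex) b)" by (simp add: v_def module_vec_simps)
      ultimately show "w \<in> T ` carrier (module_vec TYPE(complex) b)" by blast
    qed
  qed
  ultimately have "VS.dim = vectorspace.dim class_ring ?V"
    by (rule T.dim_eq[OF VS.fin_dim])
  then show ?thesis using VS.dim_is_n by simp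
qed

text \<open>A crossed homomorphism is a functional on chains that vanishes on boundaries, and the one
  attached to the character, \<open>g \<mapsto> \<rho> g - 1\<close>, is the boundary map from one-chains.  So the first
  homology is dual to the crossed homomorphisms modulo the principal ones.\<close>

lemma twisted_b1_eq:
  fixes G :: "('g, 'a) monoid_scheme"
  assumes "group G"
    and rho: "crossed_hom G \<rho> (\<lambda>g. \<rho> g - 1)"
    and D: "\<And>i. i < b \<Longrightarrow> crossed_hom G \<rho> (D i)"
    and spans: "\<And>E. crossed_hom G \<rho> E \<Longrightarrow>
      \<exists>a c. \<forall>g\<in>carrier G. E g = (\<Sum>i<b. a i * D i g) + c * (\<rho> g - 1)"
    and indep: "\<And>a c. \<forall>g\<in>carrier G. (\<Sum>i<b. a i * D i g) = c * (\<rho> g - 1) \<Longrightarrow> \<forall>i<b. a i = 0"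
  shows "twisted_b1 G \<rho> = b"
proof -
  interpret group G by fact
  let ?D0 = "\<lambda>g. \<rho> g - 1"
  define C where "C = {c :: 'g \<Rightarrow>\<^sub>0 complex. Poly_Mapping.keys c \<subseteq> carrier G}"
  define Z where "Z = {c \<in> C. cext ?D0 c = 0}"
  define rel where "rel x v = (case x of (g, h) \<Rightarrow> Poly_Mapping.single h (v * \<rho> g)
    - Poly_Mapping.single (g \<otimes>\<^bsub>G\<^esub> h) v + Poly_Mapping.single g v)" for x v
  define U where "U = bar_d2 G \<rho> ` {c. Poly_Mapping.keys c \<subseteq> carrier G \<times> carrier G}"
  have rel_0: "rel x 0 = 0" and rel_add: "rel x (v + w) = rel x v + rel x w"
    and rel_scl: "rel x (a * v) = scl a (rel x v)" for x v w a
    by (cases x; simp add: rel_def single_add scl_add scl_diff scl_single algebra_simps)+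
  have d2: "bar_d2 G \<rho> c = (\<Sum>x\<in>S. rel x (Poly_Mapping.lookup c x))"
    if "finite S" "Poly_Mapping.keys c \<subseteq> S" for c S
  proof -
    have "bar_d2 G \<rho> c = (\<Sum>x\<in>Poly_Mapping.keys c. rel x (Poly_Mapping.lookup c x))"
      unfolding bar_d2_def by (rule sum.cong) (auto simp: rel_def)
    also have "\<dots> = (\<Sum>x\<in>S. rel x (Poly_Mapping.lookup c x))"
      by (rule sum.mono_neutral_left) (use that in \<open>auto simp: in_keys_iff rel_0\<close>)
    finally show ?thesis .
  qed
  have d2_add: "bar_d2 G \<rho> (c + d) = bar_d2 G \<rho> c + bar_d2 G \<rho> d" for c d
    using d2[of "Poly_Mapping.keys c \<union> Poly_Mapping.keys d"] Poly_Mapping.keys_add[of c d]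
    by (simp add: lookup_add rel_add sum.distrib)
  have d2_scl: "bar_d2 G \<rho> (scl a c) = scl a (bar_d2 G \<rho> c)" for a c
    using d2[of "Poly_Mapping.keys c"] keys_scl[of a c] by (simp add: rel_scl scl_sum)
  have d2_single: "bar_d2 G \<rho> (Poly_Mapping.single x v) = rel x v" for x v
    using d2[of "{x}" "Poly_Mapping.single x v"] by simp
  have C: "0 \<in> C" "x \<in> C \<Longrightarrow> y \<in> C \<Longrightarrow> x + y \<in> C" "x \<in> C \<Longrightarrow> scl a x \<in> C" for x y a
    unfolding C_def using Poly_Mapping.keys_add[of x y] keys_scl[of a x] by auto
  have Z: "0 \<in> Z" "x \<in> Z \<Longrightarrow> y \<in> Z \<Longrightarrow> x + y \<in> Z" "x \<in> Z \<Longrightarrow> scl a x \<in> Z" for x y a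
    using C by (auto simp: Z_def cext_simps cext_scl)
  have U_I: "bar_d2 G \<rho> c \<in> U" if "Poly_Mapping.keys c \<subseteq> carrier G \<times> carrier G" for c
    unfolding U_def by (rule imageI) (use that in simp)
  have U_E: thesis if "u \<in> U" "\<And>c. Poly_Mapping.keys c \<subseteq> carrier G \<times> carrier G \<Longrightarrow> u = bar_d2 G \<rho> c \<Longrightarrow> thesis"
    for u thesis
    using that(1) unfolding U_def by (elim imageE, intro that(2)) simp_all
  have U0: "0 \<in> U" using U_I[of 0] by (simp add: bar_d2_def)
  have U_add: "x + y \<in> U" if xU: "x \<in> U" and yU: "y \<in> U" for x y
  proof -
    obtain c where c: "Poly_Mapping.keys c \<subseteq> carrier G \<times> carrier G" "x = bar_d2 G \<rho> c"
      using xU by (rule U_E)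
    obtain d where d: "Poly_Mapping.keys d \<subseteq> carrier G \<times> carrier G" "y = bar_d2 G \<rho> d"
      using yU by (rule U_E)
    have "Poly_Mapping.keys (c + d) \<subseteq> carrier G \<times> carrier G"
      using Poly_Mapping.keys_add[of c d] c(1) d(1) by blast
    moreover have "x + y = bar_d2 G \<rho> (c + d)" unfolding c(2) d(2) d2_add ..
    ultimately show ?thesis by (metis U_I)
  qed
  have U_scl: "scl a x \<in> U" if xU: "x \<in> U" for x a
  proof -
    obtain c where c: "Poly_Mapping.keys c \<subseteq> carrier G \<times> carrier G" "x = bar_d2 G \<rho> c"
      using xU by (rule U_E)
    have "Poly_Mapping.keys (scl a c) \<subseteq> carrier G \<times> carrier G"
      using keys_scl[of a c] c(1) by blast
    moreover have "scl a x = bar_d2 G \<rho> (scl a c)" unfolding c(2) d2_scl ..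
    ultimately show ?thesis by (metis U_I)
  qed
  have vanish: "cext E u = 0" if E: "crossed_hom G \<rho> E" and u: "u \<in> U" for E u
  proof -
    obtain c where c: "Poly_Mapping.keys c \<subseteq> carrier G \<times> carrier G" "u = bar_d2 G \<rho> c"
      using u by (rule U_E)
    have "cext E u = (\<Sum>x\<in>Poly_Mapping.keys c. cext E (rel x (Poly_Mapping.lookup c x)))"
      using d2[of "Poly_Mapping.keys c" c] c by (simp add: cext_simps)
    also have "\<dots> = 0"
    proof (rule sum.neutral, intro ballI)
      fix x assume "x \<in> Poly_Mapping.keys c"
      then obtain g h where x: "x = (g, h)" "g \<in> carrier G" "h \<in> carrier G" using c by blast
      then show "cext E (rel x (Poly_Mapping.lookup c x)) = 0"
        using E by (simp add: rel_def cext_simps crossed_hom_def algebra_simps)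
    qed
    finally show ?thesis .
  qed
  have UC: "U \<subseteq> C"
  proof
    fix u assume "u \<in> U"
    then obtain c where c: "Poly_Mapping.keys c \<subseteq> carrier G \<times> carrier G" "u = bar_d2 G \<rho> c"
      by (rule U_E)
    have "Poly_Mapping.keys (rel x v) \<subseteq> carrier G" if "x \<in> carrier G \<times> carrier G" for x v
      using that by (auto simp: rel_def in_keys_iff lookup_add lookup_minus lookup_single when_def split: if_splits)
    then have "(\<Union>x\<in>Poly_Mapping.keys c. Poly_Mapping.keys (rel x (Poly_Mapping.lookup c x))) \<subseteq> carrier G"
      using c(1) by blast
    moreover have "u = (\<Sum>x\<in>Poly_Mapping.keys c. rel x (Poly_Mapping.lookup c x))"
      using d2[of "Poly_Mapping.keys c" c] c by simp
    ultimately show "u \<in> C" unfolding C_def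
      using Poly_Mapping.keys_sum[of "\<lambda>x. rel x (Poly_Mapping.lookup c x)" "Poly_Mapping.keys c"] by auto
  qed
  have cext_lin: "cext (\<lambda>g. (\<Sum>i<b. a i * D i g) + e * ?D0 g) x = (\<Sum>i<b. a i * cext (D i) x) + e * cext ?D0 x" for a e x
  proof -
    have "(\<Sum>i<b. a i * cext (D i) x) = (\<Sum>g\<in>Poly_Mapping.keys x. \<Sum>i<b. a i * (Poly_Mapping.lookup x g * D i g))"
      unfolding pm_ext_def sum_distrib_left by (rule sum.swap)
    then show ?thesis
      by (simp add: pm_ext_def distrib_left sum.distrib sum_distrib_left mult_ac)
  qed
  have cext_C: "cext E x = cext F x" if "x \<in> C" "\<And>g. g \<in> carrier G \<Longrightarrow> E g = F g" for E F x
    by (rule pm_ext_cong) (use that in \<open>auto simp: C_def\<close>)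
  have "vectorspace.dim class_ring (twisted_H1 G \<rho>) = b"
    unfolding twisted_H1_def
  proof (rule dim_quot_module[where Z = Z and D = D])
    show "carrier (chain_space (carrier G)\<lparr>carrier := {c \<in> carrier (chain_space (carrier G)). bar_d1 \<rho> c = 0}\<rparr>) = Z"
      by (auto simp: Z_def C_def chain_space_def bar_d1_def pm_ext_def)
    have U_eq: "bar_d2 G \<rho> ` carrier (chain_space (carrier G \<times> carrier G)) = U"
      by (simp add: U_def chain_space_def)
    show "0 \<in> bar_d2 G \<rho> ` carrier (chain_space (carrier G \<times> carrier G))" using U0 unfolding U_eq .
    show "x + y \<in> bar_d2 G \<rho> ` carrier (chain_space (carrier G \<times> carrier G))"
      if "x \<in> bar_d2 G \<rho> ` carrier (chain_space (carrier G \<times> carrier G))"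
        "y \<in> bar_d2 G \<rho> ` carrier (chain_space (carrier G \<times> carrier G))" for x y
      using U_add that unfolding U_eq by blast
    show "scl a x \<in> bar_d2 G \<rho> ` carrier (chain_space (carrier G \<times> carrier G))"
      if "x \<in> bar_d2 G \<rho> ` carrier (chain_space (carrier G \<times> carrier G))" for a x
      using U_scl that unfolding U_eq by blast
    show "cext (D i) x = 0" if "i < b" "x \<in> bar_d2 G \<rho> ` carrier (chain_space (carrier G \<times> carrier G))" for i x
      using vanish[OF D[OF that(1)]] that(2) unfolding U_eq by blast
    show "x \<in> bar_d2 G \<rho> ` carrier (chain_space (carrier G \<times> carrier G))"
      if x: "x \<in> Z" "\<forall>i<b. cext (D i) x = 0" for x
      unfolding U_eq
    proof (rule ccontr)
      assume "x \<notin> U"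
      from separating_functional[OF U0 U_add U_scl this]
      obtain E where E: "\<And>u. u \<in> U \<Longrightarrow> cext E u = 0" "cext E x = 1" by blast
      have "crossed_hom G \<rho> E"
        unfolding crossed_hom_def
      proof (intro ballI)
        fix g h assume gh: "g \<in> carrier G" "h \<in> carrier G"
        then have "rel (g, h) 1 \<in> U"
          using U_I[of "Poly_Mapping.single (g, h) 1"] by (simp add: d2_single)
        from E(1)[OF this] show "E (g \<otimes>\<^bsub>G\<^esub> h) = E g + \<rho> g * E h"
          by (simp add: rel_def cext_simps algebra_simps)
      qed
      from spans[OF this] obtain a e where
        "\<And>g. g \<in> carrier G \<Longrightarrow> E g = (\<Sum>i<b. a i * D i g) + e * ?D0 g" by blast
      then have "cext E x = (\<Sum>i<b. a i * cext (D i) x) + e * cext ?D0 x"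
        using cext_C[of x E] x(1) cext_lin by (simp add: Z_def)
      also have "\<dots> = 0" using x by (simp add: Z_def)
      finally show False using E(2) by simp
    qed
    show "\<forall>i<b. a i = 0" if a: "\<forall>x\<in>Z. (\<Sum>i<b. a i * cext (D i) x) = 0" for a
    proof -
      \<comment> \<open>a functional that vanishes on the kernel of the boundary map is a multiple of it\<close>
      have "\<exists>e. \<forall>x\<in>C. (\<Sum>i<b. a i * cext (D i) x) = e * cext ?D0 x"
      proof (cases "\<forall>x\<in>C. cext ?D0 x = 0")
        case True
        then have "Z = C" by (auto simp: Z_def)
        with a show ?thesis by (intro exI[of _ 0]) simp
      next
        case False
        then obtain w where w: "w \<in> C" "cext ?D0 w \<noteq> 0" by blast
        define e where "e = (\<Sum>i<b. a i * cext (D i) w) / cext ?D0 w"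
        have "(\<Sum>i<b. a i * cext (D i) x) = e * cext ?D0 x" if x: "x \<in> C" for x
        proof -
          let ?q = "cext ?D0 x / cext ?D0 w"
          have "x + scl (- ?q) w \<in> C" using C x w by blast
          then have "x + scl (- ?q) w \<in> Z" using w by (simp add: Z_def cext_simps cext_scl)
          with a have 1: "(\<Sum>i<b. a i * cext (D i) (x + scl (- ?q) w)) = 0" by (rule bspec)
          have "(\<Sum>i<b. a i * cext (D i) (x + scl (- ?q) w))
            = (\<Sum>i<b. a i * cext (D i) x + - ?q * (a i * cext (D i) w))"
            by (rule sum.cong[OF refl]) (simp only: cext_simps(1) cext_scl distrib_left mult.left_commute)
          also have "\<dots> = (\<Sum>i<b. a i * cext (D i) x) + - ?q * (\<Sum>i<b. a i * cext (D i) w)"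
            by (simp only: sum.distrib sum_distrib_left)
          finally have 2: "(\<Sum>i<b. a i * cext (D i) (x + scl (- ?q) w))
            = (\<Sum>i<b. a i * cext (D i) x) - ?q * (\<Sum>i<b. a i * cext (D i) w)"
            by (simp only: mult_minus_left add_uminus_conv_diff)
          have "(\<Sum>i<b. a i * cext (D i) x) = ?q * (\<Sum>i<b. a i * cext (D i) w)"
            using trans[OF 2[symmetric] 1] by (rule iffD2[OF eq_iff_diff_eq_0])
          also have "\<dots> = e * cext ?D0 x" unfolding e_def by (simp only: times_divide_eq_left times_divide_eq_right mult.commute)
          finally show ?thesis .
        qed
        then show ?thesis by (intro exI[of _ e] ballI)
      qed
      then obtain e where e': "\<forall>x\<in>C. (\<Sum>i<b. a i * cext (D i) x) = e * cext ?D0 x" by (elim exE)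
      then have e: "(\<Sum>i<b. a i * cext (D i) x) = e * cext ?D0 x" if "x \<in> C" for x using that by (rule bspec)
      have "(\<Sum>i<b. a i * D i g) = e * ?D0 g" if "g \<in> carrier G" for g
        using e[of "Poly_Mapping.single g 1"] that by (simp add: C_def cext_simps)
      then show ?thesis by (intro indep ballI)
    qed
  qed (use Z in \<open>auto simp: chain_space_def\<close>)
  then show ?thesis by (simp add: twisted_b1_def)
qed


section \<open>Homomorphisms out of the Alexander module\<close>

(* This rule would replace the weight of integral linear extensions by the identity function. *)
declare of_int_eq_id [simp del]

lemma generate_free_Abelian_induct [consumes 1, case_names relator zero diff]:
  assumes "x \<in> generate (free_Abelian_group S) R"
    and rel: "\<And>x. x \<in> R \<Longrightarrow> Poly_Mapping.keys x \<subseteq> S \<and> Q x" and zero: "Q 0"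
    and diff: "\<And>x y. Q x \<Longrightarrow> Q y \<Longrightarrow> Q (x - y)"
  shows "Q x"
  using assms(1)
proof (induction rule: generate.induct)
  case one
  then show ?case using zero by simp
next
  case (incl h)
  then show ?case using rel by simp
next
  case (inv h)
  then show ?case using rel[of h] diff[OF zero, of h] by simp
next
  case (eng h1 h2)
  then show ?case using diff[OF eng.IH(1) diff[OF zero eng.IH(2)]] by simp
qed

lemma generate_free_Abelian_subgroup:
  assumes "\<And>x. x \<in> R \<Longrightarrow> Poly_Mapping.keys x \<subseteq> S"
  shows "add_subgroup (generate (free_Abelian_group S) R)"
proof -
  have R: "R \<subseteq> carrier (free_Abelian_group S)" using assms by auto
  have sub: "subgroup (generate (free_Abelian_group S) R) (free_Abelian_group S)"
    by (rule group.generate_is_subgroup[OF group_free_Abelian_group R])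
  show ?thesis
  proof
    show "0 \<in> generate (free_Abelian_group S) R" 
      using subgroup.one_closed[OF sub] unfolding one_free_Abelian_group .
    fix x y assume xy: "x \<in> generate (free_Abelian_group S) R" "y \<in> generate (free_Abelian_group S) R"
    have y: "Poly_Mapping.keys y \<subseteq> S"
      using subgroup.mem_carrier[OF sub xy(2)] unfolding carrier_free_Abelian_group_iff .
    show "x - y \<in> generate (free_Abelian_group S) R"
      using subgroup.m_closed[OF sub xy(1) subgroup.m_inv_closed[OF sub xy(2)]]
      unfolding inv_free_Abelian_group[OF y] mult_free_Abelian_group add_uminus_conv_diff .
  qed
qed

lemma frag_cmul_of_int: "frag_cmul k p = of_int k * (p :: int \<Rightarrow>\<^sub>0 int)"
proof -
  have "frag_cmul k p = Poly_Mapping.map ((*) k) p"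
  proof (rule poly_mapping_eqI)
    fix x
    show "Poly_Mapping.lookup (frag_cmul k p) x = Poly_Mapping.lookup (Poly_Mapping.map ((*) k) p) x"
      by (simp add: Poly_Mapping.map.rep_eq when_def)
  qed
  moreover have "lconst k = (of_int k :: int \<Rightarrow>\<^sub>0 int)"
    by (simp add: of_int_eq_id flip: single_of_int)
  ultimately show ?thesis by (simp add: mult_map_scale_conv_mult)
qed

lemma group_ring_map_zext: "group_ring_map \<phi> s = zext (\<lambda>g. tpow (\<phi> g)) s"
  by (simp add: group_ring_map_def frag_extend_def pm_ext_def frag_cmul_of_int)

lemma zext_hom:
  assumes "comm_ring_hom \<chi>"
  shows "\<chi> (zext f c) = zext (\<lambda>x. \<chi> (f x)) c"
proof -
  interpret comm_ring_hom \<chi> by fact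
  show ?thesis using pm_ext_hom[OF assms, of of_int f c] by (simp add: hom_of_int)
qed

lemma zext_mult_left: "zext (\<lambda>x. a * f x) c = a * zext f c"
  and zext_mult_right: "zext (\<lambda>x. f x * a) c = zext f c * a"
  by (simp_all add: pm_ext_def sum_distrib_left sum_distrib_right mult_ac)

lemma zext_add_fun: "zext (\<lambda>x. f x + g x) c = zext f c + zext g c"
  by (simp add: pm_ext_def distrib_left sum.distrib)

lemma of_int_augmentation: "of_int (augmentation x) = zext (\<lambda>_. 1) x"
  by (simp add: augmentation_def pm_ext_def)

locale group_to_int = group G for G :: "('g, 'a) monoid_scheme" (structure) +
  fixes \<phi> :: "'g \<Rightarrow> int"
  assumes phi_mult: "\<And>g h. g \<in> carrier G \<Longrightarrow> h \<in> carrier G \<Longrightarrow> \<phi> (g \<otimes> h) = \<phi> g + \<phi> h"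
begin

definition aug :: "('g \<Rightarrow>\<^sub>0 int) set" where
  "aug = {x. Poly_Mapping.keys x \<subseteq> carrier G \<and> augmentation x = 0}"

abbreviation lmult :: "('g \<Rightarrow>\<^sub>0 int) \<Rightarrow> ('g \<Rightarrow>\<^sub>0 int) \<Rightarrow> 'g \<Rightarrow>\<^sub>0 int" where
  "lmult \<equiv> monoid.mult (integral_group_ring G)"

definition alex_rel :: "(((int \<Rightarrow>\<^sub>0 int) \<times> ('g \<Rightarrow>\<^sub>0 int)) \<Rightarrow>\<^sub>0 int) set" where
  "alex_rel = tensor_relators (integral_group_ring G) (\<lambda>p s. p * group_ring_map \<phi> s)
     (class_ring :: (int \<Rightarrow>\<^sub>0 int) ring) (augmentation_ideal G)"

definition alex_sub :: "(((int \<Rightarrow>\<^sub>0 int) \<times> ('g \<Rightarrow>\<^sub>0 int)) \<Rightarrow>\<^sub>0 int) set" where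
  "alex_sub = generate (free_Abelian_group (UNIV \<times> aug)) alex_rel"

abbreviation "alex \<equiv> alexander_module G \<phi>"
abbreviation "acls \<equiv> cls alex_sub"

text \<open>The universal crossed homomorphism \<open>g \<mapsto> 1 \<otimes> (g - 1)\<close>.\<close>

definition delta :: "'g \<Rightarrow> (((int \<Rightarrow>\<^sub>0 int) \<times> ('g \<Rightarrow>\<^sub>0 int)) \<Rightarrow>\<^sub>0 int) set" where
  "delta g = acls (frag_of (1, frag_of g - frag_of \<one>))"

lemma lmult_eq: "lmult s x = frag_extend (\<lambda>g. frag_extend (\<lambda>h. frag_of (g \<otimes> h)) x) s"
  by (simp add: integral_group_ring_def)

lemma augmentation_zext: "augmentation x = zext (\<lambda>_. 1) x"
  by (simp add: augmentation_def pm_ext_def of_int_eq_id)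

lemma aug_carrier: "carrier (augmentation_ideal G) = aug"
  by (simp add: augmentation_ideal_def integral_group_ring_def aug_def)

lemma keys_lmult: 
  assumes "Poly_Mapping.keys s \<subseteq> carrier G" "Poly_Mapping.keys x \<subseteq> carrier G"
  shows "Poly_Mapping.keys (lmult s x) \<subseteq> carrier G"
proof -
  have "Poly_Mapping.keys (frag_extend (\<lambda>h. frag_of (g \<otimes> h)) x) \<subseteq> carrier G" if "g \<in> carrier G" for g
    using keys_frag_extend[of "\<lambda>h. frag_of (g \<otimes> h)" x] assms(2) that by (fastforce simp: keys_frag_of)
  then show ?thesis
    unfolding lmult_eq
    using keys_frag_extend[of "\<lambda>g. frag_extend (\<lambda>h. frag_of (g \<otimes> h)) x" s] assms(1) by blast
qed

text \<open>In \<open>D(g h) = D g + \<rho> g * D h\<close> the first term is independent of \<open>h\<close>, so it cancels on elements of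
  augmentation zero.\<close>

lemma zext_lmult:
  assumes s: "Poly_Mapping.keys s \<subseteq> carrier G" and x: "x \<in> aug"
    and D: "crossed_hom G \<rho> D"
  shows "zext D (lmult s x) = zext \<rho> s * zext D x"
proof -
  have inner: "zext (\<lambda>h. D (g \<otimes> h)) x = \<rho> g * zext D x" if "g \<in> carrier G" for g
  proof -
    have "zext (\<lambda>h. D (g \<otimes> h)) x = zext (\<lambda>h. D g * 1 + \<rho> g * D h) x"
      by (rule pm_ext_cong) (use D x that in \<open>auto simp: crossed_hom_def aug_def\<close>)
    also have "\<dots> = D g * of_int (augmentation x) + \<rho> g * zext D x"
      by (simp only: zext_add_fun zext_mult_left of_int_augmentation)
    finally show ?thesis using x by (simp add: aug_def)
  qed
  have "zext D (lmult s x) = zext (\<lambda>g. zext (\<lambda>h. D (g \<otimes> h)) x) s"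
    unfolding lmult_eq by (simp add: zext_frag_extend)
  also have "\<dots> = zext (\<lambda>g. \<rho> g * zext D x) s"
    by (rule pm_ext_cong) (use s inner in blast)
  finally show ?thesis by (simp only: zext_mult_right)
qed

lemma aug_add: "x \<in> aug \<Longrightarrow> y \<in> aug \<Longrightarrow> x + y \<in> aug"
  and aug_diff: "x \<in> aug \<Longrightarrow> y \<in> aug \<Longrightarrow> x - y \<in> aug"
  using Poly_Mapping.keys_add[of x y] keys_diff[of x y]
  by (auto simp: aug_def augmentation_zext zext_simps)

lemma aug_gen: "g \<in> carrier G \<Longrightarrow> h \<in> carrier G \<Longrightarrow> frag_of g - frag_of h \<in> aug"
  using keys_diff[of "frag_of g" "frag_of h"]
  by (auto simp: aug_def augmentation_zext zext_simps keys_frag_of)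

lemma aug_lmult:
  assumes "Poly_Mapping.keys s \<subseteq> carrier G" "x \<in> aug"
  shows "lmult s x \<in> aug"
proof -
  have "augmentation (lmult s x) = zext (\<lambda>_. zext (\<lambda>_. 1) x) s"
    by (simp add: augmentation_zext lmult_eq zext_frag_extend)
  also have "\<dots> = 0" using assms(2) unfolding augmentation_zext[symmetric] by (simp add: aug_def pm_ext_def)
  finally show ?thesis using keys_lmult assms by (simp add: aug_def)
qed

lemma alex_rel_eq:
  "alex_rel = {frag_of (p + q, x) - frag_of (p, x) - frag_of (q, x) | p q x. x \<in> aug} \<union>
     {frag_of (p, x + y) - frag_of (p, x) - frag_of (p, y) | p x y. x \<in> aug \<and> y \<in> aug} \<union>
     {frag_of (p * group_ring_map \<phi> s, x) - frag_of (p, lmult s x) | p s x.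
        Poly_Mapping.keys s \<subseteq> carrier G \<and> x \<in> aug}"
  unfolding alex_rel_def tensor_relators_def aug_carrier
  by (simp add: augmentation_ideal_def integral_group_ring_def)

lemma keys_diff3:
  assumes "a \<in> T" "b \<in> T" "c \<in> T"
  shows "Poly_Mapping.keys (frag_of a - frag_of b - frag_of c) \<subseteq> T"
    "Poly_Mapping.keys (frag_of a - frag_of b) \<subseteq> T"
  using keys_diff[of "frag_of a - frag_of b" "frag_of c"] keys_diff[of "frag_of a" "frag_of b"] assms
  by (auto simp: keys_frag_of)

lemma alex_rel_cases [consumes 1, case_names add_left add_right balanced]:
  assumes "c \<in> alex_rel"
    and "\<And>p q x. x \<in> aug \<Longrightarrow> c = frag_of (p + q, x) - frag_of (p, x) - frag_of (q, x) \<Longrightarrow> Q"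
    and "\<And>p x y. x \<in> aug \<Longrightarrow> y \<in> aug \<Longrightarrow> c = frag_of (p, x + y) - frag_of (p, x) - frag_of (p, y) \<Longrightarrow> Q"
    and "\<And>p s x. Poly_Mapping.keys s \<subseteq> carrier G \<Longrightarrow> x \<in> aug \<Longrightarrow>
      c = frag_of (p * group_ring_map \<phi> s, x) - frag_of (p, lmult s x) \<Longrightarrow> Q"
  shows Q
  using assms(1) unfolding alex_rel_eq Un_iff mem_Collect_eq
proof (elim disjE exE conjE, goal_cases)
  case (1 p q x)
  show Q by (rule assms(2)[OF 1(2,1)])
next
  case (2 p x y)
  show Q by (rule assms(3)[OF 2(2,3,1)])
next
  case (3 p s x)
  show Q by (rule assms(4)[OF 3(2,3,1)])
qed

lemma alex_rel_keys: "c \<in> alex_rel \<Longrightarrow> Poly_Mapping.keys c \<subseteq> UNIV \<times> aug"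
  by (erule alex_rel_cases; hypsubst; intro keys_diff3) (auto simp: aug_add aug_lmult)

sublocale alex_sub: add_subgroup alex_sub
  unfolding alex_sub_def by (rule generate_free_Abelian_subgroup) (rule alex_rel_keys)

lemma alex_relI:
  shows "x \<in> aug \<Longrightarrow> frag_of (p + q, x) - frag_of (p, x) - frag_of (q, x) \<in> alex_sub"
    and "x \<in> aug \<Longrightarrow> y \<in> aug \<Longrightarrow> frag_of (p, x + y) - frag_of (p, x) - frag_of (p, y) \<in> alex_sub"
    and "Poly_Mapping.keys s \<subseteq> carrier G \<Longrightarrow> x \<in> aug \<Longrightarrow>
      frag_of (p * group_ring_map \<phi> s, x) - frag_of (p, lmult s x) \<in> alex_sub"
  unfolding alex_sub_def by (intro generate.incl; unfold alex_rel_eq; blast)+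

definition scale :: "(int \<Rightarrow>\<^sub>0 int) \<Rightarrow> (((int \<Rightarrow>\<^sub>0 int) \<times> ('g \<Rightarrow>\<^sub>0 int)) \<Rightarrow>\<^sub>0 int) \<Rightarrow>
    ((int \<Rightarrow>\<^sub>0 int) \<times> ('g \<Rightarrow>\<^sub>0 int)) \<Rightarrow>\<^sub>0 int" where
  "scale r = frag_extend (\<lambda>(p, x). frag_of (r * p, x))"

lemma scale_simps [simp]: "scale r (frag_of (p, x)) = frag_of (r * p, x)"
  "scale r (c - d) = scale r c - scale r d" "scale r 0 = 0"
  by (simp_all add: scale_def frag_extend_diff)

lemma scale_alex_sub: "c \<in> alex_sub \<Longrightarrow> scale r c \<in> alex_sub"
  unfolding alex_sub_def
proof (induction rule: generate_free_Abelian_induct)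
  case (relator c)
  have "scale r c \<in> alex_sub"
    using relator
  proof (cases rule: alex_rel_cases)
    case (add_left p q x)
    then show ?thesis using alex_relI(1)[of x "r * p" "r * q"] by (simp add: distrib_left)
  next
    case (add_right p x y)
    then show ?thesis using alex_relI(2)[of x y "r * p"] by simp
  next
    case (balanced p s x)
    then show ?thesis using alex_relI(3)[of s x "r * p"] by (simp add: mult.assoc)
  qed
  then show ?case using alex_rel_keys[OF relator] by (simp add: alex_sub_def)
next
  case zero
  then show ?case using alex_sub.zero_mem by (simp add: alex_sub_def)
next
  case (diff c d)
  then show ?case using alex_sub.diff_mem[of "scale r c" "scale r d"] by (simp add: alex_sub_def)
qed

lemma alex_def: "alex = quot_module
  \<lparr>carrier = carrier (free_Abelian_group (UNIV \<times> aug)), monoid.mult = undefined, one = undefined,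
   zero = 0, add = (+), module.smult = scale\<rparr> alex_sub"
  unfolding alexander_module_def tensor_module_def aug_carrier alex_sub_def alex_rel_def scale_def
  by simp

lemma alex_carrier: "carrier alex = acls ` {c. Poly_Mapping.keys c \<subseteq> UNIV \<times> aug}"
  unfolding alex_def by (subst quot_module_carrier) (auto simp: free_Abelian_group_def)

lemma alex_add: "acls c \<oplus>\<^bsub>alex\<^esub> acls d = acls (c + d)"
  unfolding alex_def by (rule alex_sub.quot_module_add) simp

lemma alex_zero: "\<zero>\<^bsub>alex\<^esub> = acls 0"
  unfolding alex_def by (rule quot_module_zero)

lemma alex_smult: "r \<odot>\<^bsub>alex\<^esub> acls c = acls (scale r c)"
  unfolding alex_def
  by (subst alex_sub.quot_module_smult) (use scale_alex_sub[of _ r] in \<open>auto simp flip: scale_simps(2)\<close>)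

lemma alex_mem: "Poly_Mapping.keys c \<subseteq> UNIV \<times> aug \<Longrightarrow> acls c \<in> carrier alex"
  unfolding alex_carrier by blast

lemma delta_mem: "g \<in> carrier G \<Longrightarrow> delta g \<in> carrier alex"
  unfolding delta_def by (rule alex_mem) (simp add: keys_frag_of aug_gen)

definition alex_hom :: "((int \<Rightarrow>\<^sub>0 int) \<Rightarrow> 'r::comm_ring_1) \<Rightarrow>
    ((((int \<Rightarrow>\<^sub>0 int) \<times> ('g \<Rightarrow>\<^sub>0 int)) \<Rightarrow>\<^sub>0 int) set \<Rightarrow> 'r) \<Rightarrow> bool" where
  "alex_hom \<chi> F \<longleftrightarrow> (\<forall>a\<in>carrier alex. \<forall>b\<in>carrier alex. F (a \<oplus>\<^bsub>alex\<^esub> b) = F a + F b) \<and>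
     (\<forall>p. \<forall>a\<in>carrier alex. F (p \<odot>\<^bsub>alex\<^esub> a) = \<chi> p * F a)"

abbreviation char :: "((int \<Rightarrow>\<^sub>0 int) \<Rightarrow> 'r::comm_ring_1) \<Rightarrow> 'g \<Rightarrow> 'r" where
  "char \<chi> g \<equiv> \<chi> (tpow (\<phi> g))"

text \<open>The universal property of the Alexander module: a crossed homomorphism extends linearly to the
  augmentation ideal, by its values on \<open>g - 1\<close>, and this extension is semilinear over the group ring.\<close>

lemma alex_hom_of_crossed_hom:
  assumes \<chi>: "comm_ring_hom \<chi>" and D: "crossed_hom G (char \<chi>) D"
  shows "\<exists>F. alex_hom \<chi> F \<and> (\<forall>g\<in>carrier G. F (delta g) = D g)"
proof -
  interpret \<chi>: comm_ring_hom \<chi> by fact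
  define f where "f = (\<lambda>(p, x). \<chi> p * zext D x)"
  have f: "f (p, x) = \<chi> p * zext D x" for p x by (simp add: f_def)
  have kill: "zext f c = 0" if "c \<in> alex_sub" for c
    using that unfolding alex_sub_def
  proof (induction rule: generate_free_Abelian_induct)
    case (relator c)
    then have "zext f c = 0"
    proof (cases rule: alex_rel_cases)
      case (add_left p q x)
      then show ?thesis by (simp add: zext_simps(2) f \<chi>.hom_add distrib_right)
    next
      case (add_right p x y)
      then show ?thesis by (simp add: zext_simps(1,2) f distrib_left)
    next
      case (balanced p s x)
      then show ?thesis
        by (simp add: zext_simps(2) f zext_lmult[OF _ _ D] \<chi>.hom_mult group_ring_map_zext zext_hom[OF \<chi>] mult.assoc)
    qed
    then show ?case using alex_rel_keys[OF relator] by simp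
  qed (simp_all add: zext_simps)
  have well: "zext f c = zext f d" if "acls c = acls d" for c d
  proof -
    have "c - d \<in> alex_sub" using that unfolding alex_sub.cls_eq_iff .
    from kill[OF this] show ?thesis unfolding zext_simps(2) by (rule iffD2[OF eq_iff_diff_eq_0])
  qed
  define F where "F a = zext f (SOME c. acls c = a)" for a
  have F: "F (acls c) = zext f c" for c
    unfolding F_def by (rule well) (rule someI[of "\<lambda>d. acls d = acls c"], simp)
  have scale: "zext f (scale r c) = \<chi> r * zext f c" for r c
    by (simp add: scale_def zext_frag_extend split_def f \<chi>.hom_mult mult.assoc zext_mult_left)
      (simp add: f_def split_def)
  have D1: "D \<one> = 0"
  proof -
    have "\<phi> \<one> = 0" using phi_mult[OF one_closed one_closed] by simp
    then have "char \<chi> \<one> = 1" by simp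
    moreover have "D (\<one> \<otimes> \<one>) = D \<one> + char \<chi> \<one> * D \<one>"
      using D unfolding crossed_hom_def by blast
    ultimately show ?thesis by simp
  qed
  have "alex_hom \<chi> F"
    unfolding alex_hom_def alex_carrier
    by (auto simp: alex_add alex_smult F zext_simps(1) scale)
  moreover have "F (delta g) = D g" for g
    by (simp add: delta_def F f zext_simps D1)
  ultimately show ?thesis by blast
qed

lemma delta_mult:
  assumes "g \<in> carrier G" "h \<in> carrier G"
  shows "delta (g \<otimes> h) = delta g \<oplus>\<^bsub>alex\<^esub> (tpow (\<phi> g) \<odot>\<^bsub>alex\<^esub> delta h)"
proof -
  let ?x = "frag_of g - frag_of \<one>" and ?y = "frag_of h - frag_of \<one>" and ?s = "frag_of g"
  have xy: "?x \<in> aug" "?y \<in> aug" "Poly_Mapping.keys ?s \<subseteq> carrier G"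
    using assms by (auto simp: aug_gen keys_frag_of)
  have lm: "lmult ?s ?y = frag_of (g \<otimes> h) - frag_of g"
    using assms by (simp add: lmult_eq frag_extend_diff)
  then have sum: "frag_of (g \<otimes> h) - frag_of \<one> = ?x + lmult ?s ?y" by simp
  have gr: "group_ring_map \<phi> ?s = tpow (\<phi> g)" by (simp add: group_ring_map_def)
  have "frag_of (1, ?x + lmult ?s ?y) - (frag_of (1, ?x) + frag_of (tpow (\<phi> g), ?y))
    = (frag_of (1, ?x + lmult ?s ?y) - frag_of (1, ?x) - frag_of (1, lmult ?s ?y))
      - (frag_of (1 * group_ring_map \<phi> ?s, ?y) - frag_of (1, lmult ?s ?y))"
    by (simp add: gr)
  also have "\<dots> \<in> alex_sub"
    by (intro alex_sub.diff_mem alex_relI xy aug_lmult)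
  finally show ?thesis
    unfolding delta_def alex_smult alex_add scale_simps mult_1_right alex_sub.cls_eq_iff sum .
qed

lemma crossed_hom_of_alex_hom:
  assumes "alex_hom \<chi> F"
  shows "crossed_hom G (char \<chi>) (\<lambda>g. F (delta g))"
  unfolding crossed_hom_def
proof (intro ballI)
  fix g h assume gh: "g \<in> carrier G" "h \<in> carrier G"
  have "tpow (\<phi> g) \<odot>\<^bsub>alex\<^esub> delta h \<in> carrier alex"
    unfolding delta_def alex_smult by (rule alex_mem) (simp add: keys_frag_of aug_gen gh)
  then show "F (delta (g \<otimes> h)) = F (delta g) + char \<chi> g * F (delta h)"
    using assms gh by (simp add: delta_mult delta_mem alex_hom_def)
qed

text \<open>The Alexander module is generated by the classes of the \<open>g - 1\<close>.\<close>

lemma alex_hom_eq_0: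
  assumes F: "alex_hom \<chi> F" and 0: "\<And>g. g \<in> carrier G \<Longrightarrow> F (delta g) = 0" and a: "a \<in> carrier alex"
  shows "F a = 0"
proof -
  have F_add: "F (acls (c + d)) = F (acls c) + F (acls d)"
    if "Poly_Mapping.keys c \<subseteq> UNIV \<times> aug" "Poly_Mapping.keys d \<subseteq> UNIV \<times> aug" for c d
    using F alex_mem[OF that(1)] alex_mem[OF that(2)] by (simp add: alex_hom_def flip: alex_add)
  have F_0: "F (acls 0) = 0" using F_add[of 0 0] by simp
  have F_diff: "F (acls (c - d)) = F (acls c) - F (acls d)"
    if "Poly_Mapping.keys c \<subseteq> UNIV \<times> aug" "Poly_Mapping.keys d \<subseteq> UNIV \<times> aug" for c d
  proof -
    have "Poly_Mapping.keys (c - d) \<subseteq> UNIV \<times> aug" using keys_diff[of c d] that by blast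
    from F_add[OF this that(2)] show ?thesis by simp
  qed
  have key1: "Poly_Mapping.keys (frag_of (p, x)) \<subseteq> UNIV \<times> aug" if "x \<in> aug" for p :: "int \<Rightarrow>\<^sub>0 int" and x
    using that by (simp add: keys_frag_of)
  have F_right: "F (acls (frag_of (1, x + y))) = F (acls (frag_of (1, x))) + F (acls (frag_of (1, y)))"
    if "x \<in> aug" "y \<in> aug" for x y
  proof -
    have "acls (frag_of (1, x + y)) = acls (frag_of (1, x) + frag_of (1, y))"
      unfolding alex_sub.cls_eq_iff using alex_relI(2)[OF that, of 1] by (simp add: diff_diff_eq)
    then show ?thesis using F_add[OF key1 key1] that by simp
  qed
  have F_right_diff: "F (acls (frag_of (1, x - y))) = F (acls (frag_of (1, x))) - F (acls (frag_of (1, y)))"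
    if "x \<in> aug" "y \<in> aug" for x y
    using F_right[OF aug_diff[OF that] that(2)] by simp
  \<comment> \<open>a linear extension of \<open>g \<mapsto> g - 1\<close> that is the identity on the augmentation ideal\<close>
  define r where "r x = x - frag_cmul (augmentation x) (frag_of \<one>)" for x :: "'g \<Rightarrow>\<^sub>0 int"
  have r_diff: "r (x - y) = r x - r y" for x y
    by (simp add: r_def augmentation_zext zext_simps frag_cmul_diff_distrib)
  have "r x \<in> aug \<and> F (acls (frag_of (1, r x))) = 0" if "Poly_Mapping.keys x \<subseteq> carrier G" for x
    using that
  proof (induction x rule: frag_induction)
    case zero
    have "(0 :: 'g \<Rightarrow>\<^sub>0 int) \<in> aug" by (simp add: aug_def augmentation_def)
    then show ?case using F_right_diff[of 0 0] by (simp add: r_def augmentation_def)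
  next
    case (one g)
    then show ?case using 0[OF one] aug_gen[OF one one_closed]
      by (simp add: r_def augmentation_zext delta_def)
  next
    case (diff x y)
    then show ?case using F_right_diff[of "r x" "r y"] aug_diff[of "r x" "r y"] by (simp add: r_diff)
  qed
  moreover have "r x = x" if "x \<in> aug" for x using that by (simp add: r_def aug_def)
  ultimately have F_gen: "F (acls (frag_of (1, x))) = 0" if "x \<in> aug" for x
    using that by (metis (mono_tags, lifting) aug_def mem_Collect_eq)
  have "F (acls c) = 0" if "Poly_Mapping.keys c \<subseteq> UNIV \<times> aug" for c
  proof -
    have "Poly_Mapping.keys c \<subseteq> UNIV \<times> aug \<and> F (acls c) = 0"
      using that
    proof (induction c rule: frag_induction)
      case (one px)
      then obtain p x where px: "px = (p, x)" "x \<in> aug" by blast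
      have "acls (frag_of px) = p \<odot>\<^bsub>alex\<^esub> acls (frag_of (1, x))" by (simp add: px alex_smult)
      then have "F (acls (frag_of px)) = \<chi> p * F (acls (frag_of (1, x)))"
        using F alex_mem[OF key1[OF px(2)]] by (simp add: alex_hom_def)
      then show ?case using F_gen[OF px(2)] px by (simp add: keys_frag_of)
    next
      case (diff c d)
      then show ?case using F_diff[of c d] keys_diff[of c d] by auto
    qed (simp add: F_0)
    then show ?thesis ..
  qed
  then show ?thesis using a by (auto simp: alex_carrier)
qed

end

section \<open>Crossed homomorphisms as kernel vectors of a presentation matrix\<close>

locale presented = group_to_int G \<phi> for G :: "('g, 'a) monoid_scheme" (structure) and \<phi> +
  fixes P :: "(int \<Rightarrow>\<^sub>0 int) mat" and \<pi>
  assumes pi_hom: "\<pi> \<in> LinearCombinations.module_hom class_ring (module_vec TYPE(int \<Rightarrow>\<^sub>0 int) (dim_col P)) alex"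
    and pi_surj: "\<pi> ` carrier_vec (dim_col P) = carrier alex"
    and pi_ker: "{v \<in> carrier_vec (dim_col P). \<pi> v = \<zero>\<^bsub>alex\<^esub>} =
      (\<lambda>w. transpose_mat P *\<^sub>v w) ` carrier_vec (dim_row P)"
begin

definition lift :: "'g \<Rightarrow> (int \<Rightarrow>\<^sub>0 int) vec" where
  "lift g = (SOME v. v \<in> carrier_vec (dim_col P) \<and> \<pi> v = delta g)"

definition kernel_vector :: "((int \<Rightarrow>\<^sub>0 int) \<Rightarrow> 'r::comm_ring_1) \<Rightarrow> (nat \<Rightarrow> 'r) \<Rightarrow> bool" where
  "kernel_vector \<chi> u \<longleftrightarrow> (\<forall>r<dim_row P. (\<Sum>i<dim_col P. \<chi> (P $$ (r, i)) * u i) = 0)"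

definition pairing :: "((int \<Rightarrow>\<^sub>0 int) \<Rightarrow> 'r::comm_ring_1) \<Rightarrow> (nat \<Rightarrow> 'r) \<Rightarrow> (int \<Rightarrow>\<^sub>0 int) vec \<Rightarrow> 'r" where
  "pairing \<chi> u v = (\<Sum>i<dim_col P. \<chi> (v $ i) * u i)"

abbreviation crossed :: "((int \<Rightarrow>\<^sub>0 int) \<Rightarrow> 'r::comm_ring_1) \<Rightarrow> (nat \<Rightarrow> 'r) \<Rightarrow> 'g \<Rightarrow> 'r" where
  "crossed \<chi> u g \<equiv> pairing \<chi> u (lift g)"

lemma pi_add: "v \<in> carrier_vec (dim_col P) \<Longrightarrow> w \<in> carrier_vec (dim_col P) \<Longrightarrow> \<pi> (v + w) = \<pi> v \<oplus>\<^bsub>alex\<^esub> \<pi> w"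
  and pi_smult: "v \<in> carrier_vec (dim_col P) \<Longrightarrow> \<pi> (p \<cdot>\<^sub>v v) = p \<odot>\<^bsub>alex\<^esub> \<pi> v"
  using pi_hom by (auto simp: LinearCombinations.module_hom_def module_vec_simps)

lemma lift: 
  assumes "g \<in> carrier G"
  shows "lift g \<in> carrier_vec (dim_col P)" "\<pi> (lift g) = delta g"
proof -
  have "\<exists>v. v \<in> carrier_vec (dim_col P) \<and> \<pi> v = delta g"
    using delta_mem[OF assms] unfolding pi_surj[symmetric] by (metis imageE)
  from someI_ex[OF this] show "lift g \<in> carrier_vec (dim_col P)" "\<pi> (lift g) = delta g"
    unfolding lift_def by simp_all
qed

context
  fixes \<chi> :: "(int \<Rightarrow>\<^sub>0 int) \<Rightarrow> 'r::comm_ring_1"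
  assumes \<chi>: "comm_ring_hom \<chi>"
begin

interpretation \<chi>: comm_ring_hom \<chi> by (rule \<chi>)

lemma pairing_add:
  assumes "v \<in> carrier_vec (dim_col P)" "w \<in> carrier_vec (dim_col P)"
  shows "pairing \<chi> u (v + w) = pairing \<chi> u v + pairing \<chi> u w"
proof -
  have "pairing \<chi> u (v + w) = (\<Sum>i<dim_col P. \<chi> (v $ i) * u i + \<chi> (w $ i) * u i)"
    unfolding pairing_def by (rule sum.cong) (use assms in \<open>auto simp: \<chi>.hom_add distrib_right\<close>)
  then show ?thesis by (simp add: pairing_def sum.distrib)
qed

lemma pairing_smult:
  assumes "v \<in> carrier_vec (dim_col P)"
  shows "pairing \<chi> u (p \<cdot>\<^sub>v v) = \<chi> p * pairing \<chi> u v"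
  unfolding pairing_def sum_distrib_left
  by (rule sum.cong) (use assms in \<open>auto simp: \<chi>.hom_mult mult.assoc\<close>)

lemma pairing_row_span:
  assumes u: "kernel_vector \<chi> u" and w: "w \<in> carrier_vec (dim_row P)"
  shows "pairing \<chi> u (transpose_mat P *\<^sub>v w) = 0"
proof -
  have "pairing \<chi> u (transpose_mat P *\<^sub>v w) = (\<Sum>i<dim_col P. \<Sum>r<dim_row P. \<chi> (w $ r) * (\<chi> (P $$ (r, i)) * u i))"
    unfolding pairing_def
  proof (rule sum.cong)
    fix i assume i: "i \<in> {..<dim_col P}"
    have "(transpose_mat P *\<^sub>v w) $ i = (\<Sum>r<dim_row P. P $$ (r, i) * w $ r)"
      using mult_mat_vec_nth[of "transpose_mat P" "dim_col P" "dim_row P" w i] w i by simp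
    then have "\<chi> ((transpose_mat P *\<^sub>v w) $ i) = (\<Sum>r<dim_row P. \<chi> (P $$ (r, i)) * \<chi> (w $ r))"
      by (simp only: \<chi>.hom_sum \<chi>.hom_mult)
    then have "\<chi> ((transpose_mat P *\<^sub>v w) $ i) * u i = (\<Sum>r<dim_row P. \<chi> (P $$ (r, i)) * \<chi> (w $ r) * u i)"
      by (simp only: sum_distrib_right)
    also have "\<dots> = (\<Sum>r<dim_row P. \<chi> (w $ r) * (\<chi> (P $$ (r, i)) * u i))"
      by (rule sum.cong[OF refl]) (simp add: mult.assoc mult.left_commute)
    finally show "\<chi> ((transpose_mat P *\<^sub>v w) $ i) * u i = (\<Sum>r<dim_row P. \<chi> (w $ r) * (\<chi> (P $$ (r, i)) * u i))" .
  qed simp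
  also have "\<dots> = (\<Sum>r<dim_row P. \<chi> (w $ r) * (\<Sum>i<dim_col P. \<chi> (P $$ (r, i)) * u i))"
    by (subst sum.swap) (simp only: sum_distrib_left)
  also have "\<dots> = 0" using u by (intro sum.neutral) (auto simp: kernel_vector_def)
  finally show ?thesis .
qed

lemma pairing_well_defined:
  assumes u: "kernel_vector \<chi> u" and v: "v \<in> carrier_vec (dim_col P)" and w: "w \<in> carrier_vec (dim_col P)"
    and eq: "\<pi> v = \<pi> w"
  shows "pairing \<chi> u v = pairing \<chi> u w"
proof -
  have mw: "(-1) \<cdot>\<^sub>v w \<in> carrier_vec (dim_col P)" using w by simp
  have "w + (-1) \<cdot>\<^sub>v w = 0\<^sub>v (dim_col P)" using w by (intro eq_vecI) auto
  moreover have "0\<^sub>v (dim_col P) = transpose_mat P *\<^sub>v 0\<^sub>v (dim_row P)" by (rule eq_vecI) simp_all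
  then have "\<pi> (0\<^sub>v (dim_col P)) = \<zero>\<^bsub>alex\<^esub>" using pi_ker by (metis (mono_tags, lifting) imageI mem_Collect_eq zero_carrier_vec)
  ultimately have "\<pi> (v + (-1) \<cdot>\<^sub>v w) = \<zero>\<^bsub>alex\<^esub>"
    using pi_add[OF v mw] pi_add[OF w mw] eq by simp
  then have "v + (-1) \<cdot>\<^sub>v w \<in> {v \<in> carrier_vec (dim_col P). \<pi> v = \<zero>\<^bsub>alex\<^esub>}" using v w by simp
  then obtain y where "y \<in> carrier_vec (dim_row P)" "v + (-1) \<cdot>\<^sub>v w = transpose_mat P *\<^sub>v y"
    unfolding pi_ker by (elim imageE)
  then have "pairing \<chi> u (v + (-1) \<cdot>\<^sub>v w) = 0" using pairing_row_span[OF u] by simp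
  then show ?thesis by (simp add: pairing_add[OF v mw] pairing_smult[OF w] \<chi>.hom_uminus)
qed

text \<open>A semilinear map out of a presented module amounts to values \<open>u\<^sub>i\<close> at the generators that satisfy
  the relations, that is, the equations given by the rows of \<open>P\<close>.\<close>

lemma alex_hom_of_kernel_vector:
  assumes u: "kernel_vector \<chi> u"
  shows "\<exists>F. alex_hom \<chi> F \<and> (\<forall>v\<in>carrier_vec (dim_col P). F (\<pi> v) = pairing \<chi> u v)"
proof -
  define F where "F a = pairing \<chi> u (SOME v. v \<in> carrier_vec (dim_col P) \<and> \<pi> v = a)" for a
  have F: "F (\<pi> v) = pairing \<chi> u v" if v: "v \<in> carrier_vec (dim_col P)" for v
  proof -
    have "(SOME w. w \<in> carrier_vec (dim_col P) \<and> \<pi> w = \<pi> v) \<in> carrier_vec (dim_col P)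
      \<and> \<pi> (SOME w. w \<in> carrier_vec (dim_col P) \<and> \<pi> w = \<pi> v) = \<pi> v"
      by (rule someI[of _ v]) (simp add: v)
    then show ?thesis unfolding F_def using pairing_well_defined[OF u _ v] by blast
  qed
  have "alex_hom \<chi> F"
    unfolding alex_hom_def
  proof (intro conjI ballI allI)
    fix a b assume "a \<in> carrier alex" "b \<in> carrier alex"
    then obtain v w where vw: "v \<in> carrier_vec (dim_col P)" "a = \<pi> v" "w \<in> carrier_vec (dim_col P)" "b = \<pi> w"
      unfolding pi_surj[symmetric] by (elim imageE)
    then show "F (a \<oplus>\<^bsub>alex\<^esub> b) = F a + F b" by (simp add: F pairing_add flip: pi_add)
  next
    fix p a assume "a \<in> carrier alex"
    then obtain v where v: "v \<in> carrier_vec (dim_col P)" "a = \<pi> v"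
      unfolding pi_surj[symmetric] by (elim imageE)
    then show "F (p \<odot>\<^bsub>alex\<^esub> a) = \<chi> p * F a" by (simp add: F pairing_smult flip: pi_smult)
  qed
  with F show ?thesis by blast
qed

lemma kernel_vector_of_alex_hom:
  assumes F: "alex_hom \<chi> F"
  defines "u \<equiv> \<lambda>i. F (\<pi> (unit_vec (dim_col P) i))"
  shows "kernel_vector \<chi> u" "\<And>v. v \<in> carrier_vec (dim_col P) \<Longrightarrow> F (\<pi> v) = pairing \<chi> u v"
proof -
  have mem: "\<pi> v \<in> carrier alex" if "v \<in> carrier_vec (dim_col P)" for v
    unfolding pi_surj[symmetric] using that by (rule imageI)
  have F_add: "F (\<pi> (v + w)) = F (\<pi> v) + F (\<pi> w)" if "v \<in> carrier_vec (dim_col P)" "w \<in> carrier_vec (dim_col P)" for v w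
    using F mem[OF that(1)] mem[OF that(2)] by (simp add: alex_hom_def pi_add that)
  have F_smult: "F (\<pi> (p \<cdot>\<^sub>v v)) = \<chi> p * F (\<pi> v)" if "v \<in> carrier_vec (dim_col P)" for p v
    using F mem[OF that] by (simp add: alex_hom_def pi_smult that)
  have partial: "F (\<pi> (vec (dim_col P) (\<lambda>i. if i < k then v $ i else 0))) = (\<Sum>i<k. \<chi> (v $ i) * u i)"
    if "k \<le> dim_col P" for k v
    using that
  proof (induction k)
    case 0
    have "vec (dim_col P) (\<lambda>i. if i < 0 then v $ i else 0) = 0 \<cdot>\<^sub>v 0\<^sub>v (dim_col P)" by (rule eq_vecI) simp_all
    then show ?case using F_smult[of "0\<^sub>v (dim_col P)" 0] by simp
  next
    case (Suc k)
    have "vec (dim_col P) (\<lambda>i. if i < Suc k then v $ i else 0)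
      = vec (dim_col P) (\<lambda>i. if i < k then v $ i else 0) + v $ k \<cdot>\<^sub>v unit_vec (dim_col P) k"
      by (rule eq_vecI) (use Suc.prems in \<open>auto simp: less_Suc_eq\<close>)
    then show ?case using Suc by (simp add: F_add F_smult u_def)
  qed
  show pair: "F (\<pi> v) = pairing \<chi> u v" if v: "v \<in> carrier_vec (dim_col P)" for v
  proof -
    have "vec (dim_col P) (\<lambda>i. if i < dim_col P then v $ i else 0) = v"
      by (rule eq_vecI) (use v in auto)
    then show ?thesis using partial[of "dim_col P" v] by (simp add: pairing_def)
  qed
  show "kernel_vector \<chi> u"
    unfolding kernel_vector_def
  proof (intro allI impI)
    fix r assume r: "r < dim_row P"
    have "row P r = transpose_mat P *\<^sub>v unit_vec (dim_row P) r"
      by (rule eq_vecI) (use r in \<open>auto simp: scalar_prod_right_unit\<close>)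
    then have "row P r \<in> {v \<in> carrier_vec (dim_col P). \<pi> v = \<zero>\<^bsub>alex\<^esub>}"
      unfolding pi_ker by (intro image_eqI[of _ _ "unit_vec (dim_row P) r"]) simp_all
    then have "\<pi> (row P r) = acls 0" by (simp add: alex_zero)
    moreover have "F (acls 0) = 0"
    proof -
      have "acls 0 \<in> carrier alex" by (rule alex_mem) simp
      then have "F (acls 0 \<oplus>\<^bsub>alex\<^esub> acls 0) = F (acls 0) + F (acls 0)"
        using F unfolding alex_hom_def by blast
      then show ?thesis by (simp add: alex_add)
    qed
    ultimately have "pairing \<chi> u (row P r) = 0" using pair[of "row P r"] by simp
    then show "(\<Sum>i<dim_col P. \<chi> (P $$ (r, i)) * u i) = 0"
      using r by (simp add: pairing_def)
  qed
qed

lemma crossed_hom_of_kernel_vector: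
  assumes "kernel_vector \<chi> u"
  shows "crossed_hom G (char \<chi>) (crossed \<chi> u)"
proof -
  obtain F where F: "alex_hom \<chi> F" "\<And>v. v \<in> carrier_vec (dim_col P) \<Longrightarrow> F (\<pi> v) = pairing \<chi> u v"
    using alex_hom_of_kernel_vector[OF assms] by blast
  have "F (delta g) = crossed \<chi> u g" if "g \<in> carrier G" for g
    using F(2)[OF lift(1)[OF that]] lift(2)[OF that] by simp
  then show ?thesis
    using crossed_hom_of_alex_hom[OF F(1)] by (simp add: crossed_hom_def)
qed

lemma kernel_vector_of_crossed_hom:
  assumes "crossed_hom G (char \<chi>) D"
  shows "\<exists>u. kernel_vector \<chi> u \<and> (\<forall>g\<in>carrier G. crossed \<chi> u g = D g)"
proof -
  obtain F where F: "alex_hom \<chi> F" "\<And>g. g \<in> carrier G \<Longrightarrow> F (delta g) = D g"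
    using alex_hom_of_crossed_hom[OF \<chi> assms] by blast
  let ?u = "\<lambda>i. F (\<pi> (unit_vec (dim_col P) i))"
  have "crossed \<chi> ?u g = D g" if "g \<in> carrier G" for g
    using kernel_vector_of_alex_hom(2)[OF F(1) lift(1)[OF that]] lift(2)[OF that] F(2)[OF that] by simp
  then show ?thesis using kernel_vector_of_alex_hom(1)[OF F(1)] by blast
qed

lemma kernel_vector_eq_0:
  assumes u: "kernel_vector \<chi> u" and 0: "\<And>g. g \<in> carrier G \<Longrightarrow> crossed \<chi> u g = 0" and i: "i < dim_col P"
  shows "u i = 0"
proof -
  obtain F where F: "alex_hom \<chi> F" "\<And>v. v \<in> carrier_vec (dim_col P) \<Longrightarrow> F (\<pi> v) = pairing \<chi> u v"
    using alex_hom_of_kernel_vector[OF u] by blast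
  have "F (delta g) = 0" if "g \<in> carrier G" for g
    using F(2)[OF lift(1)[OF that]] lift(2)[OF that] 0[OF that] by simp
  moreover have "\<pi> (unit_vec (dim_col P) i) \<in> carrier alex"
    unfolding pi_surj[symmetric] by (rule imageI) simp
  ultimately have "F (\<pi> (unit_vec (dim_col P) i)) = 0" by (rule alex_hom_eq_0[OF F(1)])
  then have "pairing \<chi> u (unit_vec (dim_col P) i) = 0" using F(2) by simp
  moreover have "pairing \<chi> u (unit_vec (dim_col P) i) = (\<Sum>k<dim_col P. if k = i then u k else 0)"
    unfolding pairing_def by (rule sum.cong) (use i in auto)
  ultimately show ?thesis using i by simp
qed

end

end


section \<open>The projection onto the infinite cyclic quotient\<close>

lemma (in comm_group) torsion_subgroup_is_subgroup: "subgroup (torsion_subgroup G) G"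
proof (rule subgroupI)
  show "torsion_subgroup G \<subseteq> carrier G" by (auto simp: torsion_subgroup_def)
  show "torsion_subgroup G \<noteq> {}"
    by (auto simp: torsion_subgroup_def intro!: exI[of _ \<one>] exI[of _ 1])
next
  fix x assume "x \<in> torsion_subgroup G"
  then obtain n :: nat where x: "x \<in> carrier G" "0 < n" "x [^] n = \<one>" by (auto simp: torsion_subgroup_def)
  then have "inv x [^] n = \<one>" by (simp add: nat_pow_inv)
  with x show "inv x \<in> torsion_subgroup G" by (auto simp: torsion_subgroup_def)
next
  fix x y assume "x \<in> torsion_subgroup G" "y \<in> torsion_subgroup G"
  then obtain n m :: nat where x: "x \<in> carrier G" "0 < n" "x [^] n = \<one>"
    and y: "y \<in> carrier G" "0 < m" "y [^] m = \<one>" by (auto simp: torsion_subgroup_def)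
  have "x [^] (n * m) = \<one>" using x y by (simp flip: nat_pow_pow)
  moreover have "y [^] (n * m) = \<one>" using x y by (simp add: mult.commute[of n] flip: nat_pow_pow)
  ultimately have "(x \<otimes> y) [^] (n * m) = \<one>"
    using x y by (simp add: pow_mult_distrib m_comm)
  then show "x \<otimes> y \<in> torsion_subgroup G"
    using x y by (auto simp: torsion_subgroup_def intro!: exI[of _ "n * m"])
qed

lemma abf_projection_hom:
  fixes G :: "('g, 'a) monoid_scheme" (structure)
  assumes "group G" and psi: "\<psi> \<in> iso (abf G) integer_group"
  shows "abf_projection G \<psi> \<in> hom G integer_group" "abf_projection G \<psi> ` carrier G = UNIV"
proof -
  interpret group G by fact
  let ?A = "abelianization G"
  have N: "derived G (carrier G) \<lhd> G"
    using derived_is_normal[OF normal_self] .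
  interpret A: comm_group ?A unfolding abelianization_def by (rule derived_quot_is_comm_group)
  have T: "torsion_subgroup ?A \<lhd> ?A"
    by (rule A.subgroup_imp_normal[OF A.torsion_subgroup_is_subgroup])
  have 1: "(\<lambda>g. derived G (carrier G) #> g) \<in> hom G ?A"
    unfolding abelianization_def by (rule normal.r_coset_hom_Mod[OF N])
  have 2: "(\<lambda>a. torsion_subgroup ?A #>\<^bsub>?A\<^esub> a) \<in> hom ?A (abf G)"
    unfolding abf_def by (rule normal.r_coset_hom_Mod[OF T])
  have 3: "\<psi> \<in> hom (abf G) integer_group" using psi by (simp add: iso_def)
  have eq: "abf_projection G \<psi> = \<psi> \<circ> ((\<lambda>a. torsion_subgroup ?A #>\<^bsub>?A\<^esub> a) \<circ> (\<lambda>g. derived G (carrier G) #> g))"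
    by (rule ext) (simp add: abf_projection_def)
  show "abf_projection G \<psi> \<in> hom G integer_group"
    unfolding eq by (intro Group.hom_compose[OF Group.hom_compose[OF 1 2] 3])
  have s1: "(\<lambda>g. derived G (carrier G) #> g) ` carrier G = carrier ?A"
    by (auto simp: abelianization_def FactGroup_def RCOSETS_def)
  have s2: "(\<lambda>a. torsion_subgroup ?A #>\<^bsub>?A\<^esub> a) ` carrier ?A = carrier (abf G)"
    by (auto simp: abf_def FactGroup_def RCOSETS_def)
  have s3: "\<psi> ` carrier (abf G) = UNIV" using psi by (auto simp: iso_def bij_betw_def)
  show "abf_projection G \<psi> ` carrier G = UNIV"
    unfolding eq by (simp only: image_comp[symmetric] s1 s2 s3)
qed


section \<open>The Alexander invariant\<close>

text \<open>The algebra behind \<open>(g, h) \<mapsto> (g t\<^sup>-\<^sup>i)(t\<^sup>i (h t\<^sup>-\<^sup>j) t\<^sup>-\<^sup>i)\<close>, the product in a semidirect product with an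
  infinite cyclic group generated by \<open>t\<close>; here \<open>a = t\<^sup>i\<close> and \<open>b = t\<^sup>j\<close>.\<close>

lemma (in group) conj_rearrange:
  assumes "g \<in> carrier G" "h \<in> carrier G" "a \<in> carrier G" "b \<in> carrier G"
  shows "g \<otimes> h \<otimes> (inv b \<otimes> inv a) = (g \<otimes> inv a) \<otimes> (a \<otimes> (h \<otimes> inv b) \<otimes> inv a)"
proof -
  have "inv a \<otimes> (a \<otimes> z) = z" if "z \<in> carrier G" for z
    using assms that by (simp flip: m_assoc)
  then show ?thesis using assms by (simp add: m_assoc)
qed

locale infinite_cyclic_quotient = group_to_int G \<phi> for G :: "('g, 'a) monoid_scheme" (structure) and \<phi> +
  fixes t0 :: 'g
  assumes t0: "t0 \<in> carrier G" "\<phi> t0 = 1"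
begin

lemma phi_one: "\<phi> \<one> = 0"
  using phi_mult[OF one_closed one_closed] by simp

lemma phi_inv: "g \<in> carrier G \<Longrightarrow> \<phi> (inv g) = - \<phi> g"
  using phi_mult[of g "inv g"] phi_one by simp

lemma phi_pow: "\<phi> (t0 [^] i) = (i :: int)"
proof -
  have nat: "\<phi> (t0 [^] n) = int n" for n :: nat
  proof (induction n)
    case 0
    show ?case using phi_one by simp
  next
    case (Suc n)
    have "\<phi> (t0 [^] n \<otimes> t0) = \<phi> (t0 [^] n) + \<phi> t0"
      by (rule phi_mult[OF nat_pow_closed[OF t0(1)] t0(1)])
    then show ?case using Suc t0(2) by simp
  qed
  show ?thesis
  proof (cases "i < 0")
    case True
    have "\<phi> (inv (t0 [^] nat (- i))) = - int (nat (- i))"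
      unfolding phi_inv[OF nat_pow_closed[OF t0(1)]] nat ..
    then show ?thesis unfolding int_pow_def2 using True by simp
  next
    case False
    then show ?thesis unfolding int_pow_def2 using nat[of "nat i"] by simp
  qed
qed

definition K :: "'g set" where "K = {g \<in> carrier G. \<phi> g = 0}"

definition N :: "'g set" where "N = derived G K"

definition kap :: "'g \<Rightarrow> 'g set" where "kap k = N #> k"

abbreviation "B \<equiv> ker_ab G \<phi>"

lemma K_eq: "kernel G integer_group \<phi> = K"
  by (auto simp: kernel_def K_def integer_group_def)

lemma K_carrier: "k \<in> K \<Longrightarrow> k \<in> carrier G" by (simp add: K_def)

lemma K_normal: "K \<lhd> G"
proof -
  have "group_hom G integer_group \<phi>"
    by (intro group_hom.intro group_hom_axioms.intro homI is_group group_integer_group)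
      (simp_all add: phi_mult)
  then show ?thesis using group_hom.normal_kernel K_eq by metis
qed

lemma K_closed: "one G \<in> K" "a \<in> K \<Longrightarrow> b \<in> K \<Longrightarrow> a \<otimes> b \<in> K" "a \<in> K \<Longrightarrow> inv a \<in> K"
  "g \<in> carrier G \<Longrightarrow> a \<in> K \<Longrightarrow> g \<otimes> a \<otimes> inv g \<in> K"
  by (auto simp: K_def phi_one phi_mult phi_inv)

lemma N_normal: "N \<lhd> G"
  unfolding N_def by (rule derived_is_normal[OF K_normal])

lemma N_subgroup: "subgroup N G"
  by (rule normal_imp_subgroup[OF N_normal])

lemma N_K: "N \<subseteq> K"
  unfolding N_def by (rule derived_incl[OF subset_refl normal_imp_subgroup[OF K_normal]])

lemma N_commutator: "a \<in> K \<Longrightarrow> b \<in> K \<Longrightarrow> a \<otimes> b \<otimes> inv a \<otimes> inv b \<in> N"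
  unfolding N_def derived_def by (rule generate.incl) blast

lemma kap_mult: "a \<in> K \<Longrightarrow> b \<in> K \<Longrightarrow> kap a <#> kap b = kap (a \<otimes> b)"
  unfolding kap_def by (rule normal.rcos_sum[OF N_normal]) (simp_all add: K_carrier)

lemma kap_eqI:
  assumes "a \<in> K" "b \<in> K" "a \<otimes> inv b \<in> N"
  shows "kap a = kap b"
proof -
  have "a = a \<otimes> inv b \<otimes> b" using assms(1,2) by (simp add: K_carrier m_assoc)
  then have "a \<in> N #> b" using assms(3) unfolding r_coset_def by blast
  then show ?thesis unfolding kap_def
    using repr_independence[OF _ _ N_subgroup, of a b] assms by (simp add: K_carrier)
qed

lemma kap_eqD:
  assumes "a \<in> K" "b \<in> K" "kap a = kap b"
  shows "a \<otimes> inv b \<in> N"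
proof -
  have "a \<in> N #> b" using rcos_self[OF _ N_subgroup, of a] assms by (simp add: kap_def K_carrier)
  then obtain n where n: "n \<in> N" "a = n \<otimes> b" by (auto simp: r_coset_def)
  then have "n \<in> K" using N_K by blast
  with n assms show ?thesis by (simp add: m_assoc K_carrier)
qed

lemma kap_comm:
  assumes "a \<in> K" "b \<in> K"
  shows "kap (a \<otimes> b) = kap (b \<otimes> a)"
proof (rule kap_eqI)
  have "a \<otimes> b \<otimes> inv (b \<otimes> a) = a \<otimes> b \<otimes> inv a \<otimes> inv b"
    using assms by (simp add: K_carrier inv_mult_group m_assoc)
  then show "a \<otimes> b \<otimes> inv (b \<otimes> a) \<in> N" using N_commutator[OF assms] by simp
qed (use assms K_closed in auto)

lemma B_carrier: "carrier B = kap ` K"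
  by (auto simp: ker_ab_def Let_def FactGroup_def RCOSETS_def r_coset_def kap_def N_def K_eq)

lemma B_mult: "Y \<otimes>\<^bsub>B\<^esub> Z = Y <#> Z"
  by (simp add: ker_ab_def Let_def FactGroup_def set_mult_def)

lemma B_one: "\<one>\<^bsub>B\<^esub> = kap \<one>"
  using coset_join2[OF one_closed N_subgroup subgroup.one_closed[OF N_subgroup]]
  by (simp add: ker_ab_def Let_def FactGroup_def kap_def N_def K_eq)

lemma B_kap_mult: "a \<in> K \<Longrightarrow> b \<in> K \<Longrightarrow> kap a \<otimes>\<^bsub>B\<^esub> kap b = kap (a \<otimes> b)"
  by (simp add: B_mult kap_mult)

lemma B_comm_group: "comm_group B"
proof (rule comm_groupI)
  fix x assume "x \<in> carrier B"
  then obtain a where a: "x = kap a" "a \<in> K" unfolding B_carrier by blast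
  show "\<exists>y\<in>carrier B. y \<otimes>\<^bsub>B\<^esub> x = \<one>\<^bsub>B\<^esub>"
    by (rule bexI[of _ "kap (inv a)"]) (use a K_closed in \<open>simp_all add: B_kap_mult B_one B_carrier K_carrier\<close>)
qed (use K_closed kap_comm in \<open>auto simp: B_carrier B_kap_mult B_one K_carrier m_assoc\<close>)

sublocale B: comm_group B by (rule B_comm_group)

text \<open>Conjugation by any \<open>g\<close> with \<open>\<phi> g = i\<close> induces the action of \<open>t\<^sup>i\<close>: two choices of \<open>g\<close> differ by
  an element of the kernel, which acts trivially on its abelianization.\<close>

lemma conj_kap:
  assumes g: "g \<in> carrier G" "\<phi> g = i" and k: "k \<in> K"
  shows "conj_action G \<phi> i (kap k) = kap (g \<otimes> k \<otimes> inv g)"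
proof (intro equalityI subsetI)
  let ?y = "g \<otimes> k \<otimes> inv g"
  have y: "?y \<in> K" using K_closed(4) g k by blast
  fix w assume "w \<in> conj_action G \<phi> i (kap k)"
  then obtain g' x where w: "w = g' \<otimes> x \<otimes> inv g'" "g' \<in> carrier G" "\<phi> g' = i" "x \<in> kap k"
    unfolding conj_action_def by blast
  then obtain n where n: "n \<in> N" "x = n \<otimes> k" by (auto simp: kap_def r_coset_def)
  have nc: "n \<in> carrier G" using n(1) N_K K_carrier by blast
  have kc: "k \<in> carrier G" using k K_carrier by blast
  let ?u = "g' \<otimes> inv g"
  have u: "?u \<in> K" using g w by (simp add: K_def phi_mult phi_inv)
  have "g' \<otimes> k \<otimes> inv g' = ?u \<otimes> (?y \<otimes> inv ?u)"
  proof -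
    have "inv g \<otimes> (g \<otimes> z) = z" if "z \<in> carrier G" for z
      using g(1) that by (simp flip: m_assoc)
    then show ?thesis using g(1) w(2) kc by (simp add: m_assoc inv_mult_group)
  qed
  then have "kap (g' \<otimes> k \<otimes> inv g') = kap ((?y \<otimes> inv ?u) \<otimes> ?u)"
    using kap_comm[OF u K_closed(2)[OF y K_closed(3)[OF u]]] by simp
  also have "(?y \<otimes> inv ?u) \<otimes> ?u = ?y"
    using y u K_carrier by (simp add: m_assoc)
  finally have eq: "kap (g' \<otimes> k \<otimes> inv g') = kap ?y" .
  have "w = (g' \<otimes> n \<otimes> inv g') \<otimes> (g' \<otimes> k \<otimes> inv g')"
  proof -
    have "inv g' \<otimes> (g' \<otimes> z) = z" if "z \<in> carrier G" for z
      using w(2) that by (simp flip: m_assoc)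
    then show ?thesis using w(1,2) n nc kc by (simp add: m_assoc)
  qed
  moreover have "g' \<otimes> n \<otimes> inv g' \<in> N" by (rule normal.inv_op_closed2[OF N_normal w(2) n(1)])
  ultimately have "w \<in> kap (g' \<otimes> k \<otimes> inv g')" unfolding kap_def r_coset_def by blast
  then show "w \<in> kap ?y" unfolding eq .
next
  let ?y = "g \<otimes> k \<otimes> inv g"
  fix w assume "w \<in> kap ?y"
  then obtain n where n: "n \<in> N" "w = n \<otimes> ?y" by (auto simp: kap_def r_coset_def)
  have nc: "n \<in> carrier G" using n(1) N_K K_carrier by blast
  have kc: "k \<in> carrier G" using k K_carrier by blast
  have "inv g \<otimes> n \<otimes> g \<in> N" by (rule normal.inv_op_closed1[OF N_normal g(1) n(1)])
  then have "(inv g \<otimes> n \<otimes> g) \<otimes> k \<in> kap k" unfolding kap_def r_coset_def by blast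
  moreover have "w = g \<otimes> ((inv g \<otimes> n \<otimes> g) \<otimes> k) \<otimes> inv g"
  proof -
    have "g \<otimes> (inv g \<otimes> z) = z" if "z \<in> carrier G" for z
      using g(1) that by (simp flip: m_assoc)
    then show ?thesis using n(2) nc kc g(1) by (simp add: m_assoc)
  qed
  ultimately show "w \<in> conj_action G \<phi> i (kap k)" unfolding conj_action_def using g by blast
qed

abbreviation T :: "int \<Rightarrow> 'g set \<Rightarrow> 'g set" where "T i \<equiv> conj_action G \<phi> i"

lemma T_kap: "k \<in> K \<Longrightarrow> T i (kap k) = kap (t0 [^] i \<otimes> k \<otimes> inv (t0 [^] i))"
  by (rule conj_kap) (simp_all add: t0 phi_pow)

lemma T_closed: "Y \<in> carrier B \<Longrightarrow> T i Y \<in> carrier B"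
  unfolding B_carrier by (auto simp: T_kap intro!: imageI K_closed(4) t0)

lemma T_0: "Y \<in> carrier B \<Longrightarrow> T 0 Y = Y"
  unfolding B_carrier by (auto simp: T_kap K_carrier)

lemma T_mult:
  assumes "Y \<in> carrier B" "Z \<in> carrier B"
  shows "T i (Y \<otimes>\<^bsub>B\<^esub> Z) = T i Y \<otimes>\<^bsub>B\<^esub> T i Z"
proof -
  obtain a b where a: "Y = kap a" "a \<in> K" and b: "Z = kap b" "b \<in> K" using assms unfolding B_carrier by blast
  let ?g = "t0 [^] i"
  have g: "?g \<in> carrier G" by (simp add: t0)
  have "inv ?g \<otimes> (?g \<otimes> z) = z" if "z \<in> carrier G" for z
    using g that by (simp flip: m_assoc)
  then have "(?g \<otimes> a \<otimes> inv ?g) \<otimes> (?g \<otimes> b \<otimes> inv ?g) = ?g \<otimes> (a \<otimes> b) \<otimes> inv ?g"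
    using g K_carrier[OF a(2)] K_carrier[OF b(2)] by (simp add: m_assoc)
  then show ?thesis
    using a b by (simp add: B_kap_mult T_kap K_closed g)
qed

lemma T_group_hom: "group_hom B B (T i)"
  by unfold_locales (auto intro!: homI simp: T_closed T_mult)

abbreviation "Bmod \<equiv> alexander_invariant G \<phi>"

lemma Bmod_tpow: "Y \<in> carrier B \<Longrightarrow> tpow i \<odot>\<^bsub>Bmod\<^esub> Y = T i Y"
  by (simp add: alexander_invariant_def T_closed B.finprod_insert)

lemma Bmod_lconst: "Y \<in> carrier B \<Longrightarrow> lconst n \<odot>\<^bsub>Bmod\<^esub> Y = Y [^]\<^bsub>B\<^esub> n"
  by (cases "n = 0") (simp_all add: alexander_invariant_def T_0 B.finprod_insert)

lemma Bmod_simps: "carrier Bmod = carrier B" "\<zero>\<^bsub>Bmod\<^esub> = \<one>\<^bsub>B\<^esub>" "Y \<oplus>\<^bsub>Bmod\<^esub> Z = Y \<otimes>\<^bsub>B\<^esub> Z"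
  by (simp_all add: alexander_invariant_def)


section \<open>Homomorphisms out of the complexified Alexander invariant\<close>

abbreviation "BC \<equiv> complexified_module Bmod"

definition bc_rel :: "(('g set \<times> complex) \<Rightarrow>\<^sub>0 int) set" where
  "bc_rel = tensor_relators (class_ring :: int ring) (\<lambda>b k. lconst k \<odot>\<^bsub>Bmod\<^esub> b) Bmod complex_int_module"

definition bc_sub :: "(('g set \<times> complex) \<Rightarrow>\<^sub>0 int) set" where
  "bc_sub = generate (free_Abelian_group (carrier B \<times> UNIV)) bc_rel"

abbreviation "bcls \<equiv> cls bc_sub"

lemma bc_rel_cases [consumes 1, case_names add_left add_right balanced]:
  assumes "c \<in> bc_rel"
    and "\<And>Y Z v. Y \<in> carrier B \<Longrightarrow> Z \<in> carrier B \<Longrightarrow>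
      c = frag_of (Y \<otimes>\<^bsub>B\<^esub> Z, v) - frag_of (Y, v) - frag_of (Z, v) \<Longrightarrow> Q"
    and "\<And>Y v w. Y \<in> carrier B \<Longrightarrow> c = frag_of (Y, v + w) - frag_of (Y, v) - frag_of (Y, w) \<Longrightarrow> Q"
    and "\<And>Y n v. Y \<in> carrier B \<Longrightarrow> c = frag_of (Y [^]\<^bsub>B\<^esub> n, v) - frag_of (Y, of_int n * v) \<Longrightarrow> Q"
  shows Q
  using assms(1) unfolding bc_rel_def tensor_relators_def Un_iff mem_Collect_eq Bmod_simps
proof (elim disjE exE conjE, goal_cases)
  case (1 Y Z v)
  show Q by (rule assms(2)[OF 1(2,3,1)])
next
  case (2 Y v w)
  then show Q by (intro assms(3)[of Y v w]) (simp_all add: complex_int_module_def)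
next
  case (3 Y n v)
  then show Q by (intro assms(4)[of Y n v]) (simp_all add: complex_int_module_def Bmod_lconst)
qed

lemma bc_relI:
  shows "Y \<in> carrier B \<Longrightarrow> Z \<in> carrier B \<Longrightarrow> frag_of (Y \<otimes>\<^bsub>B\<^esub> Z, v) - frag_of (Y, v) - frag_of (Z, v) \<in> bc_sub"
    and "Y \<in> carrier B \<Longrightarrow> frag_of (Y, v + w) - frag_of (Y, v) - frag_of (Y, w) \<in> bc_sub"
    and "Y \<in> carrier B \<Longrightarrow> frag_of (Y [^]\<^bsub>B\<^esub> n, v) - frag_of (Y, of_int n * v) \<in> bc_sub"
proof -
  show "frag_of (Y \<otimes>\<^bsub>B\<^esub> Z, v) - frag_of (Y, v) - frag_of (Z, v) \<in> bc_sub" if "Y \<in> carrier B" "Z \<in> carrier B"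
    unfolding bc_sub_def
    by (rule generate.incl, unfold bc_rel_def tensor_relators_def Bmod_simps)
      (intro UnI1 CollectI exI conjI, rule refl, use that in \<open>simp_all add: complex_int_module_def\<close>)
  show "frag_of (Y, v + w) - frag_of (Y, v) - frag_of (Y, w) \<in> bc_sub" if "Y \<in> carrier B"
    unfolding bc_sub_def
    by (rule generate.incl, unfold bc_rel_def tensor_relators_def Bmod_simps)
      (rule UnI1, rule UnI2, intro CollectI exI[of _ Y] exI[of _ v] exI[of _ w] conjI,
       use that in \<open>simp_all add: complex_int_module_def\<close>)
  show "frag_of (Y [^]\<^bsub>B\<^esub> n, v) - frag_of (Y, of_int n * v) \<in> bc_sub" if "Y \<in> carrier B"
    unfolding bc_sub_def
    by (rule generate.incl, unfold bc_rel_def tensor_relators_def Bmod_simps)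
      (rule UnI2, intro CollectI exI[of _ Y] exI[of _ n] exI[of _ v] conjI,
       use that in \<open>simp_all add: complex_int_module_def Bmod_lconst\<close>)
qed

lemma bc_rel_keys: "c \<in> bc_rel \<Longrightarrow> Poly_Mapping.keys c \<subseteq> carrier B \<times> UNIV"
  by (erule bc_rel_cases; hypsubst; intro keys_diff3) auto

sublocale bc_sub: add_subgroup bc_sub
  unfolding bc_sub_def by (rule generate_free_Abelian_subgroup) (rule bc_rel_keys)

definition bc_scale :: "(int \<Rightarrow>\<^sub>0 complex) \<Rightarrow> (('g set \<times> complex) \<Rightarrow>\<^sub>0 int) \<Rightarrow> ('g set \<times> complex) \<Rightarrow>\<^sub>0 int" where
  "bc_scale p = frag_extend
    (\<lambda>(Y, v). \<Sum>i\<in>Poly_Mapping.keys p. frag_of (tpow i \<odot>\<^bsub>Bmod\<^esub> Y, Poly_Mapping.lookup p i * v))"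

lemma bc_scale_frag_of: "Y \<in> carrier B \<Longrightarrow>
    bc_scale p (frag_of (Y, v)) = (\<Sum>i\<in>Poly_Mapping.keys p. frag_of (T i Y, Poly_Mapping.lookup p i * v))"
  by (simp add: bc_scale_def Bmod_tpow)

lemma bc_scale_simps [simp]: "bc_scale p (c - d) = bc_scale p c - bc_scale p d" "bc_scale p 0 = 0"
  by (simp_all add: bc_scale_def frag_extend_diff)

lemma bc_sub_sum: "(\<And>i. i \<in> I \<Longrightarrow> c i \<in> bc_sub) \<Longrightarrow> (\<Sum>i\<in>I. c i) \<in> bc_sub"
  by (induction I rule: infinite_finite_induct) (simp_all add: bc_sub.zero_mem bc_sub.add_mem)

lemma bc_scale_bc_sub: "c \<in> bc_sub \<Longrightarrow> bc_scale p c \<in> bc_sub"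
  unfolding bc_sub_def
proof (induction rule: generate_free_Abelian_induct)
  case (relator c)
  have "bc_scale p c \<in> bc_sub"
    using relator
  proof (cases rule: bc_rel_cases)
    case (add_left Y Z v)
    then have "bc_scale p c = (\<Sum>i\<in>Poly_Mapping.keys p. frag_of (T i Y \<otimes>\<^bsub>B\<^esub> T i Z, Poly_Mapping.lookup p i * v)
      - frag_of (T i Y, Poly_Mapping.lookup p i * v) - frag_of (T i Z, Poly_Mapping.lookup p i * v))"
      by (simp add: bc_scale_frag_of T_mult sum_subtractf)
    also have "\<dots> \<in> bc_sub" by (intro bc_sub_sum bc_relI T_closed add_left)
    finally show ?thesis .
  next
    case (add_right Y v w)
    then have "bc_scale p c = (\<Sum>i\<in>Poly_Mapping.keys p. frag_of (T i Y, Poly_Mapping.lookup p i * v + Poly_Mapping.lookup p i * w)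
      - frag_of (T i Y, Poly_Mapping.lookup p i * v) - frag_of (T i Y, Poly_Mapping.lookup p i * w))"
      by (simp add: bc_scale_frag_of sum_subtractf distrib_left)
    also have "\<dots> \<in> bc_sub" by (intro bc_sub_sum bc_relI T_closed add_right)
    finally show ?thesis .
  next
    case (balanced Y n v)
    have pow: "T i (Y [^]\<^bsub>B\<^esub> n) = T i Y [^]\<^bsub>B\<^esub> n" for i
      by (rule group_hom.hom_int_pow[OF T_group_hom balanced(1)])
    have "bc_scale p c = (\<Sum>i\<in>Poly_Mapping.keys p. frag_of (T i Y [^]\<^bsub>B\<^esub> n, Poly_Mapping.lookup p i * v)
      - frag_of (T i Y, of_int n * (Poly_Mapping.lookup p i * v)))"
      using balanced by (simp add: bc_scale_frag_of sum_subtractf pow mult.left_commute)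
    also have "\<dots> \<in> bc_sub" by (intro bc_sub_sum bc_relI T_closed balanced)
    finally show ?thesis .
  qed
  then show ?case using bc_rel_keys[OF relator] by (simp add: bc_sub_def)
next
  case zero
  then show ?case using bc_sub.zero_mem by (simp add: bc_sub_def)
next
  case (diff c d)
  then show ?case using bc_sub.diff_mem[of "bc_scale p c" "bc_scale p d"] by (simp add: bc_sub_def)
qed

lemma BC_def: "BC = quot_module
  \<lparr>carrier = carrier (free_Abelian_group (carrier B \<times> UNIV)), monoid.mult = undefined, one = undefined,
   zero = 0, add = (+), module.smult = bc_scale\<rparr> bc_sub"
proof -
  have "carrier complex_int_module = UNIV" by (simp add: complex_int_module_def)
  moreover have "frag_extend ((\<lambda>p (b, c). \<Sum>i\<in>Poly_Mapping.keys p. frag_of (tpow i \<odot>\<^bsub>Bmod\<^esub> b, Poly_Mapping.lookup p i * c)) r) = bc_scale r" for r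
    by (simp add: bc_scale_def)
  ultimately show ?thesis
    unfolding complexified_module_def tensor_module_def Bmod_simps bc_sub_def bc_rel_def by simp
qed

lemma BC_carrier: "carrier BC = bcls ` {c. Poly_Mapping.keys c \<subseteq> carrier B \<times> UNIV}"
  unfolding BC_def by (subst quot_module_carrier) (auto simp: free_Abelian_group_def)

lemma BC_add: "bcls c \<oplus>\<^bsub>BC\<^esub> bcls d = bcls (c + d)"
  unfolding BC_def by (rule bc_sub.quot_module_add) simp

lemma BC_smult: "p \<odot>\<^bsub>BC\<^esub> bcls c = bcls (bc_scale p c)"
  unfolding BC_def
  by (subst bc_sub.quot_module_smult) (use bc_scale_bc_sub[of _ p] in \<open>auto simp flip: bc_scale_simps(1)\<close>)

lemma BC_mem: "Poly_Mapping.keys c \<subseteq> carrier B \<times> UNIV \<Longrightarrow> bcls c \<in> carrier BC"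
  unfolding BC_carrier by blast

lemma keys_bc_scale: 
  assumes "Poly_Mapping.keys c \<subseteq> carrier B \<times> UNIV"
  shows "Poly_Mapping.keys (bc_scale p c) \<subseteq> carrier B \<times> UNIV"
proof -
  have "Poly_Mapping.keys (\<Sum>i\<in>Poly_Mapping.keys p. frag_of (tpow i \<odot>\<^bsub>Bmod\<^esub> Y, Poly_Mapping.lookup p i * v)) \<subseteq> carrier B \<times> UNIV"
    if "Y \<in> carrier B" for Y v
  proof (rule order_trans[OF Poly_Mapping.keys_sum], rule UN_least)
    fix i
    show "Poly_Mapping.keys (frag_of (tpow i \<odot>\<^bsub>Bmod\<^esub> Y, Poly_Mapping.lookup p i * v)) \<subseteq> carrier B \<times> UNIV"
      unfolding keys_frag_of Bmod_tpow[OF that] using T_closed[OF that, of i] by simp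
  qed
  note sum = this
  show ?thesis
    unfolding bc_scale_def
  proof (rule order_trans[OF keys_frag_extend], rule UN_least)
    fix x assume "x \<in> Poly_Mapping.keys c"
    then obtain Y v where "x = (Y, v)" "Y \<in> carrier B" using assms by blast
    then show "Poly_Mapping.keys (case x of (Y, v) \<Rightarrow> \<Sum>i\<in>Poly_Mapping.keys p. frag_of (tpow i \<odot>\<^bsub>Bmod\<^esub> Y, Poly_Mapping.lookup p i * v))
      \<subseteq> carrier B \<times> UNIV"
      using sum[of Y v] by simp
  qed
qed

lemma BC_smult_closed: "Y \<in> carrier BC \<Longrightarrow> p \<odot>\<^bsub>BC\<^esub> Y \<in> carrier BC"
  unfolding BC_carrier by (auto simp: BC_smult intro!: imageI keys_bc_scale)

definition ten :: "'g \<Rightarrow> complex \<Rightarrow> (('g set \<times> complex) \<Rightarrow>\<^sub>0 int) set" where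
  "ten k v = bcls (frag_of (kap k, v))"

lemma ten_mem: "k \<in> K \<Longrightarrow> ten k v \<in> carrier BC"
  unfolding ten_def by (rule BC_mem) (auto simp: keys_frag_of B_carrier)

lemma kap_mem: "k \<in> K \<Longrightarrow> kap k \<in> carrier B"
  by (simp add: B_carrier)

lemma ten_mult:
  assumes "a \<in> K" "b \<in> K"
  shows "ten (a \<otimes> b) v = ten a v \<oplus>\<^bsub>BC\<^esub> ten b v"
  unfolding ten_def BC_add bc_sub.cls_eq_iff
  using bc_relI(1)[OF kap_mem[OF assms(1)] kap_mem[OF assms(2)], of v]
  by (simp add: B_kap_mult assms diff_diff_eq)

lemma tpow_ten:
  assumes "k \<in> K" "g \<in> carrier G" "\<phi> g = i"
  shows "tpow i \<odot>\<^bsub>BC\<^esub> ten k v = ten (g \<otimes> k \<otimes> inv g) v"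
  unfolding ten_def BC_smult using assms by (simp add: bc_scale_frag_of kap_mem conj_kap[OF assms(2,3)])

lemma lconst_ten:
  assumes "k \<in> K"
  shows "lconst c \<odot>\<^bsub>BC\<^esub> ten k 1 = ten k c"
proof (cases "c = 0")
  case False
  then show ?thesis
    unfolding ten_def BC_smult using assms by (simp add: bc_scale_frag_of kap_mem T_0)
next
  case True
  have "0 - frag_of (kap k, 0) \<in> bc_sub"
    using bc_relI(2)[OF kap_mem[OF assms], of 0 0] by simp
  then show ?thesis
    unfolding ten_def BC_smult bc_sub.cls_eq_iff using assms True by (simp add: bc_scale_frag_of kap_mem)
qed

definition bc_hom :: "((int \<Rightarrow>\<^sub>0 complex) \<Rightarrow> 'r::comm_ring_1) \<Rightarrow> ((('g set \<times> complex) \<Rightarrow>\<^sub>0 int) set \<Rightarrow> 'r) \<Rightarrow> bool" where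
  "bc_hom \<chi> f \<longleftrightarrow> (\<forall>a\<in>carrier BC. \<forall>b\<in>carrier BC. f (a \<oplus>\<^bsub>BC\<^esub> b) = f a + f b) \<and>
     (\<forall>p. \<forall>a\<in>carrier BC. f (p \<odot>\<^bsub>BC\<^esub> a) = \<chi> p * f a)"

lemma bc_hom_eq_0:
  assumes f: "bc_hom \<chi> f" and 0: "\<And>k. k \<in> K \<Longrightarrow> f (ten k 1) = 0" and Y: "Y \<in> carrier BC"
  shows "f Y = 0"
proof -
  have add: "f (bcls (c + d)) = f (bcls c) + f (bcls d)"
    if "Poly_Mapping.keys c \<subseteq> carrier B \<times> UNIV" "Poly_Mapping.keys d \<subseteq> carrier B \<times> UNIV" for c d
    using f BC_mem[OF that(1)] BC_mem[OF that(2)] by (simp add: bc_hom_def flip: BC_add)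
  have "f (bcls c) = 0" if "Poly_Mapping.keys c \<subseteq> carrier B \<times> UNIV" for c
  proof -
    have "Poly_Mapping.keys c \<subseteq> carrier B \<times> UNIV \<and> f (bcls c) = 0"
      using that
    proof (induction c rule: frag_induction)
      case zero
      show ?case using add[of 0 0] by simp
    next
      case (one Yv)
      then obtain Y v where Y: "Yv = (Y, v)" "Y \<in> carrier B" by (elim SigmaE)
      then obtain k where k': "Y = kap k" "k \<in> K" unfolding B_carrier by (elim imageE)
      then have k: "Yv = (kap k, v)" "k \<in> K" using Y by simp_all
      have "f (lconst v \<odot>\<^bsub>BC\<^esub> ten k 1) = \<chi> (lconst v) * f (ten k 1)"
        using f ten_mem[OF k(2), of 1] unfolding bc_hom_def by blast
      then have "f (ten k v) = \<chi> (lconst v) * f (ten k 1)"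
        unfolding lconst_ten[OF k(2)] .
      then show ?case using 0[OF k(2)] k by (simp add: ten_def keys_frag_of kap_mem)
    next
      case (diff c d)
      have "Poly_Mapping.keys (c - d) \<subseteq> carrier B \<times> UNIV" using keys_diff[of c d] diff.IH by blast
      then show ?case using add[of "c - d" d] diff.IH by simp
    qed
    then show ?thesis ..
  qed
  then show ?thesis using Y by (auto simp: BC_carrier)
qed

text \<open>The choice of \<open>t\<^sub>0\<close> splits \<open>\<phi>\<close>, so that \<open>G\<close> is a semidirect product of \<open>K\<close> and an infinite cyclic
  group; this is the \<open>K\<close>-component.\<close>

definition retract :: "'g \<Rightarrow> 'g" where "retract g = g \<otimes> t0 [^] (- \<phi> g)"

lemma retract_K: "g \<in> carrier G \<Longrightarrow> retract g \<in> K"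
  by (simp add: retract_def K_def phi_mult phi_pow t0)

lemma retract_kernel: "k \<in> K \<Longrightarrow> retract k = k"
  by (simp add: retract_def K_def)

lemma retract_t0: "retract t0 = \<one>"
  by (simp add: retract_def t0 int_pow_neg)

lemma retract_mult:
  assumes g: "g \<in> carrier G" "h \<in> carrier G"
  shows "retract (g \<otimes> h) = retract g \<otimes> (t0 [^] \<phi> g \<otimes> retract h \<otimes> inv (t0 [^] \<phi> g))"
proof -
  let ?a = "t0 [^] \<phi> g" and ?b = "t0 [^] \<phi> h"
  have ab: "?a \<in> carrier G" "?b \<in> carrier G" using t0 by simp_all
  have "- \<phi> (g \<otimes> h) = - \<phi> h + - \<phi> g" unfolding phi_mult[OF g] by simp
  then have "t0 [^] (- \<phi> (g \<otimes> h)) = t0 [^] (- \<phi> h + - \<phi> g)" by (rule arg_cong)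
  also have "\<dots> = t0 [^] (- \<phi> h) \<otimes> t0 [^] (- \<phi> g)" by (rule int_pow_mult[OF t0(1)])
  also have "\<dots> = inv ?b \<otimes> inv ?a" unfolding int_pow_neg[OF t0(1)] ..
  finally have 1: "t0 [^] (- \<phi> (g \<otimes> h)) = inv ?b \<otimes> inv ?a" .
  show ?thesis
    unfolding retract_def 1 unfolding int_pow_neg[OF t0(1)] by (rule conj_rearrange[OF g ab])
qed

text \<open>A homomorphism on \<open>K\<close> that is equivariant for conjugation extends to a crossed homomorphism on the
  semidirect product that vanishes at \<open>t\<^sub>0\<close>.\<close>

lemma crossed_hom_of_bc_hom:
  assumes f: "bc_hom \<chi> f"
  shows "crossed_hom G (\<lambda>g. \<chi> (tpow (\<phi> g))) (\<lambda>g. f (ten (retract g) 1))"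
  unfolding crossed_hom_def
proof (intro ballI)
  fix g h assume gh: "g \<in> carrier G" "h \<in> carrier G"
  let ?y = "t0 [^] \<phi> g \<otimes> retract h \<otimes> inv (t0 [^] \<phi> g)"
  have y: "?y \<in> K" using retract_K[OF gh(2)] by (intro K_closed(4)) (simp_all add: t0)
  have "ten ?y 1 = tpow (\<phi> g) \<odot>\<^bsub>BC\<^esub> ten (retract h) 1"
    using retract_K[OF gh(2)] by (simp add: tpow_ten[of _ "t0 [^] \<phi> g"] t0 phi_pow)
  then show "f (ten (retract (g \<otimes> h)) 1) = f (ten (retract g) 1) + \<chi> (tpow (\<phi> g)) * f (ten (retract h) 1)"
    using f ten_mem[OF y, of 1] ten_mem[OF retract_K[OF gh(1)], of 1] ten_mem[OF retract_K[OF gh(2)], of 1]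
    by (simp add: retract_mult gh ten_mult[OF retract_K[OF gh(1)] y] bc_hom_def)
qed

text \<open>On \<open>K\<close> the character is trivial, so a crossed homomorphism restricts to a homomorphism there, which
  factors through the abelianization; the crossed product rule makes it equivariant for conjugation.\<close>

lemma bc_hom_of_crossed_hom:
  fixes \<chi> :: "(int \<Rightarrow>\<^sub>0 complex) \<Rightarrow> 'r::comm_ring_1"
  assumes \<chi>: "comm_ring_hom \<chi>" and D: "crossed_hom G (\<lambda>g. \<chi> (tpow (\<phi> g))) D"
  shows "\<exists>f. bc_hom \<chi> f \<and> (\<forall>k\<in>K. \<forall>v. f (ten k v) = \<chi> (lconst v) * D k)"
proof -
  interpret \<chi>: comm_ring_hom \<chi> by fact
  let ?\<rho> = "\<lambda>g. \<chi> (tpow (\<phi> g))"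
  have D_mult: "D (g \<otimes> h) = D g + ?\<rho> g * D h" if "g \<in> carrier G" "h \<in> carrier G" for g h
    using D that by (simp add: crossed_hom_def)
  have rho_K: "?\<rho> k = 1" if "k \<in> K" for k using that by (simp add: K_def)
  have D_K: "D (a \<otimes> b) = D a + D b" if "a \<in> K" "b \<in> K" for a b
    using D_mult[of a b] rho_K[OF that(1)] that K_carrier by simp
  have D_one: "D \<one> = 0" using D_K[OF K_closed(1) K_closed(1)] by simp
  have D_inv: "D (inv a) = - D a" if "a \<in> K" for a
    using D_K[OF that K_closed(3)[OF that]] that D_one by (simp add: K_carrier eq_neg_iff_add_eq_0 add.commute)
  have "n \<in> K \<and> D n = 0" if "n \<in> N" for n
    using that unfolding N_def derived_def
  proof (induction rule: generate.induct)
    case one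
    then show ?case using D_one K_closed by simp
  next
    case (incl h)
    then obtain a b where ab: "a \<in> K" "b \<in> K" "h = a \<otimes> b \<otimes> inv a \<otimes> inv b" by blast
    then show ?case by (simp add: K_closed D_K D_inv)
  next
    case (inv h)
    then obtain a b where ab: "a \<in> K" "b \<in> K" "h = a \<otimes> b \<otimes> inv a \<otimes> inv b" by blast
    then have "h \<in> K" "D h = 0" by (simp_all add: K_closed D_K D_inv)
    then show ?case using K_closed(3)[of h] D_inv[of h] by simp
  next
    case (eng h1 h2)
    then show ?case by (simp add: K_closed D_K)
  qed
  then have D_N: "D n = 0" if "n \<in> N" for n using that by blast
  have D_kap: "D a = D b" if "a \<in> K" "b \<in> K" "kap a = kap b" for a b
    using D_N[OF kap_eqD[OF that]] D_K[OF that(1) K_closed(3)[OF that(2)]] D_inv[OF that(2)] by simp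
  define F where "F Y = D (SOME k. k \<in> K \<and> kap k = Y)" for Y
  have F: "F (kap k) = D k" if "k \<in> K" for k
  proof -
    have "(SOME a. a \<in> K \<and> kap a = kap k) \<in> K \<and> kap (SOME a. a \<in> K \<and> kap a = kap k) = kap k"
      by (rule someI[of _ k]) (simp add: that)
    then show ?thesis unfolding F_def using D_kap that by blast
  qed
  have F_mult: "F (Y \<otimes>\<^bsub>B\<^esub> Z) = F Y + F Z" if "Y \<in> carrier B" "Z \<in> carrier B" for Y Z
    using that unfolding B_carrier by (auto simp: B_kap_mult F D_K K_closed)
  have F_one: "F \<one>\<^bsub>B\<^esub> = 0" using F_mult[OF B.one_closed B.one_closed] by simp
  have F_inv: "F (inv\<^bsub>B\<^esub> Y) = - F Y" if "Y \<in> carrier B" for Y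
    using F_mult[OF that B.inv_closed[OF that]] F_one that by (simp add: eq_neg_iff_add_eq_0 add.commute)
  have F_nat_pow: "F (Y [^]\<^bsub>B\<^esub> n) = of_nat n * F Y" if "Y \<in> carrier B" for Y and n :: nat
    using that by (induction n) (simp_all add: F_one F_mult distrib_right)
  have F_pow: "F (Y [^]\<^bsub>B\<^esub> n) = of_int n * F Y" if "Y \<in> carrier B" for Y and n :: int
  proof (cases "n < 0")
    case True
    have "F (Y [^]\<^bsub>B\<^esub> n) = F (inv\<^bsub>B\<^esub> (Y [^]\<^bsub>B\<^esub> nat (- n)))"
      unfolding int_pow_def2 if_P[OF True] ..
    also have "\<dots> = - (of_nat (nat (- n)) * F Y)"
      unfolding F_inv[OF B.nat_pow_closed[OF that]] F_nat_pow[OF that] ..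
    also have "of_nat (nat (- n)) = (of_int (- n) :: 'r)"
      by (rule of_nat_nat) (use True in simp)
    finally show ?thesis by simp
  next
    case False
    have "F (Y [^]\<^bsub>B\<^esub> n) = of_nat (nat n) * F Y"
      unfolding int_pow_def2 if_not_P[OF False] F_nat_pow[OF that] ..
    also have "of_nat (nat n) = (of_int n :: 'r)"
      by (rule of_nat_nat) (use False in simp)
    finally show ?thesis .
  qed
  have F_T: "F (T i Y) = \<chi> (tpow i) * F Y" if Y: "Y \<in> carrier B" for i Y
  proof -
    obtain k where k: "Y = kap k" "k \<in> K" using Y unfolding B_carrier by blast
    let ?g = "t0 [^] i"
    have g: "?g \<in> carrier G" "inv ?g \<in> carrier G" "\<phi> ?g = i" using t0 by (simp_all add: phi_pow)
    have kc: "k \<in> carrier G" using k(2) by (rule K_carrier)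
    have "D (?g \<otimes> k \<otimes> inv ?g) = D (?g \<otimes> k) + ?\<rho> (?g \<otimes> k) * D (inv ?g)"
      by (rule D_mult) (use g kc in auto)
    also have "?\<rho> (?g \<otimes> k) = ?\<rho> ?g" using g kc k(2) by (simp add: phi_mult K_def)
    also have "D (?g \<otimes> k) = D ?g + ?\<rho> ?g * D k" using g kc by (simp add: D_mult)
    finally have "D (?g \<otimes> k \<otimes> inv ?g) = ?\<rho> ?g * D k + (D ?g + ?\<rho> ?g * D (inv ?g))" by (simp add: add_ac)
    also have "D ?g + ?\<rho> ?g * D (inv ?g) = 0" using D_mult[OF g(1,2)] g D_one by simp
    finally show ?thesis
      using k g by (simp add: T_kap F K_closed)
  qed
  define \<beta> where "\<beta> = (\<lambda>(Y, v). \<chi> (lconst v) * F Y)"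
  have \<beta>: "\<beta> (Y, v) = \<chi> (lconst v) * F Y" for Y v by (simp add: \<beta>_def)
  have lc_add: "\<chi> (lconst (v + w)) = \<chi> (lconst v) + \<chi> (lconst w)" for v w
    by (simp add: single_add \<chi>.hom_add)
  have lc_int: "\<chi> (lconst (of_int n * v)) = of_int n * \<chi> (lconst v)" for n v
  proof -
    have "lconst (of_int n * v) = of_int n * lconst v" by (simp add: mult_single flip: single_of_int)
    then show ?thesis by (simp add: \<chi>.hom_mult \<chi>.hom_of_int)
  qed
  have kill: "zext \<beta> c = 0" if "c \<in> bc_sub" for c
    using that unfolding bc_sub_def
  proof (induction rule: generate_free_Abelian_induct)
    case (relator c)
    then have "zext \<beta> c = 0"
    proof (cases rule: bc_rel_cases)
      case (add_left Y Z v)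
      then show ?thesis by (simp add: zext_simps(2) \<beta> F_mult distrib_left)
    next
      case (add_right Y v w)
      then show ?thesis by (simp add: zext_simps(2) \<beta> lc_add distrib_right)
    next
      case (balanced Y n v)
      then show ?thesis by (simp add: zext_simps(2) \<beta> F_pow lc_int)
    qed
    then show ?case using bc_rel_keys[OF relator] by simp
  qed (simp_all add: zext_simps)
  have well: "zext \<beta> c = zext \<beta> d" if "bcls c = bcls d" for c d
  proof -
    have "c - d \<in> bc_sub" using that unfolding bc_sub.cls_eq_iff .
    from kill[OF this] show ?thesis unfolding zext_simps(2) by (rule iffD2[OF eq_iff_diff_eq_0])
  qed
  define f where "f a = zext \<beta> (SOME c. bcls c = a)" for a
  have f: "f (bcls c) = zext \<beta> c" for c
    unfolding f_def by (rule well) (rule someI[of "\<lambda>d. bcls d = bcls c"], simp)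
  have expand: "\<chi> p = (\<Sum>i\<in>Poly_Mapping.keys p. \<chi> (lconst (Poly_Mapping.lookup p i)) * \<chi> (tpow i))" for p
  proof -
    have mono: "\<chi> (Poly_Mapping.single i v) = \<chi> (lconst v) * \<chi> (tpow i)" for i v
    proof -
      have "Poly_Mapping.single i v = lconst v * tpow i" by (simp add: mult_single)
      then show ?thesis by (simp only: \<chi>.hom_mult)
    qed
    have "\<chi> p = \<chi> (\<Sum>i\<in>Poly_Mapping.keys p. Poly_Mapping.single i (Poly_Mapping.lookup p i))"
      by (rule arg_cong[OF pm_sum_singles[of p], of \<chi>])
    also have "\<dots> = (\<Sum>i\<in>Poly_Mapping.keys p. \<chi> (lconst (Poly_Mapping.lookup p i)) * \<chi> (tpow i))"
      unfolding \<chi>.hom_sum by (rule sum.cong[OF refl mono])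
    finally show ?thesis .
  qed
  have f_scale: "zext \<beta> (bc_scale p c) = \<chi> p * zext \<beta> c"
    if keys: "Poly_Mapping.keys c \<subseteq> carrier B \<times> UNIV" for p c
  proof -
    have "zext \<beta> (bc_scale p c) = zext (\<lambda>x. \<chi> p * \<beta> x) c"
      unfolding bc_scale_def zext_frag_extend
    proof (rule pm_ext_cong)
      fix x assume "x \<in> Poly_Mapping.keys c"
      then obtain Y v where x: "x = (Y, v)" "Y \<in> carrier B" using keys by blast
      have lc: "\<chi> (lconst (Poly_Mapping.lookup p i * v)) = \<chi> (lconst (Poly_Mapping.lookup p i)) * \<chi> (lconst v)" for i
        by (simp add: mult_single flip: \<chi>.hom_mult)
      have "zext \<beta> (\<Sum>i\<in>Poly_Mapping.keys p. frag_of (tpow i \<odot>\<^bsub>Bmod\<^esub> Y, Poly_Mapping.lookup p i * v))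
        = (\<Sum>i\<in>Poly_Mapping.keys p. \<chi> (lconst (Poly_Mapping.lookup p i)) * \<chi> (tpow i) * (\<chi> (lconst v) * F Y))"
        unfolding pm_ext_sum[of of_int, OF of_int_add] zext_frag_of \<beta> Bmod_tpow[OF x(2)] F_T[OF x(2)] lc
        by (rule sum.cong[OF refl]) (simp only: mult_ac)
      also have "\<dots> = \<chi> p * \<beta> x"
        unfolding expand[of p] x(1) \<beta> sum_distrib_right ..
      finally show "zext \<beta> (case x of (Y, v) \<Rightarrow> \<Sum>i\<in>Poly_Mapping.keys p. frag_of (tpow i \<odot>\<^bsub>Bmod\<^esub> Y, Poly_Mapping.lookup p i * v)) = \<chi> p * \<beta> x"
        by (simp add: x(1))
    qed
    then show ?thesis by (simp only: zext_mult_left)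
  qed
  have "bc_hom \<chi> f"
    unfolding bc_hom_def
  proof (intro conjI ballI allI)
    fix a b assume "a \<in> carrier BC" "b \<in> carrier BC"
    then obtain c d where "a = bcls c" "b = bcls d" unfolding BC_carrier by (elim imageE)
    then show "f (a \<oplus>\<^bsub>BC\<^esub> b) = f a + f b" by (simp only: BC_add f zext_simps(1))
  next
    fix p a assume "a \<in> carrier BC"
    then obtain c where c: "a = bcls c" "Poly_Mapping.keys c \<subseteq> carrier B \<times> UNIV"
      unfolding BC_carrier by (elim imageE CollectE)
    show "f (p \<odot>\<^bsub>BC\<^esub> a) = \<chi> p * f a"
      unfolding c(1) BC_smult f by (rule f_scale[OF c(2)])
  qed
  moreover have "f (ten k v) = \<chi> (lconst v) * D k" if "k \<in> K" for k v
    by (simp add: ten_def f \<beta> F that)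
  ultimately show ?thesis by blast
qed

end


section \<open>Detecting the exponents of the primary decomposition\<close>

lemma PIdl_class_ring: "PIdl\<^bsub>class_ring\<^esub> a = {x * a | x. True}"
  by (auto simp: cgenideal_def)

lemma cyclic_summand_props:
  fixes z :: complex and k :: nat
  defines "J \<equiv> PIdl\<^bsub>class_ring\<^esub> ((tpow 1 - lconst z) ^ k)"
  shows "add_subgroup J" "carrier (cyclic_summand z k) = range (cls J)"
    "cls J x \<oplus>\<^bsub>cyclic_summand z k\<^esub> cls J y = cls J (x + y)"
    "p \<odot>\<^bsub>cyclic_summand z k\<^esub> cls J x = cls J (p * x)"
    "\<zero>\<^bsub>cyclic_summand z k\<^esub> = cls J 0"
proof -
  let ?a = "(tpow 1 - lconst z) ^ k :: int \<Rightarrow>\<^sub>0 complex"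
  have J: "J = {x * ?a | x. True}" unfolding J_def PIdl_class_ring ..
  show sub: "add_subgroup J"
  proof
    have "0 = 0 * ?a" by simp
    then show "0 \<in> J" unfolding J by blast
    fix x y assume "x \<in> J" "y \<in> J"
    then obtain x' y' where "x = x' * ?a" "y = y' * ?a" unfolding J by blast
    then have "x - y = (x' - y') * ?a" by (simp add: left_diff_distrib)
    then show "x - y \<in> J" unfolding J by blast
  qed
  have eq: "cyclic_summand z k = quot_module regular_module J" by (simp add: cyclic_summand_def J_def)
  have reg: "add (regular_module :: (int \<Rightarrow>\<^sub>0 complex, int \<Rightarrow>\<^sub>0 complex) module) = (+)"
    by (simp add: regular_module_def)
  show "carrier (cyclic_summand z k) = range (cls J)"
    unfolding eq quot_module_carrier[OF reg] by (simp add: regular_module_def)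
  show "cls J x \<oplus>\<^bsub>cyclic_summand z k\<^esub> cls J y = cls J (x + y)"
    unfolding eq by (rule add_subgroup.quot_module_add[OF sub reg])
  show "\<zero>\<^bsub>cyclic_summand z k\<^esub> = cls J 0"
    unfolding eq by (rule quot_module_zero)
  have "p \<odot>\<^bsub>quot_module regular_module J\<^esub> cls J x = cls J (p \<odot>\<^bsub>regular_module\<^esub> x)"
  proof (rule add_subgroup.quot_module_smult[OF sub reg])
    fix y assume "y - x \<in> J"
    then obtain x' where "y - x = x' * ?a" unfolding J by blast
    then have "p * y - p * x = (p * x') * ?a" by (simp add: mult.assoc flip: right_diff_distrib)
    then show "p \<odot>\<^bsub>regular_module\<^esub> y - p \<odot>\<^bsub>regular_module\<^esub> x \<in> J"
      unfolding J regular_module_def by auto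
  qed
  then show "p \<odot>\<^bsub>cyclic_summand z k\<^esub> cls J x = cls J (p * x)"
    unfolding eq by (simp add: regular_module_def)
qed

definition pd_index :: "nat \<Rightarrow> (nat \<Rightarrow> complex) \<Rightarrow> (nat \<Rightarrow> complex \<Rightarrow> nat) \<Rightarrow> (nat \<times> nat \<times> nat) set" where
  "pd_index s z e = {(j, k, l). j \<in> {1..s} \<and> 1 \<le> k \<and> l < e k (z j)}"

lemma pd_carrier:
  assumes "y \<in> carrier (primary_decomposition_module s z e)" "(j, k, l) \<in> pd_index s z e"
  shows "\<exists>x. y (j, k, l) = cls (PIdl\<^bsub>class_ring\<^esub> ((tpow 1 - lconst (z j)) ^ k)) x"
proof -
  have "y \<in> (\<Pi>\<^sub>E i\<in>pd_index s z e. carrier (case i of (j, k, l) \<Rightarrow> cyclic_summand (z j) k))"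
    using assms(1) by (simp add: primary_decomposition_module_def direct_sum_module_def pd_index_def)
  from PiE_mem[OF this assms(2)] have "y (j, k, l) \<in> carrier (cyclic_summand (z j) k)" by simp
  then show ?thesis unfolding cyclic_summand_props(2) by blast
qed

lemma pd_smult:
  "p \<odot>\<^bsub>primary_decomposition_module s z e\<^esub> y =
    (\<lambda>i\<in>pd_index s z e. p \<odot>\<^bsub>(case i of (j, k, l) \<Rightarrow> cyclic_summand (z j) k)\<^esub> y i)"
  by (simp add: primary_decomposition_module_def direct_sum_module_def pd_index_def)

lemma pd_add:
  "y \<oplus>\<^bsub>primary_decomposition_module s z e\<^esub> y' =
    (\<lambda>i\<in>pd_index s z e. y i \<oplus>\<^bsub>(case i of (j, k, l) \<Rightarrow> cyclic_summand (z j) k)\<^esub> y' i)"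
  by (simp add: primary_decomposition_module_def direct_sum_module_def pd_index_def)

abbreviation dual_value :: "complex \<Rightarrow> (int \<Rightarrow>\<^sub>0 complex) \<Rightarrow> dual" where
  "dual_value z \<equiv> (\<lambda>p. truncate (expansion z p))"

lemma dual_value_hom: "z \<noteq> 0 \<Longrightarrow> comm_ring_hom (dual_value z)"
proof -
  assume "z \<noteq> 0"
  interpret E: comm_ring_hom "expansion z" by (rule expansion_hom) fact
  interpret t: comm_ring_hom truncate by (rule truncate_hom)
  show ?thesis by unfold_locales (simp_all add: E.hom_add E.hom_mult t.hom_add t.hom_mult)
qed

text \<open>The product of \<open>t - z\<^sub>j\<close> with high powers of the other factors annihilates the module when
  \<open>z\<^sub>j\<close> contributes only simple summands, and at \<open>z\<^sub>j + \<epsilon>\<close> it takes the value \<open>\<epsilon>\<close> times a unit.\<close>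

lemma semisimple_imp_eps_kills:
  assumes Phi: "\<Phi> \<in> LinearCombinations.module_hom class_ring V (primary_decomposition_module s z e)"
    and inj: "inj_on \<Phi> (carrier V)"
    and closed: "\<And>p Y. Y \<in> carrier V \<Longrightarrow> p \<odot>\<^bsub>V\<^esub> Y \<in> carrier V"
    and z: "inj_on z {1..s}" and j: "j \<in> {1..s}" and zj: "z j \<noteq> 0"
    and fin: "finite {(j, k). j \<in> {1..s} \<and> 1 \<le> k \<and> e k (z j) \<noteq> 0}"
    and simple: "\<forall>k>1. e k (z j) = 0"
    and f: "\<And>p Y. Y \<in> carrier V \<Longrightarrow> f (p \<odot>\<^bsub>V\<^esub> Y) = dual_value (z j) p * f Y"
    and Y: "Y \<in> carrier V"
  shows "eps * f Y = 0"
proof -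
  let ?P = "primary_decomposition_module s z e"
  interpret chi: comm_ring_hom "dual_value (z j)" using zj by (rule dual_value_hom)
  interpret E: comm_ring_hom "expansion (z j)" using zj by (rule expansion_hom)
  let ?x = "\<lambda>i. tpow 1 - lconst (z i) :: int \<Rightarrow>\<^sub>0 complex"
  have "finite (snd ` {(j, k). j \<in> {1..s} \<and> 1 \<le> k \<and> e k (z j) \<noteq> 0})" using fin by (rule finite_imageI)
  then obtain M where M: "\<And>k. k \<in> snd ` {(j, k). j \<in> {1..s} \<and> 1 \<le> k \<and> e k (z j) \<noteq> 0} \<Longrightarrow> k \<le> M"
    by (meson finite_nat_set_iff_bounded_le)
  have bound: "k \<le> M" if "(i, k, l) \<in> pd_index s z e" for i k l
    by (rule M, rule image_eqI[of _ _ "(i, k)"]) (use that in \<open>auto simp: pd_index_def\<close>)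
  define q where "q = ?x j * (\<Prod>i\<in>{1..s} - {j}. ?x i ^ M)"
  have q_dvd: "?x i ^ k dvd q" if ik: "(i, k, l) \<in> pd_index s z e" for i k l
  proof (cases "i = j")
    case True
    then have "e k (z j) \<noteq> 0" "1 \<le> k" using ik by (auto simp: pd_index_def)
    with simple have "k = 1" by (metis le_neq_implies_less)
    then show ?thesis unfolding q_def True by simp
  next
    case False
    have "?x i ^ k dvd ?x i ^ M" by (rule le_imp_power_dvd) (rule bound[OF ik])
    also have "?x i ^ M dvd (\<Prod>i\<in>{1..s} - {j}. ?x i ^ M)"
      by (rule dvd_prodI) (use False ik in \<open>auto simp: pd_index_def\<close>)
    finally show ?thesis unfolding q_def by (rule dvd_mult)
  qed
  have q_kills: "q \<odot>\<^bsub>?P\<^esub> y = q \<odot>\<^bsub>?P\<^esub> y'" if y: "y \<in> carrier ?P" "y' \<in> carrier ?P" for y y'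
    unfolding pd_smult
  proof (rule restrict_ext)
    fix i assume i: "i \<in> pd_index s z e"
    obtain a k l where ikl: "i = (a, k, l)" by (metis prod_cases3)
    let ?J = "PIdl\<^bsub>class_ring\<^esub> (?x a ^ k)"
    have zero: "q \<odot>\<^bsub>cyclic_summand (z a) k\<^esub> cls ?J x = cls ?J 0" for x
    proof -
      have "(a, k, l) \<in> pd_index s z e" using i ikl by simp
      from q_dvd[OF this] obtain r where "q = ?x a ^ k * r" by (elim dvdE)
      then have "q * x = (r * x) * ?x a ^ k" by (simp add: mult_ac)
      then have "q * x - 0 \<in> ?J" unfolding PIdl_class_ring by auto
      then have "cls ?J (q * x) = cls ?J 0"
        by (simp only: add_subgroup.cls_eq_iff[OF cyclic_summand_props(1)])
      then show ?thesis unfolding cyclic_summand_props(4) .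
    qed
    obtain x where x: "y i = cls ?J x" using pd_carrier[OF y(1)] i unfolding ikl by blast
    obtain x' where x': "y' i = cls ?J x'" using pd_carrier[OF y(2)] i unfolding ikl by blast
    show "q \<odot>\<^bsub>(case i of (j, k, l) \<Rightarrow> cyclic_summand (z j) k)\<^esub> y i =
      q \<odot>\<^bsub>(case i of (j, k, l) \<Rightarrow> cyclic_summand (z j) k)\<^esub> y' i"
      unfolding x x' by (simp add: ikl zero)
  qed
  let ?Y0 = "0 \<odot>\<^bsub>V\<^esub> Y"
  have Y0: "?Y0 \<in> carrier V" using closed[OF Y] .
  have PhiY: "\<Phi> W \<in> carrier ?P" if "W \<in> carrier V" for W
    using LinearCombinations.module_hom_closed[OF Phi] that by blast
  have Phi_smult: "\<Phi> (p \<odot>\<^bsub>V\<^esub> W) = p \<odot>\<^bsub>?P\<^esub> \<Phi> W" if "W \<in> carrier V" for p W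
    by (rule LinearCombinations.module_hom_smult[OF Phi _ that]) simp
  have "\<Phi> (q \<odot>\<^bsub>V\<^esub> Y) = \<Phi> (q \<odot>\<^bsub>V\<^esub> ?Y0)"
    by (rule trans[OF Phi_smult[OF Y] trans[OF q_kills[OF PhiY[OF Y] PhiY[OF Y0]] Phi_smult[OF Y0, symmetric]]])
  then have "q \<odot>\<^bsub>V\<^esub> Y = q \<odot>\<^bsub>V\<^esub> ?Y0"
    by (rule inj_onD[OF inj _ closed[OF Y] closed[OF Y0]])
  then have "f (q \<odot>\<^bsub>V\<^esub> Y) = f (q \<odot>\<^bsub>V\<^esub> ?Y0)" by (rule arg_cong)
  then have "dual_value (z j) q * f Y = dual_value (z j) q * (dual_value (z j) 0 * f Y)"
    unfolding f[OF Y] f[OF Y0] .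
  then have qf: "dual_value (z j) q * f Y = 0" by (simp add: E.hom_zero truncate_def dual_eq_iff)
  have x: "expansion (z j) (?x i) = fps_const (z j - z i) + fps_X" for i
    by (rule expansion_linear_factor[OF zj])
  define c where "c = (\<Prod>i\<in>{1..s} - {j}. (z j - z i) ^ M)"
  define Q where "Q = (\<Prod>i\<in>{1..s} - {j}. (fps_const (z j - z i) + fps_X) ^ M)"
  have Eq: "expansion (z j) q = fps_X * Q"
    unfolding q_def Q_def E.hom_mult E.hom_prod E.hom_power x by simp
  have Q0: "fps_nth Q 0 = c"
  proof -
    interpret c0: comm_ring_hom "\<lambda>f :: complex fps. fps_nth f 0" by (rule fps_coeff_0_hom)
    show ?thesis unfolding Q_def c_def c0.hom_prod by (rule prod.cong) (simp_all add: c0.hom_power)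
  qed
  have "z j \<noteq> z i" if "i \<in> {1..s} - {j}" for i
    using inj_onD[OF z _ j, of i] that by (metis DiffE singletonI)
  then have "c \<noteq> 0" unfolding c_def by simp
  have val: "dual_value (z j) q = Dual 0 c"
    unfolding Eq truncate_def by (simp add: Q0)
  have "dual_re (dual_value (z j) q * f Y) = 0" "dual_eps (dual_value (z j) q * f Y) = 0"
    unfolding qf by simp_all
  then have "c * dual_re (f Y) = 0" unfolding val by simp
  then show ?thesis using \<open>c \<noteq> 0\<close> by (simp add: eps_mult_eq_0_iff)
qed

text \<open>Conversely, a summand \<open>\<Lambda> / (t - z\<^sub>j)\<^sup>k\<close> with \<open>k > 1\<close> maps onto the dual numbers.\<close>

lemma eps_detects_higher_summand:
  assumes Phi: "\<Phi> \<in> LinearCombinations.module_hom class_ring V (primary_decomposition_module s z e)"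
    and surj: "\<Phi> ` carrier V = carrier (primary_decomposition_module s z e)"
    and j: "j \<in> {1..s}" and zj: "z j \<noteq> 0" and k: "k > 1" "e k (z j) \<noteq> 0"
  shows "\<exists>f. (\<forall>a\<in>carrier V. \<forall>b\<in>carrier V. f (a \<oplus>\<^bsub>V\<^esub> b) = f a + f b) \<and>
    (\<forall>p. \<forall>a\<in>carrier V. f (p \<odot>\<^bsub>V\<^esub> a) = dual_value (z j) p * f a) \<and> (\<exists>a\<in>carrier V. f a = 1)"
proof -
  let ?P = "primary_decomposition_module s z e"
  interpret chi: comm_ring_hom "dual_value (z j)" using zj by (rule dual_value_hom)
  interpret E: comm_ring_hom "expansion (z j)" using zj by (rule expansion_hom)
  let ?x = "tpow 1 - lconst (z j) :: int \<Rightarrow>\<^sub>0 complex"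
  let ?J = "PIdl\<^bsub>class_ring\<^esub> (?x ^ k)"
  have idx: "(j, k, 0) \<in> pd_index s z e" using j k by (auto simp: pd_index_def)
  have Ex: "expansion (z j) ?x = fps_X" unfolding expansion_linear_factor[OF zj] by simp
  have "expansion (z j) (?x ^ k) = fps_X ^ k" unfolding E.hom_power Ex ..
  then have vanish: "dual_value (z j) (?x ^ k) = 0"
    using k(1) by (simp add: truncate_def dual_eq_iff)
  have well: "dual_value (z j) x = dual_value (z j) y" if xy: "cls ?J x = cls ?J y" for x y
  proof -
    have "x - y \<in> ?J" using xy unfolding add_subgroup.cls_eq_iff[OF cyclic_summand_props(1)] .
    then obtain r where r: "x - y = r * ?x ^ k" unfolding PIdl_class_ring by blast
    have "dual_value (z j) (x - y) = 0" unfolding r chi.hom_mult vanish by simp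
    then show ?thesis unfolding chi.hom_minus by simp
  qed
  define g where "g C = dual_value (z j) (SOME x. cls ?J x = C)" for C
  have g: "g (cls ?J x) = dual_value (z j) x" for x
    unfolding g_def by (rule well) (rule someI[of "\<lambda>y. cls ?J y = cls ?J x"], rule refl)
  define f where "f a = g (\<Phi> a (j, k, 0))" for a
  have comp: "\<exists>x. \<Phi> a (j, k, 0) = cls ?J x" if "a \<in> carrier V" for a
    by (rule pd_carrier[OF _ idx]) (use LinearCombinations.module_hom_closed[OF Phi] that in blast)
  have f_add: "f (a \<oplus>\<^bsub>V\<^esub> b) = f a + f b" if ab: "a \<in> carrier V" "b \<in> carrier V" for a b
  proof -
    obtain x y where xy: "\<Phi> a (j, k, 0) = cls ?J x" "\<Phi> b (j, k, 0) = cls ?J y"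
      using comp[OF ab(1)] comp[OF ab(2)] by blast
    have "\<Phi> (a \<oplus>\<^bsub>V\<^esub> b) (j, k, 0) = cls ?J (x + y)"
      unfolding LinearCombinations.module_hom_add[OF Phi ab] pd_add
      using idx by (simp add: xy cyclic_summand_props(3))
    then show ?thesis unfolding f_def xy g by (simp add: g chi.hom_add)
  qed
  have f_smult: "f (p \<odot>\<^bsub>V\<^esub> a) = dual_value (z j) p * f a" if a: "a \<in> carrier V" for p a
  proof -
    obtain x where x: "\<Phi> a (j, k, 0) = cls ?J x" using comp[OF a] by blast
    have "\<Phi> (p \<odot>\<^bsub>V\<^esub> a) = p \<odot>\<^bsub>?P\<^esub> \<Phi> a"
      by (rule LinearCombinations.module_hom_smult[OF Phi _ a]) simp
    then have "\<Phi> (p \<odot>\<^bsub>V\<^esub> a) (j, k, 0) = cls ?J (p * x)"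
      unfolding pd_smult using idx by (simp add: x cyclic_summand_props(4))
    then show ?thesis unfolding f_def x g by (simp add: g chi.hom_mult)
  qed
  let ?M = "\<lambda>i. case i of (j, k, l) \<Rightarrow> cyclic_summand (z j) k"
  define y where "y = (\<lambda>i\<in>pd_index s z e. if i = (j, k, 0) then cls ?J 1 else \<zero>\<^bsub>?M i\<^esub>)"
  have "y i \<in> carrier (?M i)" if "i \<in> pd_index s z e" for i
  proof -
    obtain a b l where i: "i = (a, b, l)" by (metis prod_cases3)
    then show ?thesis using that by (simp add: y_def cyclic_summand_props(2,5))
  qed
  moreover have "finite {i \<in> pd_index s z e. y i \<noteq> \<zero>\<^bsub>?M i\<^esub>}"
    by (rule finite_subset[of _ "{(j, k, 0)}"]) (auto simp: y_def)
  ultimately have "y \<in> carrier ?P"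
    unfolding primary_decomposition_module_def direct_sum_module_def pd_index_def[symmetric]
    by (simp add: y_def PiE_def extensional_def)
  then obtain a where a: "a \<in> carrier V" "y = \<Phi> a" unfolding surj[symmetric] by (elim imageE)
  have y1: "y (j, k, 0) = cls ?J 1" using idx by (simp add: y_def)
  have "f a = 1" unfolding f_def a(2)[symmetric] y1 g by (rule chi.hom_one)
  show ?thesis
    by (intro exI[of _ f] conjI ballI allI f_add f_smult bexI[of _ a] \<open>f a = 1\<close> a(1))
qed


section \<open>The twisted Betti number as the dimension of a kernel\<close>

text \<open>The columns of \<open>T\<close> with index in \<open>B\<close> form a basis of the kernel.\<close>

lemma kernel_adapted_basis:
  fixes N :: "'a::field mat"
  assumes ad: "kernel_adapted N T B" and N: "N \<in> carrier_mat h n"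
  shows "\<exists>u. (\<forall>k<card B. \<forall>r<h. (\<Sum>c<n. N $$ (r, c) * u k c) = 0) \<and>
    (\<forall>x. (\<forall>r<h. (\<Sum>c<n. N $$ (r, c) * x c) = 0) \<longrightarrow> (\<exists>a. \<forall>c<n. x c = (\<Sum>k<card B. a k * u k c))) \<and>
    (\<forall>a. (\<forall>c<n. (\<Sum>k<card B. a k * u k c) = 0) \<longrightarrow> (\<forall>k<card B. a k = 0))"
proof -
  have T: "T \<in> carrier_mat n n" "det T \<noteq> 0" and sub: "B \<subseteq> {..<n}"
    and ker: "\<And>c. c \<in> B \<Longrightarrow> N *\<^sub>v col T c = 0\<^sub>v h"
    using ad N unfolding kernel_adapted_def by auto
  have "finite B" using sub by (rule finite_subset) simp
  then obtain \<beta> where \<beta>: "bij_betw \<beta> {..<card B} B"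
    using ex_bij_betw_nat_finite[of B] unfolding lessThan_atLeast0 by blast
  have \<beta>_B: "\<beta> k \<in> B" if "k < card B" for k using bij_betwE[OF \<beta>] that by simp
  have \<beta>_less: "\<beta> k < n" if "k < card B" for k using \<beta>_B[OF that] sub by blast
  have reindex: "(\<Sum>k<card B. y (\<beta> k) * T $$ (c, \<beta> k)) = (\<Sum>b<n. T $$ (c, b) * y b)"
    if y: "\<And>b. b < n \<Longrightarrow> b \<notin> B \<Longrightarrow> y b = 0" for y c
  proof -
    have "(\<Sum>k<card B. y (\<beta> k) * T $$ (c, \<beta> k)) = (\<Sum>b\<in>B. y b * T $$ (c, b))"
      by (rule sum.reindex_bij_betw[OF \<beta>])
    also have "\<dots> = (\<Sum>b<n. y b * T $$ (c, b))"
      by (rule sum.mono_neutral_left) (use sub y in auto)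
    finally show ?thesis by (simp only: mult.commute)
  qed
  have basis: "(\<Sum>c<n. N $$ (r, c) * T $$ (c, \<beta> k)) = 0" if k: "k < card B" and r: "r < h" for k r
  proof -
    have "(N *\<^sub>v col T (\<beta> k)) $ r = (\<Sum>c<n. N $$ (r, c) * col T (\<beta> k) $ c)"
      by (rule mult_mat_vec_nth[OF N _ r]) (use T(1) in auto)
    also have "\<dots> = (\<Sum>c<n. N $$ (r, c) * T $$ (c, \<beta> k))"
      by (rule sum.cong) (use T(1) \<beta>_less[OF k] in auto)
    finally show ?thesis unfolding ker[OF \<beta>_B[OF k]] using r by simp
  qed
  have spans: "\<exists>a. \<forall>c<n. x c = (\<Sum>k<card B. a k * T $$ (c, \<beta> k))"
    if x: "\<forall>r<h. (\<Sum>c<n. N $$ (r, c) * x c) = 0" for x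
  proof -
    have "N *\<^sub>v vec n x = 0\<^sub>v h"
    proof (rule eq_vecI)
      fix r assume "r < dim_vec (0\<^sub>v h :: 'a vec)"
      then have r: "r < h" by simp
      have "(N *\<^sub>v vec n x) $ r = (\<Sum>c<n. N $$ (r, c) * x c)"
        unfolding mult_mat_vec_nth[OF N vec_carrier r] by (rule sum.cong) simp_all
      then show "(N *\<^sub>v vec n x) $ r = 0\<^sub>v h $ r" using x r by simp
    qed (use N in simp)
    then obtain v where v: "v \<in> carrier_vec n" "vec n x = T *\<^sub>v v" "\<And>c. c < n \<Longrightarrow> c \<notin> B \<Longrightarrow> v $ c = 0"
      by (rule kernel_adapted_coordinates[OF ad N vec_carrier]) blast
    have "x c = (\<Sum>k<card B. v $ \<beta> k * T $$ (c, \<beta> k))" if c: "c < n" for c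
    proof -
      have "x c = (T *\<^sub>v v) $ c" unfolding v(2)[symmetric] using c by simp
      also have "\<dots> = (\<Sum>b<n. T $$ (c, b) * v $ b)" by (rule mult_mat_vec_nth[OF T(1) v(1) c])
      finally show ?thesis using reindex[of "\<lambda>b. v $ b" c] v(3) by simp
    qed
    then show ?thesis by (intro exI[of _ "\<lambda>k. v $ \<beta> k"]) simp
  qed
  have indep: "a k = 0"
    if a: "\<forall>c<n. (\<Sum>k<card B. a k * T $$ (c, \<beta> k)) = 0" and k: "k < card B" for a k
  proof -
    define y where "y b = (if b \<in> B then a (the_inv_into {..<card B} \<beta> b) else 0)" for b
    have y: "y (\<beta> k) = a k" if k: "k < card B" for k
      using \<beta>_B[OF k] k the_inv_into_f_f[OF bij_betw_imp_inj_on[OF \<beta>]] by (simp add: y_def)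
    have "T *\<^sub>v vec n y = 0\<^sub>v n"
    proof (rule eq_vecI)
      fix c assume "c < dim_vec (0\<^sub>v n :: 'a vec)"
      then have c: "c < n" by simp
      have "(T *\<^sub>v vec n y) $ c = (\<Sum>b<n. T $$ (c, b) * y b)"
        unfolding mult_mat_vec_nth[OF T(1) vec_carrier c] by (rule sum.cong) simp_all
      also have "\<dots> = (\<Sum>k<card B. y (\<beta> k) * T $$ (c, \<beta> k))"
        by (rule reindex[symmetric]) (simp add: y_def)
      also have "\<dots> = (\<Sum>k<card B. a k * T $$ (c, \<beta> k))" by (rule sum.cong) (simp_all add: y)
      finally show "(T *\<^sub>v vec n y) $ c = 0\<^sub>v n $ c" using a c by simp
    qed (use T(1) in simp)
    then have "vec n y = 0\<^sub>v n"
      using T(2) unfolding det_0_iff_vec_prod_zero_field[OF T(1)] by (metis vec_carrier)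
    then have "vec n y $ \<beta> k = 0\<^sub>v n $ \<beta> k" by (rule arg_cong)
    then show ?thesis using \<beta>_less[OF k] y[OF k] by simp
  qed
  show ?thesis
  proof (intro exI[of _ "\<lambda>k c. T $$ (c, \<beta> k)"] conjI allI impI)
    fix k r assume "k < card B" "r < h"
    then show "(\<Sum>c<n. N $$ (r, c) * T $$ (c, \<beta> k)) = 0" by (rule basis)
  next
    fix x assume "\<forall>r<h. (\<Sum>c<n. N $$ (r, c) * x c) = 0"
    then show "\<exists>a. \<forall>c<n. x c = (\<Sum>k<card B. a k * T $$ (c, \<beta> k))" by (rule spans)
  next
    fix a k assume "\<forall>c<n. (\<Sum>k<card B. a k * T $$ (c, \<beta> k)) = 0" "k < card B"
    then show "a k = 0" by (rule indep)
  qed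
qed

lemma sum_insert_index:
  assumes j: "j < Suc n" and 0: "g j = (0 :: 'a::comm_monoid_add)"
  shows "(\<Sum>i<Suc n. g i) = (\<Sum>c<n. g (insert_index j c))"
proof -
  have "(\<Sum>i<Suc n. g i) = (\<Sum>i\<in>{..<Suc n} - {j}. g i)"
    by (rule sum.mono_neutral_right) (use 0 in auto)
  also have "{..<Suc n} - {j} = insert_index j ` {..<n}"
    using insert_index_image[OF j] by (simp add: lessThan_atLeast0)
  also have "(\<Sum>i\<in>insert_index j ` {..<n}. g i) = (\<Sum>c<n. g (insert_index j c))"
    by (rule sum.reindex_cong[of "insert_index j"]) (auto intro: inj_on_subset[OF insert_index_inj_on])
  finally show ?thesis .
qed

lemma (in group_to_int) char_crossed_hom:
  assumes "comm_ring_hom \<chi>"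
  shows "crossed_hom G (char \<chi>) (\<lambda>g. char \<chi> g - 1)"
proof -
  interpret comm_ring_hom \<chi> by fact
  show ?thesis
    unfolding crossed_hom_def
    by (auto simp: phi_mult hom_mult algebra_simps simp flip: tpow_mult)
qed

context presented
begin

lemma pairing_sum:
  "pairing \<chi> (\<lambda>i. (\<Sum>k<b. a k * u k i) + c * d i) v = (\<Sum>k<b. a k * pairing \<chi> (u k) v) + c * pairing \<chi> d v"
proof -
  have "pairing \<chi> (\<lambda>i. (\<Sum>k<b. a k * u k i) + c * d i) v =
    (\<Sum>i<dim_col P. (\<Sum>k<b. a k * (\<chi> (v $ i) * u k i)) + c * (\<chi> (v $ i) * d i))"
    unfolding pairing_def by (rule sum.cong) (simp_all add: distrib_left sum_distrib_left mult.left_commute)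
  also have "\<dots> = (\<Sum>i<dim_col P. \<Sum>k<b. a k * (\<chi> (v $ i) * u k i)) + c * pairing \<chi> d v"
    unfolding pairing_def sum.distrib sum_distrib_left ..
  also have "(\<Sum>i<dim_col P. \<Sum>k<b. a k * (\<chi> (v $ i) * u k i)) = (\<Sum>k<b. a k * pairing \<chi> (u k) v)"
    unfolding pairing_def sum_distrib_left by (rule sum.swap)
  finally show ?thesis .
qed

lemma kernel_vector_pairing: "kernel_vector \<chi> u \<longleftrightarrow> (\<forall>r<dim_row P. pairing \<chi> u (row P r) = 0)"
  unfolding kernel_vector_def pairing_def by simp

lemma kernel_vector_sum:
  assumes "\<And>k. k < b \<Longrightarrow> kernel_vector \<chi> (u k)" "kernel_vector \<chi> d"
  shows "kernel_vector \<chi> (\<lambda>i. (\<Sum>k<b. a k * u k i) + c * d i)"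
  using assms unfolding kernel_vector_pairing pairing_sum by simp

lemma pairing_comb: "pairing \<chi> (\<lambda>i. a * u i - c * d i) v = a * pairing \<chi> u v - c * pairing \<chi> d v"
  using pairing_sum[of \<chi> "\<lambda>_. a" "\<lambda>_. u" "Suc 0" "- c" d v] by simp

lemma kernel_vector_comb:
  "kernel_vector \<chi> u \<Longrightarrow> kernel_vector \<chi> d \<Longrightarrow> kernel_vector \<chi> (\<lambda>i. a * u i - c * d i)"
  unfolding kernel_vector_pairing pairing_comb by simp

lemma kernel_vector_unique:
  assumes \<chi>: "comm_ring_hom \<chi>" and u: "kernel_vector \<chi> u" "kernel_vector \<chi> v"
    and eq: "\<And>g. g \<in> carrier G \<Longrightarrow> crossed \<chi> u g = crossed \<chi> v g" and i: "i < dim_col P"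
  shows "u i = v i"
proof -
  have "1 * u i - 1 * v i = 0"
    by (rule kernel_vector_eq_0[OF \<chi> kernel_vector_comb[OF u, of 1 1] _ i])
      (simp only: pairing_comb eq, simp)
  then show ?thesis by simp
qed

text \<open>Crossed homomorphisms are determined by the corresponding kernel vectors, and the principal
  ones form the line spanned by \<open>d\<close>.\<close>

lemma twisted_b1_kernel_vectors:
  fixes \<chi> :: "(int \<Rightarrow>\<^sub>0 int) \<Rightarrow> complex"
  assumes \<chi>: "comm_ring_hom \<chi>"
    and d: "kernel_vector \<chi> d" "\<And>g. g \<in> carrier G \<Longrightarrow> crossed \<chi> d g = char \<chi> g - 1"
    and u: "\<And>k. k < b \<Longrightarrow> kernel_vector \<chi> (u k)"
    and spans: "\<And>v. kernel_vector \<chi> v \<Longrightarrow> \<exists>a c. \<forall>i<dim_col P. v i = (\<Sum>k<b. a k * u k i) + c * d i"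
    and indep: "\<And>a c. \<forall>i<dim_col P. (\<Sum>k<b. a k * u k i) = c * d i \<Longrightarrow> \<forall>k<b. a k = 0"
  shows "twisted_b1 G (char \<chi>) = b"
proof (rule twisted_b1_eq[where D = "\<lambda>k. crossed \<chi> (u k)"])
  show "group G" by (rule is_group)
  show "crossed_hom G (char \<chi>) (\<lambda>g. char \<chi> g - 1)" by (rule char_crossed_hom[OF \<chi>])
  show "crossed_hom G (char \<chi>) (crossed \<chi> (u k))" if "k < b" for k
    by (rule crossed_hom_of_kernel_vector[OF \<chi> u[OF that]])
next
  fix E assume "crossed_hom G (char \<chi>) E"
  from kernel_vector_of_crossed_hom[OF \<chi> this]
  obtain v where v: "kernel_vector \<chi> v" "\<And>g. g \<in> carrier G \<Longrightarrow> crossed \<chi> v g = E g" by blast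
  from spans[OF v(1)] obtain a c where ac: "\<And>i. i < dim_col P \<Longrightarrow> v i = (\<Sum>k<b. a k * u k i) + c * d i"
    by blast
  have "E g = (\<Sum>k<b. a k * crossed \<chi> (u k) g) + c * (char \<chi> g - 1)" if g: "g \<in> carrier G" for g
  proof -
    have "E g = pairing \<chi> (\<lambda>i. (\<Sum>k<b. a k * u k i) + c * d i) (lift g)"
      unfolding v(2)[OF g, symmetric] unfolding pairing_def by (rule sum.cong) (simp_all add: ac)
    then show ?thesis unfolding pairing_sum d(2)[OF g] .
  qed
  then show "\<exists>a c. \<forall>g\<in>carrier G. E g = (\<Sum>k<b. a k * crossed \<chi> (u k) g) + c * (char \<chi> g - 1)" by blast
next
  fix a c assume eq: "\<forall>g\<in>carrier G. (\<Sum>k<b. a k * crossed \<chi> (u k) g) = c * (char \<chi> g - 1)"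
  have "(\<Sum>k<b. a k * u k i) + 0 * d i = 0 * d i - (- c) * d i" if i: "i < dim_col P" for i
  proof (rule kernel_vector_unique[OF \<chi> kernel_vector_sum kernel_vector_comb _ i])
    fix g assume g: "g \<in> carrier G"
    have "(\<Sum>k<b. a k * crossed \<chi> (u k) g) = c * (char \<chi> g - 1)" using eq g by blast
    then show "crossed \<chi> (\<lambda>i. (\<Sum>k<b. a k * u k i) + 0 * d i) g = crossed \<chi> (\<lambda>i. 0 * d i - (- c) * d i) g"
      unfolding pairing_sum pairing_comb d(2)[OF g] by simp
  qed (use u d(1) in auto)
  then show "\<forall>k<b. a k = 0" by (intro indep[of a c]) simp
qed

text \<open>Subtracting a multiple of \<open>d\<close> makes the \<open>j\<close>-th coordinate vanish, so that modulo principal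
  crossed homomorphisms only the kernel of the matrix without its \<open>j\<close>-th column counts.\<close>

lemma kernel_vector_delete_col:
  fixes \<chi> :: "(int \<Rightarrow>\<^sub>0 int) \<Rightarrow> 'r::comm_ring_1"
  assumes n: "dim_col P = Suc n" and j: "j < Suc n" and "u j = 0"
  shows "kernel_vector \<chi> u \<longleftrightarrow>
    (\<forall>r<dim_row P. (\<Sum>c<n. delete_col (map_mat \<chi> P) j $$ (r, c) * u (insert_index j c)) = 0)"
proof -
  have "(\<Sum>i<dim_col P. \<chi> (P $$ (r, i)) * u i) =
    (\<Sum>c<n. delete_col (map_mat \<chi> P) j $$ (r, c) * u (insert_index j c))" if r: "r < dim_row P" for r
  proof -
    have "(\<Sum>i<dim_col P. \<chi> (P $$ (r, i)) * u i) =
      (\<Sum>c<n. \<chi> (P $$ (r, insert_index j c)) * u (insert_index j c))"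
      unfolding n by (rule sum_insert_index[OF j]) (simp add: \<open>u j = 0\<close>)
    also have "\<dots> = (\<Sum>c<n. delete_col (map_mat \<chi> P) j $$ (r, c) * u (insert_index j c))"
      by (rule sum.cong) (use r n insert_index_less in \<open>auto simp: delete_col_def\<close>)
    finally show ?thesis .
  qed
  then show ?thesis unfolding kernel_vector_def by simp
qed

lemma twisted_b1_delete_col:
  fixes \<chi> :: "(int \<Rightarrow>\<^sub>0 int) \<Rightarrow> complex"
  assumes \<chi>: "comm_ring_hom \<chi>"
    and n: "dim_col P = Suc n" and j: "j < Suc n"
    and d: "kernel_vector \<chi> d" "\<And>g. g \<in> carrier G \<Longrightarrow> crossed \<chi> d g = char \<chi> g - 1" and dj: "d j \<noteq> 0"
    and ad: "kernel_adapted (delete_col (map_mat \<chi> P) j) S Bs"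
  shows "twisted_b1 G (char \<chi>) = card Bs"
proof -
  let ?N = "delete_col (map_mat \<chi> P) j"
  have N: "?N \<in> carrier_mat (dim_row P) n" using n by (intro delete_col_carrier) auto
  obtain u where u: "\<forall>k<card Bs. \<forall>r<dim_row P. (\<Sum>c<n. ?N $$ (r, c) * u k c) = 0"
    and spans: "\<And>x. \<forall>r<dim_row P. (\<Sum>c<n. ?N $$ (r, c) * x c) = 0 \<Longrightarrow>
      \<exists>a. \<forall>c<n. x c = (\<Sum>k<card Bs. a k * u k c)"
    and indep: "\<And>a. \<forall>c<n. (\<Sum>k<card Bs. a k * u k c) = 0 \<Longrightarrow> \<forall>k<card Bs. a k = 0"
    using kernel_adapted_basis[OF ad N] by blast
  define w where "w k i = (if i = j then 0 else u k (delete_index j i))" for k i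
  have w: "w k j = 0" "w k (insert_index j c) = u k c" for k c
    by (simp_all add: w_def insert_index_exclude)
  have reach: "\<exists>c<n. i = insert_index j c" if "i < Suc n" "i \<noteq> j" for i
  proof -
    have "i \<in> insert_index j ` {0..<n}" unfolding insert_index_image[OF j] using that by simp
    then show ?thesis by auto
  qed
  show ?thesis
  proof (rule twisted_b1_kernel_vectors[OF \<chi> d])
    fix k assume "k < card Bs"
    then show "kernel_vector \<chi> (w k)"
      unfolding kernel_vector_delete_col[of n j "w k", OF n j w(1)] w(2) using u by blast
  next
    fix v assume v: "kernel_vector \<chi> v"
    define v' where "v' i = 1 * v i - v j / d j * d i" for i
    have v'j: "v' j = 0" using dj by (simp add: v'_def)
    have "kernel_vector \<chi> v'" unfolding v'_def by (rule kernel_vector_comb[OF v d(1)])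
    then have "\<forall>r<dim_row P. (\<Sum>c<n. ?N $$ (r, c) * v' (insert_index j c)) = 0"
      unfolding kernel_vector_delete_col[of n j v', OF n j v'j] .
    from spans[OF this]
    obtain a where a: "\<forall>c<n. v' (insert_index j c) = (\<Sum>k<card Bs. a k * u k c)" by (elim exE)
    have "v' i = (\<Sum>k<card Bs. a k * w k i)" if "i < Suc n" for i
    proof (cases "i = j")
      case True
      then show ?thesis using v'j w(1) by simp
    next
      case False
      from reach[OF that False] obtain c where c: "c < n" "i = insert_index j c" by (elim exE conjE)
      then show ?thesis using a[rule_format, OF c(1)] w(2) by simp
    qed
    then have "\<forall>i<dim_col P. v i = (\<Sum>k<card Bs. a k * w k i) + v j / d j * d i"
      unfolding n by (simp add: v'_def algebra_simps)
    then show "\<exists>a c. \<forall>i<dim_col P. v i = (\<Sum>k<card Bs. a k * w k i) + c * d i" by blast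
  next
    fix a c assume eq: "\<forall>i<dim_col P. (\<Sum>k<card Bs. a k * w k i) = c * d i"
    have "(\<Sum>k<card Bs. a k * w k j) = c * d j" using eq n j by simp
    then have "c = 0" using dj by (simp add: w(1))
    have "(\<Sum>k<card Bs. a k * u k c') = 0" if "c' < n" for c'
    proof -
      have "(\<Sum>k<card Bs. a k * w k (insert_index j c')) = c * d (insert_index j c')"
        using eq n insert_index_less[OF that] by simp
      then show ?thesis by (simp add: w(2) \<open>c = 0\<close>)
    qed
    then show "\<forall>k<card Bs. a k = 0" by (intro indep) simp
  qed
qed

end


section \<open>The order of the Alexander polynomial at a root\<close>

lemma minor_cases:
  assumes P: "P \<in> carrier_mat h (Suc n)"
    and x: "x \<in> {det (submatrix P I J) | I J. I \<subseteq> {..<dim_row P} \<and> J \<subseteq> {..<dim_col P} \<and>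
        card I = dim_col P - 1 \<and> card J = dim_col P - 1}"
  obtains i f where "i < Suc n" "f \<in> {..<n} \<rightarrow> {..<h}" "x = det (select_rows (delete_col P i) f)"
proof -
  from x obtain I J where IJ: "I \<subseteq> {..<h}" "J \<subseteq> {..<Suc n}" "card I = n" "card J = n"
    and x: "x = det (submatrix P I J)"
    using P by auto
  have "card ({..<Suc n} - J) = 1"
    using IJ by (subst card_Diff_subset) (auto intro: finite_subset)
  then obtain i where i: "{..<Suc n} - J = {i}" by (rule card_1_singletonE)
  then have "J = {..<Suc n} - {i}" "i < Suc n" using IJ(2) by auto
  then show ?thesis
    using that[OF _ pick_rows[OF IJ(1,3)]] submatrix_delete_col[OF P IJ(1,3)] x by simp
qed

lemma gcd_dvd_maximal_minor:
  fixes P :: "'a::comm_ring_1 mat"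
  assumes P: "P \<in> carrier_mat h (Suc n)" and gcd: "is_gcd_of \<Delta> (elementary_ideal1 P)"
    and j: "j < Suc n" and f: "f \<in> {..<n} \<rightarrow> {..<h}" "inj_on f {..<n}"
  shows "\<Delta> dvd det (select_rows (delete_col P j) f)"
proof -
  have ring: "ring (class_ring :: 'a ring)"
    using class_cring.cring_axioms by (rule cring.axioms(1))
  let ?S = "{det (submatrix P I J) | I J. I \<subseteq> {..<dim_row P} \<and> J \<subseteq> {..<dim_col P} \<and>
        card I = dim_col P - 1 \<and> card J = dim_col P - 1}"
  obtain s where s: "det (select_rows (delete_col P j) f) =
      s * det (select_rows (delete_col P j) (pick (f ` {..<n})))"
    using select_rows_pick[OF delete_col_carrier[OF P] f] by blast
  have I: "f ` {..<n} \<subseteq> {..<h}" "card (f ` {..<n}) = n"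
    using f by (auto simp: card_image)
  have "det (submatrix P (f ` {..<n}) ({..<Suc n} - {j})) \<in> ?S"
    by (rule CollectI, intro exI conjI, rule refl) (use P I j in auto)
  then have "det (select_rows (delete_col P j) (pick (f ` {..<n}))) \<in> ?S"
    unfolding submatrix_delete_col[OF P I j] .
  then have "det (select_rows (delete_col P j) (pick (f ` {..<n}))) \<in> elementary_ideal1 P"
    unfolding elementary_ideal1_def by (rule subsetD[OF ring.genideal_self[OF ring], rotated]) simp
  with gcd have "\<Delta> dvd det (select_rows (delete_col P j) (pick (f ` {..<n})))"
    unfolding is_gcd_of_def by blast
  then show ?thesis unfolding s by (rule dvd_mult)
qed

lemma gcd_hom_dvd_maximal_minor:
  fixes P :: "'a::comm_ring_1 mat" and \<chi> :: "'a \<Rightarrow> 'b::comm_ring_1"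
  assumes P: "P \<in> carrier_mat h (Suc n)" and gcd: "is_gcd_of \<Delta> (elementary_ideal1 P)"
    and j: "j < Suc n" and f: "f \<in> {..<n} \<rightarrow> {..<h}" "inj_on f {..<n}" and \<chi>: "comm_ring_hom \<chi>"
  shows "\<chi> \<Delta> dvd det (select_rows (delete_col (map_mat \<chi> P) j) f)"
proof -
  interpret comm_ring_hom \<chi> by fact
  obtain q where q: "det (select_rows (delete_col P j) f) = \<Delta> * q"
    using gcd_dvd_maximal_minor[OF assms(1-5)] by (elim dvdE)
  have "det (select_rows (delete_col (map_mat \<chi> P) j) f) = \<chi> (\<Delta> * q)"
    unfolding map_mat_delete_col[OF P, symmetric] map_mat_select_rows[OF delete_col_carrier[OF P] f(1)]
      hom_det q ..
  then show ?thesis unfolding hom_mult by (rule dvdI)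
qed

text \<open>All maximal minors of \<open>P\<close> are proportional to those that omit the column \<open>j\<close>, with the
  entries of a kernel vector as factors; the divisor \<open>d\<^sub>j\<close> is a unit locally at \<open>z\<close>.\<close>

lemma fps_X_power_dvd_gcd:
  fixes P :: "(int \<Rightarrow>\<^sub>0 int) mat"
  assumes P: "P \<in> carrier_mat h (Suc n)" and gcd: "is_gcd_of \<Delta> (elementary_ideal1 P)"
    and "\<Delta> \<noteq> 0" and z: "z \<noteq> 0" and j: "j < Suc n"
    and d: "d \<in> carrier_vec (Suc n)" "P *\<^sub>v d = 0\<^sub>v h" and dj: "fps_nth (int_expansion z (d $ j)) 0 \<noteq> 0"
    and dvd: "\<And>f. f \<in> {..<n} \<rightarrow> {..<h} \<Longrightarrow>
      fps_X ^ k dvd det (select_rows (delete_col (map_mat (int_expansion z) P) j) f)"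
  shows "fps_X ^ k dvd int_expansion z \<Delta>"
proof (rule gcd_order[OF gcd[unfolded elementary_ideal1_def] \<open>\<Delta> \<noteq> 0\<close> z])
  interpret E: comm_ring_hom "int_expansion z" using z by (rule int_expansion_hom)
  fix x assume "x \<in> {det (submatrix P I J) | I J. I \<subseteq> {..<dim_row P} \<and> J \<subseteq> {..<dim_col P} \<and>
        card I = dim_col P - 1 \<and> card J = dim_col P - 1}"
  then obtain i f where i: "i < Suc n" and f: "f \<in> {..<n} \<rightarrow> {..<h}"
    and x: "x = det (select_rows (delete_col P i) f)"
    by (rule minor_cases[OF P])
  have "d $ j \<noteq> 0" using dj by (auto simp: E.hom_zero)
  then obtain s where s: "x * d $ j = s * (det (select_rows (delete_col P j) f) * d $ i)"
    unfolding x using minors_proportional_to_kernel_vector[OF P d f i j] by blast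
  have "det (select_rows (delete_col (map_mat (int_expansion z) P) j) f) =
      int_expansion z (det (select_rows (delete_col P j) f))"
    unfolding map_mat_delete_col[OF P, symmetric] map_mat_select_rows[OF delete_col_carrier[OF P] f]
      E.hom_det ..
  then have "fps_X ^ k dvd int_expansion z (det (select_rows (delete_col P j) f))"
    using dvd[OF f] by simp
  then have "fps_X ^ k dvd int_expansion z x * int_expansion z (d $ j)"
    unfolding E.hom_mult[symmetric] s unfolding E.hom_mult by (intro dvd_mult dvd_mult2)
  moreover have "is_unit (int_expansion z (d $ j))" using dj by (simp add: fps_is_unit_iff)
  ultimately show "fps_X ^ k dvd int_expansion z x" by (simp only: dvd_mult_unit_iff)
qed

text \<open>At \<open>z\<^sub>j\<close>, the unit and the factors that belong to the other roots have non-zero constant terms.\<close>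

lemma fps_X_power_dvd_expansion_iff:
  fixes s :: nat
  assumes \<Delta>: "complexify \<Delta> \<doteq> (\<Prod>j\<in>{1..s}. (tpow 1 - lconst (z j)) ^ \<mu> j)"
    and inj: "inj_on z {1..s}" and j: "j \<in> {1..s}" and zj: "z j \<noteq> 0"
  shows "fps_X ^ k dvd int_expansion (z j) \<Delta> \<longleftrightarrow> k \<le> \<mu> j"
proof -
  interpret E: comm_ring_hom "expansion (z j)" using zj by (rule expansion_hom)
  interpret c0: comm_ring_hom "\<lambda>f :: complex fps. fps_nth f 0" by (rule fps_coeff_0_hom)
  from \<Delta> obtain u v where uv: "1 = u * v"
    and eq: "complexify \<Delta> = u * (\<Prod>j\<in>{1..s}. (tpow 1 - lconst (z j)) ^ \<mu> j)"
    unfolding eq_up_to_unit_def by (elim exE conjE dvdE)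
  define W where "W = expansion (z j) u * (\<Prod>i\<in>{1..s} - {j}. (fps_const (z j - z i) + fps_X) ^ \<mu> i)"
  have "int_expansion (z j) \<Delta> =
      expansion (z j) u * (\<Prod>i\<in>{1..s}. (fps_const (z j - z i) + fps_X) ^ \<mu> i)"
    unfolding expansion_complexify[symmetric] eq E.hom_mult E.hom_prod E.hom_power
      expansion_linear_factor[OF zj] ..
  also have "(\<Prod>i\<in>{1..s}. (fps_const (z j - z i) + fps_X) ^ \<mu> i) =
      fps_X ^ \<mu> j * (\<Prod>i\<in>{1..s} - {j}. (fps_const (z j - z i) + fps_X) ^ \<mu> i)"
    using prod.remove[OF finite_atLeastAtMost j, of "\<lambda>i. (fps_const (z j - z i) + fps_X) ^ \<mu> i"] by simp
  finally have fact: "int_expansion (z j) \<Delta> = fps_X ^ \<mu> j * W" unfolding W_def by (simp only: mult_ac)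
  have "fps_nth (expansion (z j) u) 0 * fps_nth (expansion (z j) v) 0 = 1"
    unfolding c0.hom_mult[symmetric] E.hom_mult[symmetric] uv[symmetric] by (simp add: E.hom_one)
  then have u0: "fps_nth (expansion (z j) u) 0 \<noteq> 0" by auto
  have "z j \<noteq> z i" if "i \<in> {1..s} - {j}" for i
    using inj_onD[OF inj _ j, of i] that by (metis DiffE singletonI)
  then have "(\<Prod>i\<in>{1..s} - {j}. (z j - z i) ^ \<mu> i) \<noteq> 0" by (subst prod_zero_iff) auto
  moreover have "fps_nth W 0 = fps_nth (expansion (z j) u) 0 * (\<Prod>i\<in>{1..s} - {j}. (z j - z i) ^ \<mu> i)"
    unfolding W_def c0.hom_mult c0.hom_prod c0.hom_power by simp
  ultimately have "fps_nth W 0 \<noteq> 0" using u0 by simp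
  then have "is_unit W" by (simp add: fps_is_unit_iff)
  then have "fps_X ^ k dvd int_expansion (z j) \<Delta> \<longleftrightarrow> fps_X ^ k dvd (fps_X :: complex fps) ^ \<mu> j"
    unfolding fact by (simp only: dvd_mult_unit_iff)
  also have "\<dots> \<longleftrightarrow> k \<le> \<mu> j"
    unfolding fps_X_power_dvd_iff by (auto simp: fps_X_power_iff not_le)
  finally show ?thesis .
qed


section \<open>Deformations of crossed homomorphisms to the dual numbers\<close>

lemma mult_mat_vec_eq_0_iff:
  assumes "A \<in> carrier_mat h n" "v \<in> carrier_vec n"
  shows "A *\<^sub>v v = 0\<^sub>v h \<longleftrightarrow> (\<forall>r<h. (\<Sum>c<n. A $$ (r, c) * v $ c) = 0)"
proof -
  have "A *\<^sub>v v = 0\<^sub>v h \<longleftrightarrow> (\<forall>r<h. (A *\<^sub>v v) $ r = 0)"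
    using assms(1) by (auto simp: vec_eq_iff)
  then show ?thesis using mult_mat_vec_nth[OF assms] by simp
qed

text \<open>Over the dual numbers, the real and the infinitesimal part of a linear system are the conditions on a
  kernel vector of the constant part and on its first-order variation.\<close>

lemma dual_system_iff:
  assumes N: "N \<in> carrier_mat h n"
  shows "(\<forall>r<h. (\<Sum>c<n. truncate (N $$ (r, c)) * y c) = 0) \<longleftrightarrow>
    const_part N *\<^sub>v vec n (\<lambda>c. dual_re (y c)) = 0\<^sub>v h \<and>
    lin_part N *\<^sub>v vec n (\<lambda>c. dual_re (y c)) + const_part N *\<^sub>v vec n (\<lambda>c. dual_eps (y c)) = 0\<^sub>v h"
proof -
  have C: "const_part N \<in> carrier_mat h n" and L: "lin_part N \<in> carrier_mat h n" using N by auto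
  have c: "(const_part N *\<^sub>v vec n x) $ r = (\<Sum>c<n. fps_nth (N $$ (r, c)) 0 * x c)"
    and l: "(lin_part N *\<^sub>v vec n x) $ r = (\<Sum>c<n. fps_nth (N $$ (r, c)) 1 * x c)"
    if r: "r < h" for r x
    unfolding mult_mat_vec_nth[OF C vec_carrier r] mult_mat_vec_nth[OF L vec_carrier r]
    by (rule sum.cong; use N r in simp)+
  have 0: "const_part N *\<^sub>v vec n x = 0\<^sub>v h \<longleftrightarrow> (\<forall>r<h. (\<Sum>c<n. fps_nth (N $$ (r, c)) 0 * x c) = 0)" for x
    using C c by (auto simp: vec_eq_iff)
  have 1: "lin_part N *\<^sub>v vec n x + const_part N *\<^sub>v vec n x' = 0\<^sub>v h \<longleftrightarrow> (\<forall>r<h.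
      (\<Sum>c<n. fps_nth (N $$ (r, c)) 1 * x c) + (\<Sum>c<n. fps_nth (N $$ (r, c)) 0 * x' c) = 0)" for x x'
    using N c l by (auto simp: vec_eq_iff)
  show ?thesis
    unfolding 0 1 dual_eq_iff by (auto simp: sum.distrib add.commute)
qed

text \<open>Writing \<open>t\<^sub>0 g = k (g t\<^sub>0)\<close> with \<open>k\<close> in the kernel of \<open>\<phi>\<close> and applying \<open>D\<close> gives
  \<open>\<rho> t\<^sub>0 * D g = D g\<close>.\<close>

lemma (in infinite_cyclic_quotient) crossed_hom_eq_0:
  assumes D: "crossed_hom G \<rho> D" and \<rho>: "\<And>k. k \<in> K \<Longrightarrow> \<rho> k = 1" and unit: "(\<rho> t0 - 1) * y = 1"
    and 0: "\<And>k. k \<in> K \<Longrightarrow> D k = 0" "D t0 = 0" and g: "g \<in> carrier G"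
  shows "D g = 0"
proof -
  define k where "k = (t0 \<otimes> g) \<otimes> inv (g \<otimes> t0)"
  have k: "k \<in> K" unfolding K_def k_def using t0 g by (simp add: phi_mult phi_inv)
  have "k \<otimes> (g \<otimes> t0) = t0 \<otimes> g" unfolding k_def using t0 g by (simp add: m_assoc)
  then have "D (k \<otimes> (g \<otimes> t0)) = D (t0 \<otimes> g)" by simp
  then have "D k + \<rho> k * (D g + \<rho> g * D t0) = D t0 + \<rho> t0 * D g"
    using D t0(1) g k K_carrier unfolding crossed_hom_def by simp
  then have "(\<rho> t0 - 1) * D g = 0" using k by (simp add: 0 \<rho> algebra_simps)
  then have "(\<rho> t0 - 1) * y * D g = 0" by (simp add: mult_ac)
  then show ?thesis unfolding unit by simp
qed

locale presented_cyclic = presented G \<phi> P \<pi> + infinite_cyclic_quotient G \<phi> t0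
  for G :: "('g, 'a) monoid_scheme" (structure) and \<phi> P \<pi> t0
begin

abbreviation dual_int :: "complex \<Rightarrow> (int \<Rightarrow>\<^sub>0 int) \<Rightarrow> dual" where
  "dual_int z \<equiv> (\<lambda>p. truncate (int_expansion z p))"

lemma dual_int_hom: "z \<noteq> 0 \<Longrightarrow> comm_ring_hom (dual_int z)"
proof -
  assume "z \<noteq> 0"
  interpret E: comm_ring_hom "int_expansion z" by (rule int_expansion_hom) fact
  interpret t: comm_ring_hom truncate by (rule truncate_hom)
  show ?thesis by unfold_locales (simp_all add: E.hom_add E.hom_mult t.hom_add t.hom_mult)
qed

lemma dual_int_tpow: "dual_int z (tpow i) = dual_value z (tpow i)"
  unfolding expansion_tpow int_expansion_tpow ..

text \<open>The two sides differ by multiples of the principal crossed homomorphism, which can be used to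
  normalize either the value at \<open>t\<^sub>0\<close> or the coordinate \<open>j\<close>, since both \<open>\<rho>(t\<^sub>0) - 1\<close> and \<open>d\<^sub>j\<close>
  are units.\<close>

lemma eps_kills_iff_kernel_vectors:
  assumes z: "z \<noteq> 0" "z \<noteq> 1"
    and d: "kernel_vector (dual_int z) d" "\<And>g. g \<in> carrier G \<Longrightarrow> crossed (dual_int z) d g = char (dual_int z) g - 1"
    and j: "j < dim_col P" and dj: "d j * y = 1"
  shows "(\<forall>f. bc_hom (dual_value z) f \<longrightarrow> (\<forall>Y\<in>carrier BC. eps * f Y = 0)) \<longleftrightarrow>
    (\<forall>u. kernel_vector (dual_int z) u \<longrightarrow> u j = 0 \<longrightarrow> (\<forall>i<dim_col P. eps * u i = 0))"
    (is "?L \<longleftrightarrow> ?R")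
proof -
  let ?\<chi> = "dual_int z"
  let ?\<rho> = "char ?\<chi>"
  have \<chi>: "comm_ring_hom ?\<chi>" using z(1) by (rule dual_int_hom)
  interpret chi: comm_ring_hom ?\<chi> by (rule \<chi>)
  interpret cv: comm_ring_hom "dual_value z" using z(1) by (rule dual_value_hom)
  have \<rho>_K: "?\<rho> k = 1" if "k \<in> K" for k
  proof -
    have "\<phi> k = 0" using that by (simp add: K_def)
    then show ?thesis using chi.hom_one by simp
  qed
  have "dual_re (?\<rho> t0 - 1) = z - 1"
    unfolding t0(2) int_expansion_tpow by (simp add: loc_t_def)
  then obtain y' where y': "(?\<rho> t0 - 1) * y' = 1" using dual_unit[of "?\<rho> t0 - 1"] z(2) by auto
  show ?thesis
  proof
    assume L: ?L
    show ?R
    proof (intro allI impI)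
      fix u i assume u: "kernel_vector ?\<chi> u" "u j = 0" and i: "i < dim_col P"
      have D: "crossed_hom G ?\<rho> (crossed ?\<chi> u)" by (rule crossed_hom_of_kernel_vector[OF \<chi> u(1)])
      from bc_hom_of_crossed_hom[OF cv.comm_ring_hom_axioms D[unfolded dual_int_tpow]]
      obtain f where f: "bc_hom (dual_value z) f"
        "\<And>k v. k \<in> K \<Longrightarrow> f (ten k v) = dual_value z (lconst v) * crossed ?\<chi> u k"
        by blast
      have eps_K: "eps * crossed ?\<chi> u k = 0" if k: "k \<in> K" for k
      proof -
        have "eps * f (ten k 1) = 0" using L f(1) ten_mem[OF k] by blast
        then show ?thesis unfolding f(2)[OF k] using cv.hom_one by simp
      qed
      define c where "c = crossed ?\<chi> u t0 * y'"
      define v where "v i = eps * u i - (eps * c) * d i" for i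
      have v: "kernel_vector ?\<chi> v" unfolding v_def by (rule kernel_vector_comb[OF u(1) d(1)])
      have cr: "crossed ?\<chi> v g = eps * crossed ?\<chi> u g - (eps * c) * (?\<rho> g - 1)" if "g \<in> carrier G" for g
        unfolding v_def pairing_comb d(2)[OF that] ..
      have v0: "crossed ?\<chi> v g = 0" if "g \<in> carrier G" for g
      proof (rule crossed_hom_eq_0[OF crossed_hom_of_kernel_vector[OF \<chi> v] \<rho>_K y' _ _ that])
        fix k assume k: "k \<in> K"
        show "crossed ?\<chi> v k = 0"
          unfolding cr[OF K_carrier[OF k]] \<rho>_K[OF k] eps_K[OF k] by simp
      next
        have "crossed ?\<chi> v t0 = eps * crossed ?\<chi> u t0 * (1 - (?\<rho> t0 - 1) * y')"
          unfolding cr[OF t0(1)] c_def by (simp add: algebra_simps)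
        then show "crossed ?\<chi> v t0 = 0" unfolding y' by simp
      qed
      have v_0: "eps * u i = (eps * c) * d i" if "i < dim_col P" for i
        using kernel_vector_eq_0[OF \<chi> v v0 that] unfolding v_def by simp
      have "(eps * c) * (d j * y) = 0" using v_0[OF j] u(2) by (simp add: mult.assoc[symmetric])
      then have "eps * c = 0" unfolding dj by simp
      then show "eps * u i = 0" unfolding v_0[OF i] by simp
    qed
  next
    assume R: ?R
    show ?L
    proof (intro allI impI ballI)
      fix f Y assume f: "bc_hom (dual_value z) f" and Y: "Y \<in> carrier BC"
      define D where "D g = f (ten (retract g) 1)" for g
      have D: "crossed_hom G ?\<rho> D"
        unfolding dual_int_tpow D_def by (rule crossed_hom_of_bc_hom[OF f])
      obtain u where u: "kernel_vector ?\<chi> u" "\<And>g. g \<in> carrier G \<Longrightarrow> crossed ?\<chi> u g = D g"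
        using kernel_vector_of_crossed_hom[OF \<chi> D] by blast
      define c where "c = u j * y"
      define v where "v i = 1 * u i - c * d i" for i
      have v: "kernel_vector ?\<chi> v" unfolding v_def by (rule kernel_vector_comb[OF u(1) d(1)])
      have "v j = u j * (1 - d j * y)" unfolding v_def c_def by (simp only: algebra_simps)
      then have "v j = 0" unfolding dj by simp
      with R v have eps_v: "eps * v i = 0" if "i < dim_col P" for i using that by blast
      have eq: "eps * D g = (eps * c) * (?\<rho> g - 1)" if g: "g \<in> carrier G" for g
      proof -
        have "eps * crossed ?\<chi> v g = (\<Sum>i<dim_col P. ?\<chi> (lift g $ i) * (eps * v i))"
          unfolding pairing_def sum_distrib_left by (rule sum.cong) (simp_all add: mult.left_commute)
        also have "\<dots> = 0" using eps_v by simp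
        finally have "eps * crossed ?\<chi> v g = 0" .
        moreover have "crossed ?\<chi> v g = 1 * D g - c * (?\<rho> g - 1)"
          unfolding v_def pairing_comb d(2)[OF g] u(2)[OF g] ..
        ultimately show ?thesis by (simp add: right_diff_distrib mult.assoc)
      qed
      have one_K: "\<one> \<in> K" by (rule K_closed(1))
      have "D (\<one> \<otimes> \<one>) = D \<one> + ?\<rho> \<one> * D \<one>" using D unfolding crossed_hom_def by blast
      then have "D \<one> = 0" unfolding \<rho>_K[OF one_K] by simp
      then have "D t0 = 0" unfolding D_def retract_t0 retract_kernel[OF one_K] .
      then have "(eps * c) * (?\<rho> t0 - 1) = 0" using eq[OF t0(1)] by simp
      then have "(eps * c) * ((?\<rho> t0 - 1) * y') = 0" by (simp add: mult.assoc[symmetric])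
      then have c0: "eps * c = 0" unfolding y' by simp
      show "eps * f Y = 0"
      proof (rule bc_hom_eq_0[OF _ _ Y])
        show "bc_hom (dual_value z) (\<lambda>Y. eps * f Y)"
          using f unfolding bc_hom_def by (simp add: distrib_left mult.left_commute)
        fix k assume k: "k \<in> K"
        have "eps * D k = 0" unfolding eq[OF K_carrier[OF k]] c0 by simp
        then show "eps * f (ten k 1) = 0" unfolding D_def retract_kernel[OF k] .
      qed
    qed
  qed
qed

lemma eps_kernel_vectors_matrix:
  fixes z :: complex
  assumes n: "dim_col P = Suc n" and j: "j < Suc n"
  defines "M \<equiv> delete_col (map_mat (int_expansion z) P) j"
  shows "(\<forall>u. kernel_vector (dual_int z) u \<longrightarrow> u j = 0 \<longrightarrow> (\<forall>i<dim_col P. eps * u i = 0)) \<longleftrightarrow>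
    (\<forall>u0\<in>carrier_vec n. \<forall>u1\<in>carrier_vec n. const_part M *\<^sub>v u0 = 0\<^sub>v (dim_row P) \<longrightarrow>
      lin_part M *\<^sub>v u0 + const_part M *\<^sub>v u1 = 0\<^sub>v (dim_row P) \<longrightarrow> u0 = 0\<^sub>v n)"
    (is "?L \<longleftrightarrow> ?R")
proof -
  have M: "M \<in> carrier_mat (dim_row P) n" unfolding M_def using n by (intro delete_col_carrier) auto
  have entry: "delete_col (map_mat (dual_int z) P) j $$ (r, c) = truncate (M $$ (r, c))"
    if "r < dim_row P" "c < n" for r c
    unfolding M_def delete_col_def using that n insert_index_less by auto
  have kernel: "kernel_vector (dual_int z) u \<longleftrightarrow>
      const_part M *\<^sub>v vec n (\<lambda>c. dual_re (u (insert_index j c))) = 0\<^sub>v (dim_row P) \<and>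
      lin_part M *\<^sub>v vec n (\<lambda>c. dual_re (u (insert_index j c))) +
        const_part M *\<^sub>v vec n (\<lambda>c. dual_eps (u (insert_index j c))) = 0\<^sub>v (dim_row P)"
    if "u j = 0" for u
    unfolding kernel_vector_delete_col[of n j u, OF n j that] dual_system_iff[OF M, symmetric]
    using entry by simp
  show ?thesis
  proof
    assume L: ?L
    show ?R
    proof (intro ballI impI)
      fix u0 u1 :: "complex vec"
      assume u: "u0 \<in> carrier_vec n" "u1 \<in> carrier_vec n"
        and eqs: "const_part M *\<^sub>v u0 = 0\<^sub>v (dim_row P)"
          "lin_part M *\<^sub>v u0 + const_part M *\<^sub>v u1 = 0\<^sub>v (dim_row P)"
      define u where "u i = (if i = j then 0 else Dual (u0 $ delete_index j i) (u1 $ delete_index j i))" for i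
      have "u j = 0" by (simp add: u_def)
      have ins: "u (insert_index j c) = Dual (u0 $ c) (u1 $ c)" for c
        by (simp add: u_def insert_index_exclude)
      have vecs: "vec n (\<lambda>c. dual_re (u (insert_index j c))) = u0" "vec n (\<lambda>c. dual_eps (u (insert_index j c))) = u1"
        unfolding ins using u by auto
      have "kernel_vector (dual_int z) u"
        unfolding kernel[of u, OF \<open>u j = 0\<close>] vecs by (rule conjI[OF eqs])
      with L \<open>u j = 0\<close> have eps_u: "\<And>i. i < dim_col P \<Longrightarrow> eps * u i = 0" by blast
      show "u0 = 0\<^sub>v n"
      proof (rule eq_vecI)
        fix c assume "c < dim_vec (0\<^sub>v n :: complex vec)"
        then have c: "c < n" by simp
        have "eps * u (insert_index j c) = 0" by (rule eps_u) (simp add: n insert_index_less[OF c])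
        then show "u0 $ c = 0\<^sub>v n $ c" unfolding ins eps_mult_eq_0_iff using c by simp
      qed (use u in simp)
    qed
  next
    assume R: ?R
    show ?L
    proof (intro allI impI)
      fix u :: "nat \<Rightarrow> dual" and i
      assume u: "kernel_vector (dual_int z) u" and uj: "u j = 0" and i: "i < dim_col P"
      note eqs = u[unfolded kernel[of u, OF uj]]
      have u0: "vec n (\<lambda>c. dual_re (u (insert_index j c))) = 0\<^sub>v n"
        by (rule R[rule_format, OF vec_carrier vec_carrier conjunct1[OF eqs] conjunct2[OF eqs]])
      show "eps * u i = 0"
      proof (cases "i = j")
        case True
        then show ?thesis using uj by simp
      next
        case False
        then have "i \<in> insert_index j ` {0..<n}" unfolding insert_index_image[OF j] using i n by simp
        then obtain c where c: "c < n" "i = insert_index j c" by auto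
        have "vec n (\<lambda>c. dual_re (u (insert_index j c))) $ c = 0\<^sub>v n $ c" unfolding u0 ..
        then show ?thesis unfolding c(2) eps_mult_eq_0_iff using c(1) by simp
      qed
    qed
  qed
qed

lemma kernel_vector_image:
  assumes \<chi>: "comm_ring_hom \<chi>" and d: "kernel_vector (\<lambda>p. p) d"
  shows "kernel_vector \<chi> (\<lambda>i. \<chi> (d i))" "crossed \<chi> (\<lambda>i. \<chi> (d i)) g = \<chi> (crossed (\<lambda>p. p) d g)"
proof -
  interpret comm_ring_hom \<chi> by fact
  have *: "pairing \<chi> (\<lambda>i. \<chi> (d i)) v = \<chi> (pairing (\<lambda>p. p) d v)" for v
    unfolding pairing_def hom_sum by (simp add: hom_mult)
  show "kernel_vector \<chi> (\<lambda>i. \<chi> (d i))"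
    using d unfolding kernel_vector_pairing * by (simp add: hom_zero)
  show "crossed \<chi> (\<lambda>i. \<chi> (d i)) g = \<chi> (crossed (\<lambda>p. p) d g)" by (rule *)
qed

lemma coeff_0_hom: "w \<noteq> 0 \<Longrightarrow> comm_ring_hom (\<lambda>p. fps_nth (int_expansion w p) 0)"
proof -
  assume "w \<noteq> 0"
  interpret E: comm_ring_hom "int_expansion w" by (rule int_expansion_hom) fact
  interpret t: comm_ring_hom "\<lambda>f :: complex fps. fps_nth f 0" by (rule fps_coeff_0_hom)
  show ?thesis by unfold_locales (simp_all add: E.hom_add E.hom_mult t.hom_add t.hom_mult)
qed

lemma coeff_0_tpow: "w \<noteq> 0 \<Longrightarrow> fps_nth (int_expansion w (tpow i)) 0 = w powi i"
  unfolding int_expansion_tpow by (rule unit_pow_loc_t_coeff_0)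

text \<open>At \<open>t = 1\<close> the kernel of the presentation matrix has dimension \<open>b\<^sub>1(G)\<close>.  If that is one,
  then deleting a column at which the kernel does not vanish leaves a matrix of full rank.\<close>

lemma alexander_polynomial_at_1:
  assumes b1: "b1 G = 1" and gcd: "is_gcd_of \<Delta> (elementary_ideal1 P)"
  shows "fps_nth (int_expansion 1 \<Delta>) 0 \<noteq> 0"
proof -
  let ?\<chi> = "\<lambda>p. fps_nth (int_expansion 1 p) 0"
  let ?M = "map_mat ?\<chi> P"
  have \<chi>: "comm_ring_hom ?\<chi>" by (rule coeff_0_hom) simp
  interpret chi: comm_ring_hom ?\<chi> by (rule \<chi>)
  have char_1: "char ?\<chi> = (\<lambda>_. 1)" by (rule ext) (subst coeff_0_tpow; simp)
  obtain S Bs where ad: "kernel_adapted ?M S Bs" using kernel_adapted_exists by blast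
  have M: "?M \<in> carrier_mat (dim_row P) (dim_col P)" by auto
  have kernel: "kernel_vector ?\<chi> u \<longleftrightarrow> (\<forall>r<dim_row P. (\<Sum>c<dim_col P. ?M $$ (r, c) * u c) = 0)" for u
    unfolding kernel_vector_def by simp
  obtain u where u: "\<And>k. k < card Bs \<Longrightarrow> kernel_vector ?\<chi> (u k)"
    and spans: "\<And>x. kernel_vector ?\<chi> x \<Longrightarrow> \<exists>a. \<forall>c<dim_col P. x c = (\<Sum>k<card Bs. a k * u k c)"
    and indep: "\<And>a. \<forall>c<dim_col P. (\<Sum>k<card Bs. a k * u k c) = 0 \<Longrightarrow> \<forall>k<card Bs. a k = 0"
    using kernel_adapted_basis[OF ad M] unfolding kernel[symmetric] by blast
  have "twisted_b1 G (char ?\<chi>) = card Bs"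
  proof (rule twisted_b1_kernel_vectors[OF \<chi>, where d = "\<lambda>_. 0"])
    show "kernel_vector ?\<chi> (\<lambda>_. 0)" by (simp add: kernel_vector_def)
    show "crossed ?\<chi> (\<lambda>_. 0) g = char ?\<chi> g - 1" for g
      unfolding fun_cong[OF char_1] by (simp add: pairing_def)
    show "\<exists>a c. \<forall>i<dim_col P. v i = (\<Sum>k<card Bs. a k * u k i) + c * 0" if "kernel_vector ?\<chi> v" for v
      using spans[OF that] by simp
    show "\<forall>k<card Bs. a k = 0" if "\<forall>i<dim_col P. (\<Sum>k<card Bs. a k * u k i) = c * 0" for a c
      by (rule indep) (use that in simp)
  qed (rule u)
  then have one: "card Bs = 1" using b1 unfolding b1_def char_1 by simp
  have "\<exists>j<dim_col P. u 0 j \<noteq> 0"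
  proof (rule ccontr)
    assume "\<not> (\<exists>j<dim_col P. u 0 j \<noteq> 0)"
    then have "\<forall>c<dim_col P. (\<Sum>k<card Bs. 1 * u k c) = 0" unfolding one by simp
    from indep[OF this, rule_format, of 0] show False unfolding one by simp
  qed
  then obtain j where j: "j < dim_col P" "u 0 j \<noteq> 0" by blast
  then obtain n where n: "dim_col P = Suc n" by (cases "dim_col P") auto
  have jn: "j < Suc n" using j(1) n by simp
  have P: "P \<in> carrier_mat (dim_row P) (Suc n)" using n by auto
  have M': "delete_col ?M j \<in> carrier_mat (dim_row P) n"
    by (rule delete_col_carrier) (simp only: map_carrier_mat P)
  have "\<exists>f \<in> {..<n} \<rightarrow> {..<dim_row P}. det (select_rows (delete_col ?M j) f) \<noteq> 0"
  proof (rule exists_nonzero_maximal_minor[OF M'])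
    fix x :: "complex vec"
    assume x: "x \<in> carrier_vec n" "delete_col ?M j *\<^sub>v x = 0\<^sub>v (dim_row P)"
    define y where "y i = (if i = j then 0 else x $ delete_index j i)" for i
    have yj: "y j = 0" and ins: "y (insert_index j c) = x $ c" for c
      by (simp_all add: y_def insert_index_exclude)
    have "kernel_vector ?\<chi> y"
      using x(2) unfolding kernel_vector_delete_col[of n j y, OF n jn yj] ins mult_mat_vec_eq_0_iff[OF M' x(1)] .
    from spans[OF this] obtain a where "\<forall>c<dim_col P. y c = (\<Sum>k<card Bs. a k * u k c)" by (elim exE)
    then have a: "y c = a 0 * u 0 c" if "c < dim_col P" for c using that unfolding one by simp
    have "a 0 = 0" using a[OF j(1)] yj j(2) by simp
    show "x = 0\<^sub>v n"
    proof (rule eq_vecI)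
      fix c assume "c < dim_vec (0\<^sub>v n :: complex vec)"
      then have c: "c < n" by simp
      have "x $ c = a 0 * u 0 (insert_index j c)"
        unfolding ins[symmetric] by (rule a) (simp add: n insert_index_less[OF c])
      then show "x $ c = 0\<^sub>v n $ c" using c \<open>a 0 = 0\<close> by simp
    qed (use x(1) in simp)
  qed
  then obtain f where f: "f \<in> {..<n} \<rightarrow> {..<dim_row P}" "det (select_rows (delete_col ?M j) f) \<noteq> 0" by blast
  have "?\<chi> \<Delta> dvd det (select_rows (delete_col ?M j) f)"
    by (rule gcd_hom_dvd_maximal_minor[OF P gcd jn f(1) det_select_rows_inj[OF M' f(2)] \<chi>])
  then show ?thesis using f(2) by auto
qed

text \<open>Both sides are compared with \<open>b\<close>, the dimension of the kernel at \<open>z\<close> of the presentation matrix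
  without the column \<open>j\<close>.  It always equals the twisted Betti number and is at most the order \<open>\<mu>\<close>;
  equality holds exactly when no non-zero kernel vector of this matrix deforms to first order.\<close>

lemma twisted_b1_eq_order_iff:
  assumes gcd: "is_gcd_of \<Delta> (elementary_ideal1 P)" and \<Delta>: "\<Delta> \<noteq> 0"
    and order: "\<And>k. fps_X ^ k dvd int_expansion z \<Delta> \<longleftrightarrow> k \<le> \<mu>"
    and z: "z \<noteq> 0" "z \<noteq> 1"
  shows "twisted_b1 G (\<lambda>g. z powi \<phi> g) = \<mu> \<longleftrightarrow>
    (\<forall>f. bc_hom (dual_value z) f \<longrightarrow> (\<forall>Y\<in>carrier BC. eps * f Y = 0))"
proof -
  let ?\<chi> = "\<lambda>p. fps_nth (int_expansion z p) 0"
  have \<chi>: "comm_ring_hom ?\<chi>" by (rule coeff_0_hom[OF z(1)])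
  interpret chi: comm_ring_hom ?\<chi> by (rule \<chi>)
  have id_hom: "comm_ring_hom (\<lambda>p :: int \<Rightarrow>\<^sub>0 int. p)" by unfold_locales simp_all
  obtain d where d: "kernel_vector (\<lambda>p. p) d"
      "\<And>g. g \<in> carrier G \<Longrightarrow> crossed (\<lambda>p. p) d g = tpow (\<phi> g) - 1"
    using kernel_vector_of_crossed_hom[OF id_hom char_crossed_hom[OF id_hom]] by blast
  have push: "kernel_vector \<psi> (\<lambda>i. \<psi> (d i))"
      "crossed \<psi> (\<lambda>i. \<psi> (d i)) g = char \<psi> g - 1"
    if \<psi>: "comm_ring_hom \<psi>" and g: "g \<in> carrier G" for \<psi> :: "(int \<Rightarrow>\<^sub>0 int) \<Rightarrow> 'r::comm_ring_1" and g
  proof -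
    interpret comm_ring_hom \<psi> by fact
    show "kernel_vector \<psi> (\<lambda>i. \<psi> (d i))" by (rule kernel_vector_image(1)[OF \<psi> d(1)])
    show "crossed \<psi> (\<lambda>i. \<psi> (d i)) g = char \<psi> g - 1"
      unfolding kernel_vector_image(2)[OF \<psi> d(1)] d(2)[OF g] by (simp add: hom_minus hom_one)
  qed
  have "crossed ?\<chi> (\<lambda>i. ?\<chi> (d i)) t0 = z - 1"
    unfolding push(2)[OF \<chi> t0(1)] t0(2) coeff_0_tpow[OF z(1)] by simp
  then have "\<exists>j<dim_col P. ?\<chi> (d j) \<noteq> 0"
    using z(2) unfolding pairing_def by (metis (no_types, lifting) lessThan_iff mult_zero_right right_minus_eq sum.neutral)
  then obtain j where j: "j < dim_col P" and dj: "?\<chi> (d j) \<noteq> 0" by blast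
  then obtain n where n: "dim_col P = Suc n" by (cases "dim_col P") auto
  have jn: "j < Suc n" using j n by simp
  have P: "P \<in> carrier_mat (dim_row P) (Suc n)" using n by auto
  define M where "M = delete_col (map_mat (int_expansion z) P) j"
  have M: "M \<in> carrier_mat (dim_row P) n" unfolding M_def by (rule delete_col_carrier) (simp only: map_carrier_mat P)
  have const: "const_part M = delete_col (map_mat ?\<chi> P) j"
    unfolding M_def by (rule eq_matI) (use n insert_index_less in \<open>auto simp: delete_col_def\<close>)
  obtain S Bs where ad: "kernel_adapted (const_part M) S Bs" using kernel_adapted_exists by blast
  have "char ?\<chi> = (\<lambda>g. z powi \<phi> g)" by (rule ext) (rule coeff_0_tpow[OF z(1)])
  moreover have "twisted_b1 G (char ?\<chi>) = card Bs"
    by (rule twisted_b1_delete_col[OF \<chi> n jn push(1)[OF \<chi> t0(1)] push(2)[OF \<chi>] dj ad[unfolded const]])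
  ultimately have b: "twisted_b1 G (\<lambda>g. z powi \<phi> g) = card Bs" by simp
  have "P *\<^sub>v vec (Suc n) d = 0\<^sub>v (dim_row P)"
    unfolding mult_mat_vec_eq_0_iff[OF P vec_carrier] using d(1) unfolding kernel_vector_def n by simp
  note dvd_gcd = fps_X_power_dvd_gcd[OF P gcd \<Delta> z(1) jn vec_carrier this, folded M_def]
  have dj': "fps_nth (int_expansion z (vec (Suc n) d $ j)) 0 \<noteq> 0" using dj jn by simp
  have "card Bs \<le> \<mu>"
    unfolding order[symmetric] by (rule dvd_gcd[OF dj']) (rule fps_X_power_dvd_maximal_minor[OF ad M])
  let ?ss = "\<forall>u0\<in>carrier_vec n. \<forall>u1\<in>carrier_vec n. const_part M *\<^sub>v u0 = 0\<^sub>v (dim_row P) \<longrightarrow>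
      lin_part M *\<^sub>v u0 + const_part M *\<^sub>v u1 = 0\<^sub>v (dim_row P) \<longrightarrow> u0 = 0\<^sub>v n"
  have "card Bs = \<mu>" if ss: ?ss
  proof -
    obtain f where f: "f \<in> {..<n} \<rightarrow> {..<dim_row P}" "inj_on f {..<n}"
      "\<not> fps_X ^ Suc (card Bs) dvd det (select_rows M f)"
      using exists_maximal_minor_of_order[OF ad M] ss by blast
    have "int_expansion z \<Delta> dvd det (select_rows M f)"
      unfolding M_def by (rule gcd_hom_dvd_maximal_minor[OF P gcd jn f(1,2) int_expansion_hom[OF z(1)]])
    then have "\<not> Suc (card Bs) \<le> \<mu>" unfolding order[symmetric] using f(3) dvd_trans by blast
    with \<open>card Bs \<le> \<mu>\<close> show ?thesis by simp
  qed
  moreover have "Suc (card Bs) \<le> \<mu>" if not: "\<not> ?ss"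
  proof -
    from not obtain u0 u1 where u: "u0 \<in> carrier_vec n" "u1 \<in> carrier_vec n" "u0 \<noteq> 0\<^sub>v n"
      "const_part M *\<^sub>v u0 = 0\<^sub>v (dim_row P)"
      "lin_part M *\<^sub>v u0 + const_part M *\<^sub>v u1 = 0\<^sub>v (dim_row P)"
      by blast
    show ?thesis
      unfolding order[symmetric]
      by (rule dvd_gcd[OF dj']) (rule fps_X_power_dvd_maximal_minor_Suc[OF ad M _ u])
  qed
  ultimately have "card Bs = \<mu> \<longleftrightarrow> ?ss" by (metis Suc_n_not_le_n)
  also have "?ss \<longleftrightarrow> (\<forall>u. kernel_vector (dual_int z) u \<longrightarrow> u j = 0 \<longrightarrow> (\<forall>i<dim_col P. eps * u i = 0))"
    unfolding M_def by (rule eps_kernel_vectors_matrix[OF n jn, symmetric])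
  also have "\<dots> \<longleftrightarrow> (\<forall>f. bc_hom (dual_value z) f \<longrightarrow> (\<forall>Y\<in>carrier BC. eps * f Y = 0))"
  proof -
    have hom: "comm_ring_hom (dual_int z)" by (rule dual_int_hom[OF z(1)])
    have "dual_re (dual_int z (d j)) \<noteq> 0" using dj by simp
    then obtain y where "dual_int z (d j) * y = 1" by (rule dual_unit)
    from eps_kills_iff_kernel_vectors[OF z push(1)[OF hom t0(1)] push(2)[OF hom] j this]
    show ?thesis by (rule sym)
  qed
  finally show ?thesis unfolding b .
qed

end

section \<open>Multiplicities and exponents at a root\<close>

theorem proposition6p13:
  fixes G :: "('g, 'a) monoid_scheme"
    and \<psi> :: "'g set set \<Rightarrow> int" and \<phi> :: "'g \<Rightarrow> int"
    and \<Delta> :: "int \<Rightarrow>\<^sub>0 int"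
    and s :: nat and z :: "nat \<Rightarrow> complex" and \<mu> :: "nat \<Rightarrow> nat"
    and e :: "nat \<Rightarrow> complex \<Rightarrow> nat"
  assumes "group G" and "finitely_generated G"
    and "b1 G = 1"
    and "\<psi> \<in> iso (abf G) integer_group" and "\<phi> = abf_projection G \<psi>"
    and "is_alexander_polynomial G \<phi> \<Delta>"
    and "\<not> (\<exists>c::int. \<Delta> \<doteq> lconst c)"
    and "inj_on z {1..s}" and "z ` {1..s} = nonzero_roots \<Delta>"
    and "complexify \<Delta> \<doteq> (\<Prod>j\<in>{1..s}. (tpow 1 - lconst (z j)) ^ \<mu> j)"
    and "finite {(j, k). j \<in> {1..s} \<and> 1 \<le> k \<and> e k (z j) \<noteq> 0}"
    and "module_isomorphic class_ring
           (complexified_module (alexander_invariant G \<phi>))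
           (primary_decomposition_module s z e)"
  shows "\<forall>j\<in>{1..s}. twisted_b1 G (\<lambda>g. z j powi \<phi> g) = \<mu> j \<longleftrightarrow> (\<forall>k>1. e k (z j) = 0)"
proof
  fix j assume j: "j \<in> {1..s}"
  obtain P where P: "presentation_matrix P (alexander_module G \<phi>)"
    and gcd: "is_gcd_of \<Delta> (elementary_ideal1 P)"
    using assms(6) unfolding is_alexander_polynomial_def by blast
  obtain \<pi> where \<pi>:
    "\<pi> \<in> LinearCombinations.module_hom class_ring (module_vec TYPE(int \<Rightarrow>\<^sub>0 int) (dim_col P)) (alexander_module G \<phi>)"
    "\<pi> ` carrier_vec (dim_col P) = carrier (alexander_module G \<phi>)"
    "{v \<in> carrier_vec (dim_col P). \<pi> v = \<zero>\<^bsub>alexander_module G \<phi>\<^esub>} =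
      (\<lambda>w. transpose_mat P *\<^sub>v w) ` carrier_vec (dim_row P)"
    using P unfolding presentation_matrix_def by blast
  have \<phi>: "\<phi> \<in> hom G integer_group" "\<phi> ` carrier G = UNIV"
    unfolding assms(5) by (rule abf_projection_hom[OF assms(1,4)])+
  have "1 \<in> \<phi> ` carrier G" unfolding \<phi>(2) by simp
  then obtain t0 where t0: "t0 \<in> carrier G" "\<phi> t0 = 1" by (elim imageE) simp
  interpret group G by (rule assms(1))
  interpret presented_cyclic G \<phi> P \<pi> t0
    by unfold_locales (use \<phi>(1) \<pi> t0 in \<open>auto simp: hom_def integer_group_def\<close>)
  have "z j \<in> nonzero_roots \<Delta>" using assms(9) j by blast
  then have zj: "z j \<noteq> 0" and root: "leval (complexify \<Delta>) (z j) = 0" unfolding nonzero_roots_def by auto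
  have root0: "fps_nth (int_expansion (z j) \<Delta>) 0 = 0"
    unfolding expansion_complexify[symmetric] expansion_coeff_0[OF zj] by (rule root)
  have z1: "z j \<noteq> 1"
  proof
    assume "z j = 1"
    from root0[unfolded this] alexander_polynomial_at_1[OF assms(3) gcd] show False by (rule notE[rotated])
  qed
  have "\<Delta> \<noteq> 0"
  proof
    assume "\<Delta> = 0"
    have "\<Delta> \<doteq> lconst 0"
      unfolding \<open>\<Delta> = 0\<close> eq_up_to_unit_def by (rule exI[of _ 1]) simp
    with assms(7) show False by (elim notE) (rule exI)
  qed
  have order: "fps_X ^ k dvd int_expansion (z j) \<Delta> \<longleftrightarrow> k \<le> \<mu> j" for k
    by (rule fps_X_power_dvd_expansion_iff[OF assms(10,8) j zj])
  obtain \<Phi> where \<Phi>: "\<Phi> \<in> LinearCombinations.module_hom class_ring BC (primary_decomposition_module s z e)"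
    and bij: "bij_betw \<Phi> (carrier BC) (carrier (primary_decomposition_module s z e))"
    using assms(12) unfolding module_isomorphic_def by blast
  have "(\<forall>f. bc_hom (dual_value (z j)) f \<longrightarrow> (\<forall>Y\<in>carrier BC. eps * f Y = 0)) \<longleftrightarrow> (\<forall>k>1. e k (z j) = 0)"
  proof (intro iffI allI impI ballI)
    fix f Y assume simple: "\<forall>k>1. e k (z j) = 0" and f: "bc_hom (dual_value (z j)) f" and Y: "Y \<in> carrier BC"
    show "eps * f Y = 0"
      by (rule semisimple_imp_eps_kills[OF \<Phi> bij_betw_imp_inj_on[OF bij] BC_smult_closed assms(8) j zj
          assms(11) simple _ Y]) (use f in \<open>auto simp: bc_hom_def\<close>)
  next
    fix k :: nat
    assume kill: "\<forall>f. bc_hom (dual_value (z j)) f \<longrightarrow> (\<forall>Y\<in>carrier BC. eps * f Y = 0)" and k: "1 < k"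
    show "e k (z j) = 0"
    proof (rule ccontr)
      assume "e k (z j) \<noteq> 0"
      from eps_detects_higher_summand[where z = z and e = e, OF \<Phi> bij_betw_imp_surj_on[OF bij] j zj k this]
      obtain f a where f: "bc_hom (dual_value (z j)) f" and a: "a \<in> carrier BC" "f a = 1"
        unfolding bc_hom_def by blast
      have "eps * f a = 0" using kill f a(1) by blast
      then show False unfolding a(2) eps_mult_eq_0_iff by simp
    qed
  qed
  then show "twisted_b1 G (\<lambda>g. z j powi \<phi> g) = \<mu> j \<longleftrightarrow> (\<forall>k>1. e k (z j) = 0)"
    using twisted_b1_eq_order_iff[OF gcd \<open>\<Delta> \<noteq> 0\<close> order zj z1] by simp
qed

end
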